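(* Let $0<r<1$. For every $\phi\in H^{\infty}(A_r)$, the quantity $$\min\Big\{\|\psi\|_{\mathrm{Mult}(H^2_2)}:\ \psi\in\mathrm{Mult}(H^2_2)\ \text{ and }\ \psi\Big(\frac{z}{\sqrt{r^2+1}},\frac{r}{\sqrt{r^2+1}}\frac{1}{z}\Big)=\phi(z)\ \text{ for all } z\in A_r\Big\}$$ (where, in particular, the set is nonempty and the minimum is attained) lies in the interval $\big[\|\phi\|_\infty,\sqrt{2}\,\|\phi\|_\infty\big]$. Moreover, the constant $\sqrt{2}$ is the best possible: for no constant $C<\sqrt{2}$ is this quantity at most $C\|\phi\|_\infty$ for all $\phi\in H^\infty(A_r)$.
   Context: For $0<r<1$, $A_r=\{z\in\mathbb{C}: r<|z|<1\}$, $H^\infty(A_r)$ is the algebra of bounded holomorphic functions on $A_r$, and $\|\phi\|_\infty=\sup_{z\in A_r}|\phi(z)|$. $\mathbb{B}_2=\{(z_1,z_2)\in\mathbb{C}^2:|z_1|^2+|z_2|^2<1\}$. The Drury–Arveson space $H^2_2$ is the reproducing kernel Hilbert space of functions on $\mathbb{B}_2$ with kernel $a_2(\lambda,\mu)=\frac{1}{1-\langle\lambda,\mu\rangle_{\mathbb{C}^2}}$. $\mathrm{Mult}(H^2_2)$ is the set of functions $\psi:\mathbb{B}_2\to\mathbb{C}$ for which $M_\psi f:=\psi f$ defines a bounded operator $M_\psi$ on $H^2_2$, and $\|\psi\|_{\mathrm{Mult}(H^2_2)}$ is the operator norm of $M_\psi$. For $z\in A_r$ the point $\big(\frac{z}{\sqrt{r^2+1}},\frac{r}{\sqrt{r^2+1}}\frac1z\big)$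 lies in $\mathbb{B}_2$. *)

theory Defs
  imports "HOL-Complex_Analysis.Complex_Analysis"
begin

section \<open>Reproducing kernel Hilbert spaces\<close>

text \<open>
  A complex Hilbert space of functions on a set \<open>X\<close> is given by its carrier \<open>H\<close> and its inner
  product \<open>ip\<close>, linear in the first argument.  HOL functions are total, so a function on \<open>X\<close> is
  represented by the total function that vanishes off \<open>X\<close>; this makes equality of functions on
  \<open>X\<close> coincide with HOL equality.  The values of \<open>ip\<close> outside \<open>H\<close> are irrelevant.
\<close>

definition ip_norm :: "(('a \<Rightarrow> complex) \<Rightarrow> ('a \<Rightarrow> complex) \<Rightarrow> complex) \<Rightarrow> ('a \<Rightarrow> complex) \<Rightarrow> real" where
  "ip_norm ip f = sqrt (Re (ip f f))"

locale hilbert_function_space =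
  fixes X :: "'a set"
    and H :: "('a \<Rightarrow> complex) set"
    and ip :: "('a \<Rightarrow> complex) \<Rightarrow> ('a \<Rightarrow> complex) \<Rightarrow> complex"
  assumes vanishes_off: "\<lbrakk>f \<in> H; x \<notin> X\<rbrakk> \<Longrightarrow> f x = 0"
    and zero_mem: "(\<lambda>x. 0) \<in> H"
    and add_mem: "\<lbrakk>f \<in> H; g \<in> H\<rbrakk> \<Longrightarrow> (\<lambda>x. f x + g x) \<in> H"
    and scale_mem: "f \<in> H \<Longrightarrow> (\<lambda>x. a * f x) \<in> H"
    and ip_add: "\<lbrakk>f \<in> H; g \<in> H; h \<in> H\<rbrakk> \<Longrightarrow> ip (\<lambda>x. f x + g x) h = ip f h + ip g h"
    and ip_scale: "\<lbrakk>f \<in> H; h \<in> H\<rbrakk> \<Longrightarrow> ip (\<lambda>x. a * f x) h = a * ip f h"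
    and ip_cnj: "\<lbrakk>f \<in> H; g \<in> H\<rbrakk> \<Longrightarrow> ip g f = cnj (ip f g)"
    and ip_nonneg: "f \<in> H \<Longrightarrow> 0 \<le> Re (ip f f)"
    and ip_definite: "\<lbrakk>f \<in> H; ip f f = 0\<rbrakk> \<Longrightarrow> f = (\<lambda>x. 0)"
    and complete: "\<lbrakk>\<And>n. F n \<in> H;
        \<forall>e>0. \<exists>N. \<forall>m\<ge>N. \<forall>n\<ge>N. ip_norm ip (\<lambda>x. F m x - F n x) < e\<rbrakk>
      \<Longrightarrow> \<exists>f\<in>H. (\<lambda>n. ip_norm ip (\<lambda>x. F n x - f x)) \<longlonglongrightarrow> 0"

locale rkhs = hilbert_function_space X H ip
  for X :: "'a set"
    and K :: "'a \<Rightarrow> 'a \<Rightarrow> complex"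
    and H :: "('a \<Rightarrow> complex) set"
    and ip :: "('a \<Rightarrow> complex) \<Rightarrow> ('a \<Rightarrow> complex) \<Rightarrow> complex" +
  assumes kernel_mem: "y \<in> X \<Longrightarrow> (\<lambda>x. if x \<in> X then K x y else 0) \<in> H"
    and reproducing: "\<lbrakk>f \<in> H; y \<in> X\<rbrakk> \<Longrightarrow> ip f (\<lambda>x. if x \<in> X then K x y else 0) = f y"

text \<open>
  Since members of \<open>H\<close> vanish off \<open>X\<close>, only the values of \<open>\<psi>\<close> on \<open>X\<close> matter in the next two
  definitions.  The multiplier norm is the operator norm of \<open>f \<mapsto> \<psi> f\<close>.
\<close>

definition multipliers ::
  "('a \<Rightarrow> complex) set \<Rightarrow> (('a \<Rightarrow> complex) \<Rightarrow> ('a \<Rightarrow> complex) \<Rightarrow> complex) \<Rightarrow> ('a \<Rightarrow> complex) set" where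
  "multipliers H ip = {\<psi>. (\<forall>f\<in>H. (\<lambda>x. \<psi> x * f x) \<in> H) \<and>
     (\<exists>C. \<forall>f\<in>H. ip_norm ip (\<lambda>x. \<psi> x * f x) \<le> C * ip_norm ip f)}"

definition mult_norm ::
  "('a \<Rightarrow> complex) set \<Rightarrow> (('a \<Rightarrow> complex) \<Rightarrow> ('a \<Rightarrow> complex) \<Rightarrow> complex) \<Rightarrow> ('a \<Rightarrow> complex) \<Rightarrow> real" where
  "mult_norm H ip \<psi> = (SUP f\<in>{f \<in> H. ip_norm ip f \<le> 1}. ip_norm ip (\<lambda>x. \<psi> x * f x))"


section \<open>The Drury--Arveson space on the unit ball of \<open>\<complex>\<^sup>2\<close>\<close>

definition unit_ball2 :: "(complex \<times> complex) set" where
  "unit_ball2 = {(z1, z2). (cmod z1)\<^sup>2 + (cmod z2)\<^sup>2 < 1}"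

definition cinner2 :: "complex \<times> complex \<Rightarrow> complex \<times> complex \<Rightarrow> complex" where
  "cinner2 l m = fst l * cnj (fst m) + snd l * cnj (snd m)"

definition da_kernel :: "complex \<times> complex \<Rightarrow> complex \<times> complex \<Rightarrow> complex" where
  "da_kernel l m = 1 / (1 - cinner2 l m)"

abbreviation drury_arveson ::
  "(complex \<times> complex \<Rightarrow> complex) set \<Rightarrow>
   ((complex \<times> complex \<Rightarrow> complex) \<Rightarrow> (complex \<times> complex \<Rightarrow> complex) \<Rightarrow> complex) \<Rightarrow> bool" where
  "drury_arveson H ip \<equiv> rkhs unit_ball2 da_kernel H ip"


section \<open>Bounded holomorphic functions on an annulus and their extensions\<close>

definition annulus :: "real \<Rightarrow> complex set" where
  "annulus r = {z. r < cmod z \<and> cmod z < 1}"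

definition Hinf :: "complex set \<Rightarrow> (complex \<Rightarrow> complex) set" where
  "Hinf A = {\<phi>. \<phi> holomorphic_on A \<and> bounded (\<phi> ` A)}"

definition sup_norm :: "complex set \<Rightarrow> (complex \<Rightarrow> complex) \<Rightarrow> real" where
  "sup_norm A \<phi> = (SUP z\<in>A. cmod (\<phi> z))"

definition annulus_embedding :: "real \<Rightarrow> complex \<Rightarrow> complex \<times> complex" where
  "annulus_embedding r z =
     (z / of_real (sqrt (r\<^sup>2 + 1)), of_real (r / sqrt (r\<^sup>2 + 1)) * (1 / z))"

definition extension_norms ::
  "(complex \<times> complex \<Rightarrow> complex) set \<Rightarrow>
   ((complex \<times> complex \<Rightarrow> complex) \<Rightarrow> (complex \<times> complex \<Rightarrow> complex) \<Rightarrow> complex) \<Rightarrow>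
   real \<Rightarrow> (complex \<Rightarrow> complex) \<Rightarrow> real set" where
  "extension_norms H ip r \<phi> = {mult_norm H ip \<psi> | \<psi>.
     \<psi> \<in> multipliers H ip \<and> (\<forall>z\<in>annulus r. \<psi> (annulus_embedding r z) = \<phi> z)}"

section \<open>Existence of the Drury--Arveson space\<close>

text \<open>
  The assumptions of \<open>drury_arveson\<close> are satisfiable: the space is realised by the feature map
  \<open>x \<mapsto> (sqrt ((i + j) choose i) x\<^sub>1\<^sup>i x\<^sub>2\<^sup>j)\<^bsub>i,j\<^esub>\<close> into \<open>\<ell>\<^sup>2\<close>.
\<close>

definition l2 :: "('i \<Rightarrow> complex) \<Rightarrow> bool" where
  "l2 c \<longleftrightarrow> (\<lambda>i. (cmod (c i))\<^sup>2) summable_on UNIV"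

lemma l2_mult: "l2 c \<Longrightarrow> l2 d \<Longrightarrow> (\<lambda>i. c i * d i) summable_on UNIV"
  unfolding l2_def
  by (rule abs_summable_summable, rule abs_summable_product)
     (simp_all add: norm_mult power2_eq_square)

lemma l2_cnj [simp]: "l2 (\<lambda>i. cnj (c i)) \<longleftrightarrow> l2 c"
  by (simp add: l2_def)

lemma l2_scale: "l2 c \<Longrightarrow> l2 (\<lambda>i. a * c i)"
  unfolding l2_def by (simp add: norm_mult power_mult_distrib summable_on_cmult_right)

lemma l2_add:
  assumes "l2 c" "l2 d"
  shows "l2 (\<lambda>i. c i + d i)"
proof -
  have "(\<lambda>i. 2 * (cmod (c i))\<^sup>2 + 2 * (cmod (d i))\<^sup>2) summable_on UNIV"
    using assms unfolding l2_def by (intro summable_on_add summable_on_cmult_right)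
  moreover have "(cmod (c i + d i))\<^sup>2 \<le> 2 * (cmod (c i))\<^sup>2 + 2 * (cmod (d i))\<^sup>2" for i
  proof -
    have "(cmod (c i + d i))\<^sup>2 \<le> (cmod (c i) + cmod (d i))\<^sup>2"
      by (intro power_mono norm_triangle_ineq) auto
    also have "\<dots> \<le> 2 * (cmod (c i))\<^sup>2 + 2 * (cmod (d i))\<^sup>2"
      using sum_squares_bound[of "cmod (c i)" "cmod (d i)"] by (simp add: power2_sum)
    finally show ?thesis .
  qed
  ultimately show ?thesis
    unfolding l2_def by (rule summable_on_comparison_test) auto
qed

lemma l2_diff: "l2 c \<Longrightarrow> l2 d \<Longrightarrow> l2 (\<lambda>i. c i - d i)"
  using l2_add[of c "\<lambda>i. (-1) * d i"] l2_scale[of d "-1"] by simp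

lemma l2_ip_self:
  assumes "l2 c"
  shows "(\<Sum>\<^sub>\<infinity>i. c i * cnj (c i)) = of_real (\<Sum>\<^sub>\<infinity>i. (cmod (c i))\<^sup>2)"
proof (rule infsumI)
  have "((\<lambda>i. of_real ((cmod (c i))\<^sup>2)) has_sum complex_of_real (\<Sum>\<^sub>\<infinity>i. (cmod (c i))\<^sup>2)) UNIV"
    using assms unfolding l2_def by (intro has_sum_of_real has_sum_infsum)
  then show "((\<lambda>i. c i * cnj (c i)) has_sum of_real (\<Sum>\<^sub>\<infinity>i. (cmod (c i))\<^sup>2)) UNIV"
    by (simp only: complex_norm_square)
qed

lemma l2_complete:
  fixes F :: "nat \<Rightarrow> 'i \<Rightarrow> complex"
  assumes F: "\<And>n. l2 (F n)"
    and cauchy: "\<And>e. e > 0 \<Longrightarrow> \<exists>N. \<forall>m\<ge>N. \<forall>n\<ge>N. sqrt (\<Sum>\<^sub>\<infinity>i. (cmod (F m i - F n i))\<^sup>2) < e"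
  shows "\<exists>c. l2 c \<and> (\<lambda>n. sqrt (\<Sum>\<^sub>\<infinity>i. (cmod (F n i - c i))\<^sup>2)) \<longlonglongrightarrow> 0"
proof -
  have part: "(\<Sum>i\<in>B. (cmod (F m i - F n i))\<^sup>2) \<le> (\<Sum>\<^sub>\<infinity>i. (cmod (F m i - F n i))\<^sup>2)"
    if "finite B" for B m n
    using l2_diff[OF F F, of m n] that unfolding l2_def by (intro finite_sum_le_infsum) auto
  have fin: "\<exists>N. \<forall>m\<ge>N. \<forall>n\<ge>N. \<forall>B. finite B \<longrightarrow> (\<Sum>i\<in>B. (cmod (F m i - F n i))\<^sup>2) \<le> e\<^sup>2"
    if e: "e > 0" for e
  proof -
    obtain N where N: "\<And>m n. m \<ge> N \<Longrightarrow> n \<ge> N \<Longrightarrow>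
        sqrt (\<Sum>\<^sub>\<infinity>i. (cmod (F m i - F n i))\<^sup>2) < e"
      using cauchy[OF e] by blast
    have "(\<Sum>\<^sub>\<infinity>i. (cmod (F m i - F n i))\<^sup>2) \<le> e\<^sup>2" if "m \<ge> N" "n \<ge> N" for m n
      using N[OF that] e by (meson less_imp_le real_le_lsqrt real_sqrt_le_iff sqrt_le_D)
    then show ?thesis using part by (meson order_trans)
  qed
  have "Cauchy (\<lambda>n. F n i)" for i
  proof (rule metric_CauchyI)
    fix e :: real assume e: "e > 0"
    then obtain N where N: "\<And>m n B. m \<ge> N \<Longrightarrow> n \<ge> N \<Longrightarrow> finite B \<Longrightarrow>
        (\<Sum>i\<in>B. (cmod (F m i - F n i))\<^sup>2) \<le> (e/2)\<^sup>2"
      using fin[of "e/2"] by auto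
    have "dist (F m i) (F n i) < e" if "m \<ge> N" "n \<ge> N" for m n
    proof -
      have "(cmod (F m i - F n i))\<^sup>2 \<le> (e/2)\<^sup>2" using N[OF that, of "{i}"] by simp
      then have "cmod (F m i - F n i) \<le> e/2" by (rule power2_le_imp_le) (use e in simp)
      then show ?thesis using e by (simp add: dist_norm)
    qed
    then show "\<exists>M. \<forall>m\<ge>M. \<forall>n\<ge>M. dist (F m i) (F n i) < e" by blast
  qed
  then have "\<forall>i. \<exists>l. (\<lambda>n. F n i) \<longlonglongrightarrow> l"
    by (simp add: Cauchy_convergent_iff convergent_def)
  then obtain c where c: "\<And>i. (\<lambda>n. F n i) \<longlonglongrightarrow> c i" by metis
  have lim: "\<exists>N. \<forall>n\<ge>N. l2 (\<lambda>i. F n i - c i) \<and> (\<Sum>\<^sub>\<infinity>i. (cmod (F n i - c i))\<^sup>2) \<le> e\<^sup>2"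
    if e: "e > 0" for e
  proof -
    obtain N where N: "\<And>m n B. m \<ge> N \<Longrightarrow> n \<ge> N \<Longrightarrow> finite B \<Longrightarrow>
        (\<Sum>i\<in>B. (cmod (F m i - F n i))\<^sup>2) \<le> e\<^sup>2"
      using fin[OF e] by auto
    have bd: "(\<Sum>i\<in>B. (cmod (F n i - c i))\<^sup>2) \<le> e\<^sup>2" if "n \<ge> N" "finite B" for n B
    proof (rule LIMSEQ_le_const2)
      show "(\<lambda>m. \<Sum>i\<in>B. (cmod (F n i - F m i))\<^sup>2) \<longlonglongrightarrow> (\<Sum>i\<in>B. (cmod (F n i - c i))\<^sup>2)"
        by (intro tendsto_intros c)
      show "\<exists>M. \<forall>m\<ge>M. (\<Sum>i\<in>B. (cmod (F n i - F m i))\<^sup>2) \<le> e\<^sup>2"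
        using N that by blast
    qed
    have l: "l2 (\<lambda>i. F n i - c i)" if "n \<ge> N" for n
      unfolding l2_def
      by (rule nonneg_bdd_above_summable_on) (use bd[OF that] in \<open>auto intro!: bdd_aboveI2\<close>)
    have "(\<Sum>\<^sub>\<infinity>i. (cmod (F n i - c i))\<^sup>2) \<le> e\<^sup>2" if "n \<ge> N" for n
      using l[OF that] bd[OF that] unfolding l2_def by (intro infsum_le_finite_sums) auto
    with l show ?thesis by blast
  qed
  obtain N where "l2 (\<lambda>i. F N i - c i)" using lim[of 1] by auto
  then have lc: "l2 c" using l2_diff[OF F[of N], of "\<lambda>i. F N i - c i"] by simp
  have "(\<lambda>n. sqrt (\<Sum>\<^sub>\<infinity>i. (cmod (F n i - c i))\<^sup>2)) \<longlonglongrightarrow> 0"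
  proof (rule LIMSEQ_I)
    fix e :: real assume e: "e > 0"
    then obtain N where N: "\<And>n. n \<ge> N \<Longrightarrow> (\<Sum>\<^sub>\<infinity>i. (cmod (F n i - c i))\<^sup>2) \<le> (e/2)\<^sup>2"
      using lim[of "e/2"] by auto
    have "norm (sqrt (\<Sum>\<^sub>\<infinity>i. (cmod (F n i - c i))\<^sup>2) - 0) < e" if "n \<ge> N" for n
    proof -
      have "sqrt (\<Sum>\<^sub>\<infinity>i. (cmod (F n i - c i))\<^sup>2) \<le> e/2"
        using real_sqrt_le_mono[OF N[OF that]] e by simp
      moreover have "0 \<le> sqrt (\<Sum>\<^sub>\<infinity>i. (cmod (F n i - c i))\<^sup>2)" by (simp add: infsum_nonneg)
      ultimately show ?thesis using e by simp
    qed
    then show "\<exists>N. \<forall>n\<ge>N. norm (sqrt (\<Sum>\<^sub>\<infinity>i. (cmod (F n i - c i))\<^sup>2) - 0) < e" by blast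
  qed
  with lc show ?thesis by blast
qed

lemma rkhs_of_feature_map:
  fixes e :: "'i \<Rightarrow> 'a \<Rightarrow> complex"
  assumes off: "\<And>i x. x \<notin> X \<Longrightarrow> e i x = 0"
    and sq: "\<And>x. x \<in> X \<Longrightarrow> l2 (\<lambda>i. e i x)"
    and indep: "\<And>c. l2 c \<Longrightarrow> (\<And>x. x \<in> X \<Longrightarrow> (\<Sum>\<^sub>\<infinity>i. c i * e i x) = 0) \<Longrightarrow> c = (\<lambda>i. 0)"
    and K: "\<And>x y. x \<in> X \<Longrightarrow> y \<in> X \<Longrightarrow> K x y = (\<Sum>\<^sub>\<infinity>i. cnj (e i y) * e i x)"
  shows "\<exists>H ip. rkhs X K H ip"
proof -
  define S where "S = (\<lambda>c x. \<Sum>\<^sub>\<infinity>i. c i * e i x)"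
  define H where "H = S ` Collect l2"
  define T where "T = inv_into (Collect l2) S"
  define ip where "ip = (\<lambda>f g. \<Sum>\<^sub>\<infinity>i. T f i * cnj (T g i))"
  have sqx: "l2 (\<lambda>i. e i x)" for x
    using sq[of x] off[of x] by (cases "x \<in> X") (auto simp: l2_def)
  have S_add: "S (\<lambda>i. c i + d i) = (\<lambda>x. S c x + S d x)" if "l2 c" "l2 d" for c d
    unfolding S_def using l2_mult[OF that(1) sqx] l2_mult[OF that(2) sqx]
    by (auto simp: distrib_right infsum_add)
  have S_scale: "S (\<lambda>i. a * c i) = (\<lambda>x. a * S c x)" for a c
    unfolding S_def by (simp add: mult.assoc infsum_cmult_right')
  have S_diff: "S (\<lambda>i. c i - d i) = (\<lambda>x. S c x - S d x)" if "l2 c" "l2 d" for c d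
    using S_add[OF that(1) l2_scale[OF that(2), of "-1"]] S_scale[of "-1" d] by simp
  have S_off: "S c x = 0" if "x \<notin> X" for c x using off[OF that] by (simp add: S_def)
  have inj: "inj_on S (Collect l2)"
  proof (rule inj_onI)
    fix c d assume cd: "c \<in> Collect l2" "d \<in> Collect l2" "S c = S d"
    then have "S (\<lambda>i. c i - d i) = (\<lambda>x. 0)" by (subst S_diff) auto
    then have "(\<lambda>i. c i - d i) = (\<lambda>i. 0)"
      using cd by (intro indep l2_diff) (auto simp: S_def fun_eq_iff)
    then show "c = d" by (simp add: fun_eq_iff)
  qed
  have TS: "T (S c) = c" if "l2 c" for c using inj that by (simp add: T_def)
  have ip: "ip (S c) (S d) = (\<Sum>\<^sub>\<infinity>i. c i * cnj (d i))" if "l2 c" "l2 d" for c d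
    using that by (simp add: ip_def TS)
  have nrm: "ip_norm ip (S c) = sqrt (\<Sum>\<^sub>\<infinity>i. (cmod (c i))\<^sup>2)" if "l2 c" for c
    using that by (simp add: ip_norm_def ip l2_ip_self)
  have HE: "\<exists>c. f = S c \<and> l2 c" if "f \<in> H" for f
    using that by (auto simp: H_def)
  have HI: "l2 c \<Longrightarrow> S c \<in> H" for c by (simp add: H_def)
  have kern: "(\<lambda>x. if x \<in> X then K x y else 0) = S (\<lambda>i. cnj (e i y))" if "y \<in> X" for y
    using that by (auto simp: K S_off fun_eq_iff) (simp add: S_def)
  have "rkhs X K H ip"
  proof unfold_locales
    fix f x assume "f \<in> H" "x \<notin> X"
    then show "f x = 0" by (auto simp: H_def S_off)
  next
    show "(\<lambda>x. 0) \<in> H" using HI[of "\<lambda>i. 0"] by (simp add: S_def l2_def)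
  next
    fix f g assume "f \<in> H" "g \<in> H"
    then obtain c d where s: "f = S c" "l2 c" "g = S d" "l2 d" using HE by meson
    then show "(\<lambda>x. f x + g x) \<in> H"
      using HI[OF l2_add[OF s(2,4)]] S_add[OF s(2,4)] by simp
  next
    fix f a assume "f \<in> H"
    then obtain c where s: "f = S c" "l2 c" using HE by blast
    then show "(\<lambda>x. a * f x) \<in> H" using HI[OF l2_scale[OF s(2)], of a] S_scale[of a c] by simp
  next
    fix f g h assume "f \<in> H" "g \<in> H" "h \<in> H"
    then obtain c d b where s: "f = S c" "l2 c" "g = S d" "l2 d" "h = S b" "l2 b"
      using HE by meson
    have "ip (\<lambda>x. f x + g x) h = (\<Sum>\<^sub>\<infinity>i. c i * cnj (b i) + d i * cnj (b i))"
      using ip[OF l2_add[OF s(2,4)] s(6)] S_add[OF s(2,4)] by (simp add: s distrib_right)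
    also have "\<dots> = (\<Sum>\<^sub>\<infinity>i. c i * cnj (b i)) + (\<Sum>\<^sub>\<infinity>i. d i * cnj (b i))"
      using l2_mult[of c "\<lambda>i. cnj (b i)"] l2_mult[of d "\<lambda>i. cnj (b i)"] s
      by (intro infsum_add) simp_all
    finally show "ip (\<lambda>x. f x + g x) h = ip f h + ip g h" using s by (simp add: ip)
  next
    fix f h a assume "f \<in> H" "h \<in> H"
    then obtain c b where s: "f = S c" "l2 c" "h = S b" "l2 b" using HE by blast
    then show "ip (\<lambda>x. a * f x) h = a * ip f h"
      using ip[OF l2_scale[OF s(2), of a] s(4)] S_scale[of a c]
      by (simp add: ip mult.assoc infsum_cmult_right')
  next
    fix f g assume "f \<in> H" "g \<in> H"
    then obtain c b where s: "f = S c" "l2 c" "g = S b" "l2 b" using HE by blast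
    then show "ip g f = cnj (ip f g)"
      using infsum_cnj[of "\<lambda>i. c i * cnj (b i)" UNIV] by (simp add: ip mult.commute)
  next
    fix f assume "f \<in> H"
    then obtain c where "f = S c" "l2 c" using HE by blast
    then show "0 \<le> Re (ip f f)" by (simp add: ip l2_ip_self infsum_nonneg)
  next
    fix f assume "f \<in> H" "ip f f = 0"
    then obtain c where s: "f = S c" "l2 c" using HE by blast
    with \<open>ip f f = 0\<close> have "(\<Sum>\<^sub>\<infinity>i. (cmod (c i))\<^sup>2) = 0" by (simp add: ip l2_ip_self)
    then have "(\<lambda>i. (cmod (c i))\<^sup>2) i = 0" for i
      using s(2) unfolding l2_def by (intro nonneg_infsum_le_0D[where A = UNIV]) simp_all
    then show "f = (\<lambda>x. 0)" using s by (simp add: S_def)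
  next
    fix F :: "nat \<Rightarrow> 'a \<Rightarrow> complex"
    assume FH: "\<And>n. F n \<in> H"
      and cau: "\<forall>e>0. \<exists>N. \<forall>m\<ge>N. \<forall>n\<ge>N. ip_norm ip (\<lambda>x. F m x - F n x) < e"
    have "\<forall>n. \<exists>c. F n = S c \<and> l2 c" using FH HE by blast
    then obtain G where G: "\<And>n. F n = S (G n)" "\<And>n. l2 (G n)" by metis
    have nF: "ip_norm ip (\<lambda>x. F m x - F n x) = sqrt (\<Sum>\<^sub>\<infinity>i. (cmod (G m i - G n i))\<^sup>2)" for m n
      using nrm[OF l2_diff[OF G(2)[of m] G(2)[of n]]] S_diff[OF G(2)[of m] G(2)[of n]]
      by (simp add: G(1))
    obtain c where c: "l2 c" "(\<lambda>n. sqrt (\<Sum>\<^sub>\<infinity>i. (cmod (G n i - c i))\<^sup>2)) \<longlonglongrightarrow> 0"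
      using l2_complete[OF G(2) cau[unfolded nF, rule_format]] by blast
    have "ip_norm ip (\<lambda>x. F n x - S c x) = sqrt (\<Sum>\<^sub>\<infinity>i. (cmod (G n i - c i))\<^sup>2)" for n
      using nrm[OF l2_diff[OF G(2)[of n] c(1)]] S_diff[OF G(2)[of n] c(1)] by (simp add: G(1))
    then have "(\<lambda>n. ip_norm ip (\<lambda>x. F n x - S c x)) \<longlonglongrightarrow> 0" using c(2) by simp
    with HI[OF c(1)] show "\<exists>f\<in>H. (\<lambda>n. ip_norm ip (\<lambda>x. F n x - f x)) \<longlonglongrightarrow> 0" by blast
  next
    fix y assume "y \<in> X"
    then show "(\<lambda>x. if x \<in> X then K x y else 0) \<in> H" using kern HI sq by simp
  next
    fix f y assume "f \<in> H" "y \<in> X"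
    then obtain c where s: "f = S c" "l2 c" using HE by blast
    then have "ip f (S (\<lambda>i. cnj (e i y))) = f y"
      using ip[of c "\<lambda>i. cnj (e i y)"] sqx by (simp add: S_def)
    then show "ip f (\<lambda>x. if x \<in> X then K x y else 0) = f y" using kern \<open>y \<in> X\<close> by simp
  qed
  then show ?thesis by blast
qed

lemma powser_eq_0:
  fixes a :: "nat \<Rightarrow> complex"
  assumes "r > 0" "\<And>x. cmod x < r \<Longrightarrow> (\<lambda>n. a n * x ^ n) sums 0"
  shows "a m = 0"
proof (rule ccontr)
  assume am: "a m \<noteq> 0"
  define f :: "complex \<Rightarrow> complex" where "f = (\<lambda>x. 0)"
  have "a 0 = 0" using assms(2)[of 0] assms(1) by simp
  then have m: "m > 0" using am by (cases m) auto
  have sm: "(\<lambda>n. a n * (x - 0) ^ n) sums f x" if "cmod (x - 0) < r" for x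
    using assms(2)[of x] that by (simp add: f_def)
  have f0: "f 0 = 0" by (simp add: f_def)
  obtain s where "s > 0" and s: "\<And>z. z \<in> cball 0 s - {0} \<Longrightarrow> f z \<noteq> 0"
    using powser_0_nonzero[OF assms(1) sm f0 am m] by blast
  then show False using s[of "of_real s"] by (simp add: f_def)
qed

definition da_feature :: "nat \<times> nat \<Rightarrow> complex \<times> complex \<Rightarrow> complex" where
  "da_feature i x = (if x \<in> unit_ball2
     then of_real (sqrt (real ((fst i + snd i) choose fst i))) * fst x ^ fst i * snd x ^ snd i else 0)"

lemma binomial_double_sum:
  fixes u v :: complex
  assumes "cmod u + cmod v < 1"
  shows "((\<lambda>(i, j). of_nat ((i + j) choose i) * u ^ i * v ^ j) has_sum (1 / (1 - (u + v)))) UNIV"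
    (is "(?f has_sum _) _")
proof -
  have bij: "bij_betw (\<lambda>(n, k). (k, n - k)) (SIGMA n:UNIV. {..n::nat}) (UNIV :: (nat \<times> nat) set)"
    by (rule bij_betwI[where g = "\<lambda>(i, j). (i + j, i)"]) auto
  have inner: "(\<Sum>k\<le>n. (of_nat (n choose k) * (x ^ k * y ^ (n - k)))) = (x + y) ^ n"
    for x y :: "'z::comm_ring_1" and n
    by (simp add: binomial_ring mult.assoc)
  have abs: "(\<lambda>x. cmod (case x of (n, k) \<Rightarrow> of_nat (n choose k) * (u ^ k * v ^ (n - k))))
      summable_on (SIGMA n:UNIV. {..n})"
  proof -
    have "(\<lambda>(n, k). of_nat (n choose k) * (cmod u ^ k * cmod v ^ (n - k))) summable_on
        (SIGMA n:UNIV. {..n})"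
    proof (rule summable_on_SigmaI)
      show "(\<lambda>n. (cmod u + cmod v) ^ n) summable_on UNIV"
        using assms by (intro summable_nonneg_imp_summable_on) (auto simp: summable_geometric)
    qed (auto intro!: has_sum_finiteI simp: inner)
    then show ?thesis by (simp add: case_prod_unfold norm_mult norm_power)
  qed
  have n: "cmod (u + v) < 1" using assms norm_triangle_ineq[of u v] by simp
  have "((\<lambda>n. (u + v) ^ n) has_sum (1 / (1 - (u + v)))) UNIV"
    by (rule norm_summable_imp_has_sum)
       (use n in \<open>auto simp: norm_power summable_geometric intro!: geometric_sums\<close>)
  then have "((\<lambda>(n, k). of_nat (n choose k) * (u ^ k * v ^ (n - k))) has_sum (1 / (1 - (u + v))))
      (SIGMA n:UNIV. {..n})"
    by (intro has_sum_SigmaI[OF _ _ abs_summable_summable[OF abs]])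
       (auto intro!: has_sum_finiteI simp: inner)
  then have "((\<lambda>x. ?f ((\<lambda>(n, k). (k, n - k)) x)) has_sum (1 / (1 - (u + v)))) (SIGMA n:UNIV. {..n})"
    by (rule has_sum_cong[THEN iffD1, rotated]) (auto simp: mult.assoc)
  then show ?thesis using has_sum_reindex_bij_betw[OF bij, of ?f] by simp
qed

lemma cmod_cinner2_bound:
  assumes "x \<in> unit_ball2" "y \<in> unit_ball2"
  shows "cmod (fst x * cnj (fst y)) + cmod (snd x * cnj (snd y)) < 1"
proof -
  have "2 * (cmod (fst x) * cmod (fst y)) \<le> (cmod (fst x))\<^sup>2 + (cmod (fst y))\<^sup>2"
    "2 * (cmod (snd x) * cmod (snd y)) \<le> (cmod (snd x))\<^sup>2 + (cmod (snd y))\<^sup>2"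
    using sum_squares_bound[of "cmod (fst x)" "cmod (fst y)"]
      sum_squares_bound[of "cmod (snd x)" "cmod (snd y)"] by (simp_all add: mult.assoc)
  then show ?thesis using assms by (auto simp: unit_ball2_def norm_mult)
qed

lemma da_kernel_has_sum:
  assumes "x \<in> unit_ball2" "y \<in> unit_ball2"
  shows "((\<lambda>i. cnj (da_feature i y) * da_feature i x) has_sum da_kernel x y) UNIV"
proof -
  have "cnj (da_feature i y) * da_feature i x =
    (\<lambda>(i, j). of_nat ((i + j) choose i) * (fst x * cnj (fst y)) ^ i * (snd x * cnj (snd y)) ^ j) i"
    for i
  proof -
    let ?s = "sqrt (real (fst i + snd i choose fst i))"
    have "of_real ?s * of_real ?s = (of_nat (fst i + snd i choose fst i) :: complex)"
      by (simp flip: of_real_mult)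
    then show ?thesis using assms
      by (simp add: da_feature_def case_prod_unfold power_mult_distrib mult_ac)
  qed
  then show ?thesis
    using binomial_double_sum[OF cmod_cinner2_bound[OF assms]]
    by (simp add: da_kernel_def cinner2_def)
qed

lemma l2_da_feature:
  assumes "x \<in> unit_ball2"
  shows "l2 (\<lambda>i. da_feature i x)"
proof -
  have "(\<lambda>i. cnj (da_feature i x) * da_feature i x) summable_on UNIV"
    using da_kernel_has_sum[OF assms assms] by (auto simp: summable_on_def)
  then have "(\<lambda>i. complex_of_real ((cmod (da_feature i x))\<^sup>2)) summable_on UNIV"
    by (simp only: complex_norm_square mult.commute)
  then have "(\<lambda>i. cmod (complex_of_real ((cmod (da_feature i x))\<^sup>2))) summable_on UNIV"
    by (simp only: summable_on_iff_abs_summable_on_complex)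
  then show ?thesis by (simp add: l2_def norm_power)
qed

lemma da_feature_indep:
  assumes c: "l2 c" and zero: "\<And>x. x \<in> unit_ball2 \<Longrightarrow> (\<Sum>\<^sub>\<infinity>i. c i * da_feature i x) = 0"
  shows "c = (\<lambda>i. 0)"
proof -
  define b where "b = (\<lambda>i j. c (i, j) * of_real (sqrt (real ((i + j) choose i))))"
  have ball: "(u, v) \<in> unit_ball2" if "cmod u < 1/2" "cmod v < 1/2" for u v
    using power_strict_mono[OF that(1), of 2] power_strict_mono[OF that(2), of 2]
    by (simp add: unit_ball2_def power2_eq_square)
  have summ: "(\<lambda>(i, j). b i j * v ^ j * u ^ i) summable_on UNIV \<times> UNIV"
    and tot: "(\<Sum>\<^sub>\<infinity>(i, j)\<in>UNIV \<times> UNIV. b i j * v ^ j * u ^ i) = 0"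
    if "cmod u < 1/2" "cmod v < 1/2" for u v
  proof -
    have eq: "(\<lambda>(i, j). b i j * v ^ j * u ^ i) = (\<lambda>i. c i * da_feature i (u, v))"
      using ball[OF that] by (auto simp: b_def da_feature_def mult_ac)
    show "(\<lambda>(i, j). b i j * v ^ j * u ^ i) summable_on UNIV \<times> UNIV"
      unfolding eq using l2_mult[OF c l2_da_feature[OF ball[OF that]]] by simp
    show "(\<Sum>\<^sub>\<infinity>(i, j)\<in>UNIV \<times> UNIV. b i j * v ^ j * u ^ i) = 0"
      unfolding eq using zero[OF ball[OF that]] by simp
  qed
  have row: "(\<lambda>j. b i j * v ^ j) summable_on UNIV" if v: "cmod v < 1/2" for i v
  proof -
    have "(\<lambda>j. b i j * v ^ j * (1/4) ^ i) summable_on UNIV"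
      using summable_on_SigmaD1[OF summ[of "1/4" v], of i] v by simp
    from summable_on_cmult_left[OF this, of "4 ^ i"] show ?thesis
      by (simp add: power_divide mult.assoc)
  qed
  have row0: "(\<Sum>\<^sub>\<infinity>j. b i j * v ^ j) = 0" if v: "cmod v < 1/2" for i v
  proof (rule powser_eq_0[of "1/2"])
    fix u :: complex assume u: "cmod u < 1/2"
    have eq: "(\<Sum>\<^sub>\<infinity>j. b i j * v ^ j * u ^ i) = (\<Sum>\<^sub>\<infinity>j. b i j * v ^ j) * u ^ i" for i
      by (simp add: infsum_cmult_left')
    have "(\<lambda>i. \<Sum>\<^sub>\<infinity>j. b i j * v ^ j * u ^ i) summable_on UNIV"
      using summable_on_Sigma_banach[OF summ[OF u v]] by simp
    moreover have "(\<Sum>\<^sub>\<infinity>i. \<Sum>\<^sub>\<infinity>j. b i j * v ^ j * u ^ i) = 0"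
      using infsum_Sigma'_banach[OF summ[OF u v]] tot[OF u v] by simp
    ultimately have "((\<lambda>i. (\<Sum>\<^sub>\<infinity>j. b i j * v ^ j) * u ^ i) has_sum 0) UNIV"
      unfolding eq using has_sum_infsum by fastforce
    then show "(\<lambda>i. (\<Sum>\<^sub>\<infinity>j. b i j * v ^ j) * u ^ i) sums 0" by (rule has_sum_imp_sums)
  qed simp
  have "b i j = 0" for i j
  proof (rule powser_eq_0[of "1/2"])
    fix v :: complex assume v: "cmod v < 1/2"
    show "(\<lambda>j. b i j * v ^ j) sums 0"
      using has_sum_imp_sums[OF has_sum_infsum[OF row[OF v, of i]]] row0[OF v, of i] by simp
  qed simp
  then have "c (i, j) = 0" for i j by (simp add: b_def)
  then show ?thesis by auto
qed

lemma drury_arveson_exists: "\<exists>H ip. drury_arveson H ip"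
proof (rule rkhs_of_feature_map)
  show "da_feature i x = 0" if "x \<notin> unit_ball2" for i x
    using that by (simp add: da_feature_def)
  show "l2 (\<lambda>i. da_feature i x)" if "x \<in> unit_ball2" for x
    using that by (rule l2_da_feature)
  show "c = (\<lambda>i. 0)"
    if "l2 c" "\<And>x. x \<in> unit_ball2 \<Longrightarrow> (\<Sum>\<^sub>\<infinity>i. c i * da_feature i x) = 0" for c
    using that by (rule da_feature_indep)
  show "da_kernel x y = (\<Sum>\<^sub>\<infinity>i. cnj (da_feature i y) * da_feature i x)"
    if "x \<in> unit_ball2" "y \<in> unit_ball2" for x y
    using infsumI[OF da_kernel_has_sum[OF that]] by simp
qed

end

theory Submission
  imports Defs
begin

text \<open>
  On the image of the annulus the Drury--Arveson kernel becomes, with \<open>t = z cnj w\<close>,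
  a constant multiple of
  \<open>1 / (1 - t) + (r\<^sup>2/t) / (1 - r\<^sup>2/t) = \<Sum>m. \<gamma>\<^sub>m t\<^sup>m\<close>, where \<open>\<gamma>\<^sub>m = 1\<close> for \<open>m \<ge> 0\<close> and
  \<open>\<gamma>\<^sub>m = r\<^bsup>-2m\<^esup>\<close> for \<open>m < 0\<close>.  So, up to a constant factor, the restriction of the
  Drury--Arveson space to the annulus consists of Laurent series with
  \<open>\<parallel>\<Sum>a\<^sub>m z\<^sup>m\<parallel>\<^sup>2 = \<Sum>max 1 (r\<^bsup>2m\<^esup>) \<bar>a\<^sub>m\<bar>\<^sup>2\<close>, whereas the Hardy space of the annulus has
  the weights \<open>1 + r\<^bsup>2m\<^esup>\<close>, which come from the two boundary circles.  The two squared norms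
  differ by a factor between 1 and 2.  On the Hardy space \<open>\<phi>\<close> multiplies with norm at most its
  supremum, hence on the restricted space with norm at most \<open>sqrt 2\<close> times its supremum.  The
  constant is sharp because \<open>z\<^sup>n + (r/z)\<^sup>n\<close> has supremum at most \<open>1 + r\<^sup>n\<close>, while it maps the
  constant function 1 to a function of squared norm \<open>2\<close> times that of 1.

  What connects the annulus with the ball is the complete Pick property of the Drury--Arveson
  kernel: a function on a subset of the ball extends to a multiplier of norm at most \<open>M\<close> as soon as
  \<open>(M\<^sup>2 - \<phi> x cnj (\<phi> y)) K x y\<close> is positive semidefinite on the subset (\<open>pick_extension\<close>),
  and on the whole ball this positivity characterises the multipliers of norm at most \<open>M\<close>
  (\<open>psd_imp_multiplier\<close>, \<open>multiplier_imp_psd\<close>).  The extension norms of \<open>\<phi>\<close> are therefore governed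
  by a closed condition on \<open>M\<close> that only involves the annulus, and the minimum is
  attained.

  The Pick property is proved by adding one point at a time, with Zorn's lemma for the limit.
  The one-point step is an extension of a bounded functional: if \<open>L\<close> is positive on \<open>X\<close> and
  \<open>L - h h\<^sup>*\<close> is positive on a part of \<open>X\<close>, then \<open>h\<close> extends to \<open>X\<close> with \<open>L - h h\<^sup>*\<close> positive on \<open>X\<close>
  (\<open>psd_extend\<close>).  This in turn is the Riesz representation theorem, obtained by minimising a
  quadratic functional on formal combinations of points (\<open>psd_riesz\<close>); the same lemma shows which
  functions belong to a reproducing kernel Hilbert space (\<open>rkhs_membership\<close>).

  The upper bound (\<open>annulus_upper_bound\<close>) is the Hardy space argument in dual form, which
  avoids Laurent expansions of \<open>\<phi>\<close>: the Cauchy formula on two circles expresses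
  \<open>\<Sum>c\<^sub>i \<phi>(z\<^sub>i) f(z\<^sub>i)\<close> for a Laurent polynomial \<open>f\<close> by boundary values, and \<open>f\<close> is then chosen
  from the coefficients \<open>c\<^sub>i \<phi>(z\<^sub>i)\<close> themselves.  The lower bound
  (\<open>annulus_multiplier_lower_bound\<close>) tests positivity on equidistributed points of the circle
  of radius \<open>sqrt r\<close>, which in the limit isolate the Laurent coefficients \<open>n\<close> and \<open>-n\<close>.
\<close>

section \<open>Positive semidefinite kernels and formal combinations of points\<close>

text \<open>
  A list of pairs \<open>(x, c)\<close> stands for the formal combination of the points \<open>x\<close> with coefficients
  \<open>c\<close>.  Points may repeat, so that concatenation is addition and no support has to be tracked.
\<close>

definition pairing :: "('a \<Rightarrow> complex) \<Rightarrow> ('a \<times> complex) list \<Rightarrow> complex" where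
  "pairing h xs = (\<Sum>p\<leftarrow>xs. snd p * h (fst p))"

text \<open>
  The sesquilinear extension of the kernel, that is, its Gram form on formal combinations.
\<close>

definition form :: "('a \<Rightarrow> 'a \<Rightarrow> complex) \<Rightarrow> ('a \<times> complex) list \<Rightarrow> ('a \<times> complex) list \<Rightarrow> complex" where
  "form K xs ys = (\<Sum>p\<leftarrow>xs. \<Sum>q\<leftarrow>ys. snd p * cnj (snd q) * K (fst p) (fst q))"

definition smul :: "complex \<Rightarrow> ('a \<times> complex) list \<Rightarrow> ('a \<times> complex) list" where
  "smul a xs = map (\<lambda>p. (fst p, a * snd p)) xs"

definition combos :: "'a set \<Rightarrow> ('a \<times> complex) list set" where
  "combos S = {xs. fst ` set xs \<subseteq> S}"

text \<open>
  The action on combinations that is dual to multiplication of functions by \<open>g\<close>; see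
  \<open>pairing_modulate\<close>.
\<close>

definition modulate :: "('a \<Rightarrow> complex) \<Rightarrow> ('a \<times> complex) list \<Rightarrow> ('a \<times> complex) list" where
  "modulate g xs = map (\<lambda>p. (fst p, snd p * g (fst p))) xs"

text \<open>
  Hermitian symmetry is demanded separately because positivity is stated for the real part only.
\<close>

definition psd :: "'a set \<Rightarrow> ('a \<Rightarrow> 'a \<Rightarrow> complex) \<Rightarrow> bool" where
  "psd S K \<longleftrightarrow> (\<forall>x\<in>S. \<forall>y\<in>S. K y x = cnj (K x y)) \<and> (\<forall>xs\<in>combos S. 0 \<le> Re (form K xs xs))"

lemma combos_simps [simp]:
  "[] \<in> combos S" "p # xs \<in> combos S \<longleftrightarrow> fst p \<in> S \<and> xs \<in> combos S"
  "xs @ ys \<in> combos S \<longleftrightarrow> xs \<in> combos S \<and> ys \<in> combos S"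
  "smul a xs \<in> combos S \<longleftrightarrow> xs \<in> combos S"
  "modulate g xs \<in> combos S \<longleftrightarrow> xs \<in> combos S"
  by (auto simp: combos_def smul_def modulate_def image_image)

lemma combos_mono: "xs \<in> combos S \<Longrightarrow> S \<subseteq> T \<Longrightarrow> xs \<in> combos T"
  by (auto simp: combos_def)

lemma pairing_simps [simp]:
  "pairing h [] = 0" "pairing h (p # xs) = snd p * h (fst p) + pairing h xs"
  "pairing h (xs @ ys) = pairing h xs + pairing h ys"
  "pairing h (smul a xs) = a * pairing h xs"
  by (simp_all add: pairing_def smul_def sum_list_const_mult[symmetric] o_def mult.assoc)

lemma form_eq_pairing: "form K xs ys = pairing (\<lambda>x. cnj (pairing (\<lambda>y. cnj (K x y)) ys)) xs"
proof -
  have cnj_sum: "cnj (sum_list zs) = sum_list (map cnj zs)" for zs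
    by (induction zs) auto
  have inner: "(\<Sum>q\<leftarrow>ys. snd p * cnj (snd q) * K (fst p) (fst q)) =
      snd p * cnj (pairing (\<lambda>y. cnj (K (fst p) y)) ys)" for p
    by (simp add: pairing_def cnj_sum o_def mult.assoc sum_list_const_mult)
  show ?thesis
    unfolding form_def inner by (simp add: pairing_def)
qed

lemma pairing_zero [simp]: "pairing (\<lambda>x. 0) xs = 0"
  by (simp add: pairing_def)

lemma pairing_add: "pairing (\<lambda>x. g x + h x) xs = pairing g xs + pairing h xs"
  by (induction xs) (simp_all add: algebra_simps)

lemma pairing_mult: "pairing (\<lambda>x. a * h x) xs = a * pairing h xs"
  by (induction xs) (simp_all add: algebra_simps)

lemma pairing_cong:
  "xs \<in> combos S \<Longrightarrow> (\<And>x. x \<in> S \<Longrightarrow> g x = h x) \<Longrightarrow> pairing g xs = pairing h xs"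
  by (induction xs) auto

lemma form_bilinear [simp]:
  "form K (xs @ ys) zs = form K xs zs + form K ys zs"
  "form K zs (xs @ ys) = form K zs xs + form K zs ys"
  "form K (smul a xs) zs = a * form K xs zs"
  "form K zs (smul a xs) = cnj a * form K zs xs"
  by (simp_all add: form_eq_pairing pairing_add pairing_mult)

lemma form_cong:
  assumes "xs \<in> combos S" "ys \<in> combos T" "\<And>x y. x \<in> S \<Longrightarrow> y \<in> T \<Longrightarrow> K x y = L x y"
  shows "form K xs ys = form L xs ys"
  unfolding form_eq_pairing
  by (rule pairing_cong[OF assms(1)]) (auto intro!: pairing_cong[OF assms(2)] simp: assms(3))

lemma form_add: "form (\<lambda>x y. K x y + L x y) xs ys = form K xs ys + form L xs ys"
  by (simp add: form_eq_pairing pairing_add)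

lemma form_mult: "form (\<lambda>x y. a * K x y) xs ys = a * form K xs ys"
  by (simp add: form_eq_pairing pairing_mult)

lemma form_diff: "form (\<lambda>x y. K x y - L x y) xs ys = form K xs ys - form L xs ys"
  using form_add[of K "\<lambda>x y. (-1) * L x y" xs ys] form_mult[of "-1" L xs ys] by simp

lemma form_swap: "form K ys xs = form (\<lambda>x y. K y x) (map (\<lambda>p. (fst p, cnj (snd p))) xs) (map (\<lambda>p. (fst p, cnj (snd p))) ys)"
proof -
  have "form K ys xs = (\<Sum>q\<leftarrow>xs. \<Sum>p\<leftarrow>ys. snd p * cnj (snd q) * K (fst p) (fst q))"
    unfolding form_def by (induction ys) (simp_all add: sum_list_addf)
  then show ?thesis by (simp add: form_def o_def mult_ac)
qed

lemma form_cnj: "cnj (form K xs ys) = form (\<lambda>x y. cnj (K y x)) ys xs"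
proof -
  have cnj_sum: "cnj (sum_list zs) = sum_list (map cnj zs)" for zs
    by (induction zs) auto
  show ?thesis
    unfolding form_swap[of _ ys xs] by (simp add: form_def cnj_sum o_def)
qed

lemma pairing_modulate: "pairing h (modulate g xs) = pairing (\<lambda>x. g x * h x) xs"
  by (simp add: pairing_def modulate_def o_def mult.assoc)

lemma form_modulate:
  "form (\<lambda>x y. g x * K x y * cnj (g y)) xs ys = form K (modulate g xs) (modulate g ys)"
  by (simp add: form_def modulate_def o_def mult_ac)

text \<open>
  Positivity of the left-hand side for all combinations says that \<open>modulate g\<close> has norm at
  most \<open>\<bar>M\<bar>\<close> with respect to the Gram form.
\<close>

lemma form_defect:
  "form (\<lambda>x y. (of_real (M\<^sup>2) - g x * cnj (g y)) * K x y) xs xs =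
    of_real (M\<^sup>2) * form K xs xs - form K (modulate g xs) (modulate g xs)"
proof -
  have "(\<lambda>x y. (of_real (M\<^sup>2) - g x * cnj (g y)) * K x y) =
      (\<lambda>x y. of_real (M\<^sup>2) * K x y - g x * K x y * cnj (g y))"
    by (simp add: fun_eq_iff algebra_simps)
  then show ?thesis by (simp only: form_diff form_mult form_modulate)
qed

lemma form_product: "form (\<lambda>x y. g x * cnj (g y)) xs ys = pairing g xs * cnj (pairing g ys)"
proof -
  have "form (\<lambda>x y. g x * cnj (g y)) xs ys = pairing (\<lambda>x. g x * cnj (pairing g ys)) xs"
    by (simp add: form_eq_pairing pairing_mult)
  moreover have "(\<lambda>x. g x * cnj (pairing g ys)) = (\<lambda>x. cnj (pairing g ys) * g x)"
    by (simp add: fun_eq_iff)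
  ultimately show ?thesis
    by (simp add: pairing_mult)
qed

lemma form_image:
  "form (\<lambda>i j. K (f i) (f j)) xs ys = form K (map (\<lambda>p. (f (fst p), snd p)) xs) (map (\<lambda>p. (f (fst p), snd p)) ys)"
  by (simp add: form_def o_def)

lemma psd_hermitian: "psd S K \<Longrightarrow> x \<in> S \<Longrightarrow> y \<in> S \<Longrightarrow> K y x = cnj (K x y)"
  unfolding psd_def by blast

lemma psd_form_cnj:
  assumes "psd S K" "xs \<in> combos S" "ys \<in> combos S"
  shows "form K ys xs = cnj (form K xs ys)"
  unfolding form_cnj using psd_hermitian[OF assms(1)] by (intro form_cong[OF assms(3,2)]) metis

lemma psd_form_real: "psd S K \<Longrightarrow> xs \<in> combos S \<Longrightarrow> form K xs xs = of_real (Re (form K xs xs))"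
  using psd_form_cnj[of S K xs xs] by (simp add: complex_eq_iff)

lemma psd_nonneg: "psd S K \<Longrightarrow> xs \<in> combos S \<Longrightarrow> 0 \<le> Re (form K xs xs)"
  unfolding psd_def by blast

lemma psdI:
  assumes "\<And>x y. x \<in> S \<Longrightarrow> y \<in> S \<Longrightarrow> K y x = cnj (K x y)"
    and "\<And>xs. xs \<in> combos S \<Longrightarrow> 0 \<le> Re (form K xs xs)"
  shows "psd S K"
  unfolding psd_def using assms by blast

lemma psd_diag:
  assumes "psd S K" "x \<in> S"
  shows "K x x = of_real (Re (K x x))" "0 \<le> Re (K x x)"
  using psd_form_real[OF assms(1), of "[(x, 1)]"] psd_nonneg[OF assms(1), of "[(x, 1)]"] assms(2)
  by (simp_all add: form_def)

lemma psd_mono: "psd T K \<Longrightarrow> S \<subseteq> T \<Longrightarrow> psd S K"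
  unfolding psd_def using combos_mono by blast

lemma psd_cong:
  assumes "\<And>x y. x \<in> S \<Longrightarrow> y \<in> S \<Longrightarrow> K x y = L x y"
  shows "psd S K \<longleftrightarrow> psd S L"
proof -
  have "form K xs xs = form L xs xs" if "xs \<in> combos S" for xs
    using that assms by (rule form_cong[OF _ that])
  then show ?thesis
    unfolding psd_def using assms by (metis (no_types, lifting))
qed

lemma psd_cong_imp:
  assumes "psd S K" "\<And>x y. x \<in> S \<Longrightarrow> y \<in> S \<Longrightarrow> K x y = L x y"
  shows "psd S L"
proof -
  have "psd S K \<longleftrightarrow> psd S L" using assms(2) by (rule psd_cong)
  then show ?thesis using assms(1) by (rule iffD1)
qed

lemma psd_add:
  assumes "psd S K" "psd S L"
  shows "psd S (\<lambda>x y. K x y + L x y)"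
proof (rule psdI)
  show "K y x + L y x = cnj (K x y + L x y)" if "x \<in> S" "y \<in> S" for x y
    using psd_hermitian[OF assms(1) that] psd_hermitian[OF assms(2) that] by simp
  show "0 \<le> Re (form (\<lambda>x y. K x y + L x y) xs xs)" if "xs \<in> combos S" for xs
    using psd_nonneg[OF assms(1) that] psd_nonneg[OF assms(2) that] by (simp add: form_add)
qed

lemma psd_zero: "psd S (\<lambda>x y. 0)"
  by (simp add: psd_def form_eq_pairing)

lemma psd_sum:
  "finite I \<Longrightarrow> (\<And>i. i \<in> I \<Longrightarrow> psd S (K i)) \<Longrightarrow> psd S (\<lambda>x y. \<Sum>i\<in>I. K i x y)"
  by (induction I rule: finite_induct) (simp_all add: psd_zero psd_add)

lemma psd_congruence:
  assumes "psd S K"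
  shows "psd S (\<lambda>x y. g x * K x y * cnj (g y))"
proof (rule psdI)
  show "g y * K y x * cnj (g x) = cnj (g x * K x y * cnj (g y))" if "x \<in> S" "y \<in> S" for x y
    using psd_hermitian[OF assms that] by (simp add: mult_ac)
  show "0 \<le> Re (form (\<lambda>x y. g x * K x y * cnj (g y)) xs xs)" if "xs \<in> combos S" for xs
    unfolding form_modulate using that by (intro psd_nonneg[OF assms]) simp
qed

lemma psd_rank_one: "psd S (\<lambda>x y. g x * cnj (g y))"
proof (rule psdI)
  show "0 \<le> Re (form (\<lambda>x y. g x * cnj (g y)) xs xs)" for xs
    unfolding form_product by (simp add: complex_mult_cnj)
qed simp

lemma psd_scale:
  assumes "psd S K" "0 \<le> a"
  shows "psd S (\<lambda>x y. of_real a * K x y)"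
proof -
  have eq: "of_real (sqrt a) * K x y * cnj (of_real (sqrt a)) = of_real a * K x y" for x y
  proof -
    have "complex_of_real (sqrt a) * of_real (sqrt a) = of_real a"
      using assms(2) by (simp flip: of_real_mult)
    then show ?thesis by (simp add: algebra_simps)
  qed
  show ?thesis
    using psd_congruence[OF assms(1), of "\<lambda>x. of_real (sqrt a)"] unfolding eq .
qed

text \<open>
  Choosing preimages lifts a combination of image points to the index set.  The map need not be
  injective, since the points of a combination may repeat.
\<close>

lemma psd_image: "psd (f ` I) K \<longleftrightarrow> psd I (\<lambda>i j. K (f i) (f j))"
proof
  assume psd: "psd (f ` I) K"
  show "psd I (\<lambda>i j. K (f i) (f j))"
  proof (rule psdI)
    show "K (f j) (f i) = cnj (K (f i) (f j))" if "i \<in> I" "j \<in> I" for i j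
      using psd_hermitian[OF psd, of "f i" "f j"] that by simp
    show "0 \<le> Re (form (\<lambda>i j. K (f i) (f j)) xs xs)" if "xs \<in> combos I" for xs
      unfolding form_image using that by (intro psd_nonneg[OF psd]) (auto simp: combos_def)
  qed
next
  assume psd: "psd I (\<lambda>i j. K (f i) (f j))"
  show "psd (f ` I) K"
  proof (rule psdI)
    show "K y x = cnj (K x y)" if "x \<in> f ` I" "y \<in> f ` I" for x y
      using psd_hermitian[OF psd] that by auto
    show "0 \<le> Re (form K xs xs)" if xs: "xs \<in> combos (f ` I)" for xs
    proof -
      define ys where "ys = map (\<lambda>p. (inv_into I f (fst p), snd p)) xs"
      have "map (\<lambda>p. (f (fst p), snd p)) ys = xs"
        unfolding ys_def map_map o_def
        by (rule map_idI) (use xs in \<open>auto simp: f_inv_into_f combos_def image_subset_iff\<close>)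
      moreover have "ys \<in> combos I"
        using xs by (auto simp: ys_def combos_def image_subset_iff inv_into_into)
      ultimately show ?thesis using psd_nonneg[OF psd, of ys] by (simp add: form_image)
    qed
  qed
qed

text \<open>
  A point at which the kernel is weighted by zero contributes nothing to the form, so positivity
  on the remaining points suffices.
\<close>

lemma psd_congruence_insert:
  assumes "psd S K" "g a = 0"
  shows "psd (insert a S) (\<lambda>x y. g x * K x y * cnj (g y))"
proof (rule psdI)
  show "g y * K y x * cnj (g x) = cnj (g x * K x y * cnj (g y))"
    if "x \<in> insert a S" "y \<in> insert a S" for x y
    using psd_hermitian[OF assms(1), of x y] that assms(2) by (auto simp: mult_ac)
  show "0 \<le> Re (form (\<lambda>x y. g x * K x y * cnj (g y)) xs xs)" if xs: "xs \<in> combos (insert a S)" for xs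
  proof -
    let ?F = "\<lambda>x y. g x * K x y * cnj (g y)"
    define ys where "ys = filter (\<lambda>p. fst p \<noteq> a) xs"
    have fil: "pairing h ys = pairing h xs" if "h a = 0" for h
      unfolding ys_def using that by (induction xs) auto
    have "form ?F xs xs = form ?F ys ys"
      by (simp add: form_eq_pairing fil assms(2))
    moreover have "ys \<in> combos S" using xs by (auto simp: ys_def combos_def)
    ultimately show ?thesis using psd_nonneg[OF psd_congruence[OF assms(1)]] by simp
  qed
qed

lemma psd_cauchy_schwarz:
  assumes psd: "psd S K" and xs: "xs \<in> combos S" and ys: "ys \<in> combos S"
  shows "(cmod (form K xs ys))\<^sup>2 \<le> Re (form K xs xs) * Re (form K ys ys)"
proof -
  define b where "b = form K xs ys"
  have quad: "0 \<le> Re (form K xs xs) - 2 * s * (cmod b)\<^sup>2 + s\<^sup>2 * (cmod b)\<^sup>2 * Re (form K ys ys)" for s :: real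
  proof -
    let ?t = "- of_real s * b"
    have "form K (xs @ smul ?t ys) (xs @ smul ?t ys) =
       form K xs xs - 2 * of_real s * (b * cnj b) + (of_real s)\<^sup>2 * (b * cnj b) * form K ys ys"
      unfolding form_bilinear psd_form_cnj[OF psd xs ys] b_def[symmetric]
      by (simp add: algebra_simps power2_eq_square)
    also have "\<dots> = of_real (Re (form K xs xs)) - 2 * of_real s * of_real ((cmod b)\<^sup>2) +
        (of_real s)\<^sup>2 * of_real ((cmod b)\<^sup>2) * of_real (Re (form K ys ys))"
      by (simp only: complex_norm_square psd_form_real[OF psd xs, symmetric]
          psd_form_real[OF psd ys, symmetric])
    also have "\<dots> = of_real (Re (form K xs xs) - 2 * s * (cmod b)\<^sup>2 + s\<^sup>2 * (cmod b)\<^sup>2 * Re (form K ys ys))"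
      by simp
    finally have "Re (form K (xs @ smul ?t ys) (xs @ smul ?t ys)) =
        Re (form K xs xs) - 2 * s * (cmod b)\<^sup>2 + s\<^sup>2 * (cmod b)\<^sup>2 * Re (form K ys ys)"
      by (simp only: Re_complex_of_real)
    moreover have "0 \<le> Re (form K (xs @ smul ?t ys) (xs @ smul ?t ys))"
      using xs ys by (intro psd_nonneg[OF psd]) simp
    ultimately show ?thesis by simp
  qed
  show ?thesis
  proof (cases "Re (form K ys ys) = 0")
    case True
    have "(cmod b)\<^sup>2 = 0"
    proof (rule ccontr)
      assume nz: "(cmod b)\<^sup>2 \<noteq> 0"
      show False
        using quad[of "(Re (form K xs xs) + 1) / (2 * (cmod b)\<^sup>2)"] True nz by (simp add: field_simps)
    qed
    then show ?thesis using True by (simp add: b_def)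
  next
    case False
    then have pos: "Re (form K ys ys) > 0" using psd_nonneg[OF psd ys] by simp
    show ?thesis
      using quad[of "1 / Re (form K ys ys)"] pos
      by (simp add: b_def[symmetric] field_simps power2_eq_square)
  qed
qed

section \<open>Bounded functionals on formal combinations\<close>

text \<open>
  The Riesz representation of a bounded functional \<open>h\<close> by an approximating sequence, since the
  combinations are not complete under the Gram form.  The functional
  \<open>J xs = \<parallel>xs\<parallel>\<^sup>2 - 2 Re (pairing h xs)\<close> is bounded below by \<open>- C\<^sup>2\<close>.  The parallelogram law makes a
  minimising sequence Cauchy, and near-minimality in every direction forces it to represent \<open>h\<close>
  in the limit.
\<close>

lemma psd_riesz:
  assumes psd: "psd S K" and "0 \<le> C"
    and bound: "\<And>xs. xs \<in> combos S \<Longrightarrow> (cmod (pairing h xs))\<^sup>2 \<le> C\<^sup>2 * Re (form K xs xs)"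
  obtains v where "\<And>n. v n \<in> combos S"
    and "\<And>m n. Re (form K (v m @ smul (-1) (v n)) (v m @ smul (-1) (v n)))
           \<le> 2 / real (Suc m) + 2 / real (Suc n)"
    and "\<And>n xs. xs \<in> combos S \<Longrightarrow>
           (cmod (form K xs (v n) - pairing h xs))\<^sup>2 \<le> (1 + Re (form K xs xs)) / real (Suc n)"
proof -
  define J where "J = (\<lambda>xs. Re (form K xs xs) - 2 * Re (pairing h xs))"
  define \<mu> where "\<mu> = Inf (J ` combos S)"
  have "- C\<^sup>2 \<le> J xs" if xs: "xs \<in> combos S" for xs
  proof -
    let ?q = "Re (form K xs xs)"
    have q: "0 \<le> ?q" using psd_nonneg[OF psd xs] .
    have "cmod (pairing h xs) \<le> C * sqrt ?q"
      using real_sqrt_le_mono[OF bound[OF xs]] assms(2) by (simp add: real_sqrt_mult)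
    then have "Re (pairing h xs) \<le> C * sqrt ?q"
      using complex_Re_le_cmod[of "pairing h xs"] by linarith
    moreover have "0 \<le> (sqrt ?q - C)\<^sup>2" by simp
    ultimately show ?thesis using q by (simp add: J_def power2_diff algebra_simps)
  qed
  then have bdd: "bdd_below (J ` combos S)" by (auto simp: bdd_below_def)
  have \<mu>: "\<mu> \<le> J xs" if "xs \<in> combos S" for xs
    unfolding \<mu>_def using that bdd by (simp add: cINF_lower)
  have "\<exists>xs\<in>combos S. J xs < \<mu> + 1 / real (Suc n)" for n
  proof -
    have "Inf (J ` combos S) < \<mu> + 1 / real (Suc n)" by (simp add: \<mu>_def)
    moreover have "combos S \<noteq> {}" using combos_simps(1) by blast
    ultimately show ?thesis using bdd by (simp add: cInf_less_iff)
  qed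
  then obtain v where v: "\<And>n. v n \<in> combos S" "\<And>n. J (v n) < \<mu> + 1 / real (Suc n)"
    by metis
  have cauchy: "Re (form K (v m @ smul (-1) (v n)) (v m @ smul (-1) (v n)))
           \<le> 2 / real (Suc m) + 2 / real (Suc n)" for m n
  proof -
    \<comment> \<open>the midpoint of two near-minimisers cannot lie below the infimum\<close>
    have "\<mu> \<le> J (smul (1/2) (v m @ v n))" using v(1) by (intro \<mu>) simp
    then have "4 * \<mu> \<le> Re (form K (v m) (v m)) + Re (form K (v n) (v n)) + Re (form K (v m) (v n))
        + Re (form K (v n) (v m)) - 4 * (Re (pairing h (v m)) + Re (pairing h (v n)))"
      by (simp add: J_def field_simps)
    moreover have "Re (form K (v m @ smul (-1) (v n)) (v m @ smul (-1) (v n))) =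
        Re (form K (v m) (v m)) + Re (form K (v n) (v n)) - Re (form K (v m) (v n))
        - Re (form K (v n) (v m))"
      by simp
    moreover have "2 * J (v m) + 2 * J (v n) < 4 * \<mu> + 2 / real (Suc m) + 2 / real (Suc n)"
      using v(2)[of m] v(2)[of n] by simp
    ultimately show ?thesis by (simp add: J_def)
  qed
  have limit: "(cmod (form K xs (v n) - pairing h xs))\<^sup>2 \<le> (1 + Re (form K xs xs)) / real (Suc n)"
    if xs: "xs \<in> combos S" for xs n
  proof -
    define d where "d = form K xs (v n) - pairing h xs"
    define q where "q = Re (form K xs xs)"
    define s where "s = 1 / (1 + q)"
    have q: "0 \<le> q" using psd_nonneg[OF psd xs] by (simp add: q_def)
    define t where "t = - of_real s * cnj d"
    \<comment> \<open>\<open>s\<close> is small enough for the quadratic term in \<open>t\<close> to cost at most half of the linear gain\<close>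
    have "\<mu> \<le> J (v n @ smul t xs)" using v(1) xs by (intro \<mu>) simp
    also have "J (v n @ smul t xs) = J (v n) + 2 * Re (t * d) + Re (t * cnj t * form K xs xs)"
      unfolding J_def form_bilinear pairing_simps psd_form_cnj[OF psd xs v(1)] d_def
      by (simp add: algebra_simps)
    also have "t * d = of_real (- (s * (cmod d)\<^sup>2))"
      unfolding t_def of_real_minus of_real_mult complex_norm_square by simp
    also have "t * cnj t * form K xs xs = of_real (s\<^sup>2 * (cmod d)\<^sup>2 * q)"
      unfolding of_real_mult complex_norm_square q_def psd_form_real[OF psd xs, symmetric]
      by (simp add: t_def power2_eq_square)
    finally have "\<mu> \<le> J (v n) - 2 * s * (cmod d)\<^sup>2 + s\<^sup>2 * (cmod d)\<^sup>2 * q" by simp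
    moreover have "s\<^sup>2 * (cmod d)\<^sup>2 * q \<le> s * (cmod d)\<^sup>2"
    proof -
      have "s * q \<le> 1" using q by (simp add: s_def)
      then have "(s * (cmod d)\<^sup>2) * (s * q) \<le> (s * (cmod d)\<^sup>2) * 1"
        using q by (intro mult_left_mono) (auto simp: s_def)
      then show ?thesis by (simp add: power2_eq_square mult_ac)
    qed
    ultimately have "s * (cmod d)\<^sup>2 \<le> 1 / real (Suc n)" using v(2)[of n] by simp
    then have "(cmod d)\<^sup>2 / (1 + q) \<le> 1 / real (Suc n)" by (simp add: s_def)
    then have "(cmod d)\<^sup>2 \<le> 1 / real (Suc n) * (1 + q)" using q by (subst (asm) pos_divide_le_eq) auto
    then show ?thesis by (simp add: d_def q_def)
  qed
  show ?thesis using that[OF v(1) cauchy limit] .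
qed

text \<open>
  If \<open>x\<close> is the norm of an approximate representing vector and \<open>w\<close> the value of the functional at
  that vector, then \<open>x\<^sup>2\<close> is almost \<open>w\<close>, which is at most \<open>C x\<close> in modulus; so \<open>x\<close> is almost at
  most \<open>C\<close>.
\<close>

lemma riesz_norm_bound:
  fixes w :: complex
  assumes "(cmod (of_real (x\<^sup>2) - w))\<^sup>2 \<le> (1 + x\<^sup>2) * e\<^sup>2" "(cmod w)\<^sup>2 \<le> C\<^sup>2 * x\<^sup>2"
    and "0 \<le> x" "0 \<le> C" "0 \<le> e"
  shows "x \<le> C + e + sqrt e"
proof (rule ccontr)
  assume n: "\<not> x \<le> C + e + sqrt e"
  have "1 + x\<^sup>2 \<le> (1 + x)\<^sup>2" using assms by (simp add: power2_sum)
  then have "(1 + x\<^sup>2) * e\<^sup>2 \<le> ((1 + x) * e)\<^sup>2" by (simp add: power_mult_distrib mult_right_mono)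
  with assms(1) have "(cmod (of_real (x\<^sup>2) - w))\<^sup>2 \<le> ((1 + x) * e)\<^sup>2" by linarith
  then have "cmod (of_real (x\<^sup>2) - w) \<le> (1 + x) * e"
    by (rule power2_le_imp_le) (simp add: assms(3,5))
  moreover have "(cmod w)\<^sup>2 \<le> (C * x)\<^sup>2" using assms(2) by (simp add: power_mult_distrib)
  then have "cmod w \<le> C * x"
    by (rule power2_le_imp_le) (simp add: assms(3,4))
  moreover have "x\<^sup>2 \<le> cmod (of_real (x\<^sup>2) - w) + cmod w"
    using norm_triangle_sub[of "complex_of_real (x\<^sup>2)" w] by (simp add: norm_mult norm_power)
  ultimately have "x\<^sup>2 \<le> (1 + x) * e + C * x" by linarith
  then have "x * (x - C - e) \<le> e" by (simp add: algebra_simps power2_eq_square)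
  moreover have "sqrt e * sqrt e < x * (x - C - e)"
  proof (rule mult_strict_mono)
    show "sqrt e < x" "sqrt e < x - C - e" using n assms(4,5) by auto
    then show "0 < x" using assms(5) by (meson le_less_trans real_sqrt_ge_zero)
  qed (simp add: assms(5))
  ultimately show False using assms(5) by simp
qed

lemma tendsto_pairing:
  "(\<And>x. x \<in> S \<Longrightarrow> (\<lambda>n. f n x) \<longlonglongrightarrow> g x) \<Longrightarrow> xs \<in> combos S \<Longrightarrow>
    (\<lambda>n. pairing (f n) xs) \<longlonglongrightarrow> pairing g xs"
  by (induction xs) (auto intro!: tendsto_intros)

lemma form_tendsto:
  assumes "\<And>x y. x \<in> S \<Longrightarrow> y \<in> S \<Longrightarrow> (\<lambda>n. K n x y) \<longlonglongrightarrow> L x y" "xs \<in> combos S" "ys \<in> combos S"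
  shows "(\<lambda>n. form (K n) xs ys) \<longlonglongrightarrow> form L xs ys"
  unfolding form_eq_pairing using assms by (intro tendsto_pairing[of S] tendsto_cnj) auto

text \<open>
  A Hahn--Banach theorem for kernels.  On \<open>T\<close> the hypothesis says that \<open>h\<close> is a functional of norm
  at most 1 for the Gram form of \<open>L\<close>.  Its approximate Riesz vectors are combinations of points
  of \<open>T\<close>, but their inner products with all points of \<open>X\<close> converge, and the limits define a
  norm-preserving extension.
\<close>

lemma psd_extend:
  assumes psd: "psd X L" and "T \<subseteq> X" and sub: "psd T (\<lambda>x y. L x y - h x * cnj (h y))"
  shows "\<exists>g. (\<forall>x\<in>T. g x = h x) \<and> psd X (\<lambda>x y. L x y - g x * cnj (g y))"
proof -
  have psdT: "psd T L" using psd_mono[OF psd \<open>T \<subseteq> X\<close>] .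
  have bound: "(cmod (pairing h xs))\<^sup>2 \<le> 1\<^sup>2 * Re (form L xs xs)" if "xs \<in> combos T" for xs
    using psd_nonneg[OF sub that]
    by (simp add: form_diff form_product complex_norm_square[symmetric] del: of_real_power)
  obtain v where v: "\<And>n. v n \<in> combos T"
    "\<And>m n. Re (form L (v m @ smul (-1) (v n)) (v m @ smul (-1) (v n)))
           \<le> 2 / real (Suc m) + 2 / real (Suc n)"
    "\<And>n xs. xs \<in> combos T \<Longrightarrow>
           (cmod (form L xs (v n) - pairing h xs))\<^sup>2 \<le> (1 + Re (form L xs xs)) / real (Suc n)"
    using psd_riesz[OF psdT zero_le_one bound] by blast
  have vX: "v n \<in> combos X" for n using v(1) \<open>T \<subseteq> X\<close> combos_mono by blast
  define f where "f = (\<lambda>n x. form L [(x, 1)] (v n))"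
  have f: "form L xs (v n) = pairing (f n) xs" for xs n
    unfolding f_def form_eq_pairing by simp
  have "convergent (\<lambda>n. f n x)" if x: "x \<in> X" for x
  proof -
    define q where "q = Re (form L [(x, 1)] [(x, 1)])"
    have q: "0 \<le> q" using psd_nonneg[OF psd, of "[(x, 1)]"] x by (simp add: q_def)
    have d: "(cmod (f m x - f n x))\<^sup>2 \<le> q * (2 / real (Suc m) + 2 / real (Suc n))" for m n
    proof -
      have "f m x - f n x = form L [(x, 1)] (v m @ smul (-1) (v n))" by (simp add: f_def)
      then have "(cmod (f m x - f n x))\<^sup>2 \<le>
          q * Re (form L (v m @ smul (-1) (v n)) (v m @ smul (-1) (v n)))"
        using psd_cauchy_schwarz[OF psd, of "[(x, 1)]" "v m @ smul (-1) (v n)"] x vX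
        by (simp only: q_def combos_simps fst_conv simp_thms)
      also have "\<dots> \<le> q * (2 / real (Suc m) + 2 / real (Suc n))"
        by (rule mult_left_mono[OF v(2) q])
      finally show ?thesis .
    qed
    have "Cauchy (\<lambda>n. f n x)"
    proof (rule metric_CauchyI)
      fix e :: real assume e: "0 < e"
      obtain N where N: "4 * q / e\<^sup>2 < real N" using reals_Archimedean2 by blast
      have "dist (f m x) (f n x) < e" if "m \<ge> N" "n \<ge> N" for m n
      proof -
        have "q * (2 / real (Suc m) + 2 / real (Suc n)) \<le> q * (2 / real (Suc N) + 2 / real (Suc N))"
          using that q by (intro mult_left_mono add_mono divide_left_mono) auto
        also have "\<dots> = 4 * q / real (Suc N)" by simp
        also have "\<dots> < e\<^sup>2"
        proof -
          have "4 * q < e\<^sup>2 * real N" using N e by (simp add: field_simps)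
          also have "\<dots> \<le> e\<^sup>2 * real (Suc N)" by (intro mult_left_mono) auto
          finally show ?thesis by (simp add: field_simps)
        qed
        finally have "(cmod (f m x - f n x))\<^sup>2 < e\<^sup>2" using d[of m n] by linarith
        then show ?thesis using e by (simp add: dist_norm power2_less_imp_less)
      qed
      then show "\<exists>N. \<forall>m\<ge>N. \<forall>n\<ge>N. dist (f m x) (f n x) < e" by blast
    qed
    then show ?thesis by (rule Cauchy_convergent)
  qed
  then obtain g where g: "\<And>x. x \<in> X \<Longrightarrow> (\<lambda>n. f n x) \<longlonglongrightarrow> g x"
    unfolding convergent_def by metis
  have inv0: "(\<lambda>n. 1 / real (Suc n)) \<longlonglongrightarrow> 0"
    using LIMSEQ_inverse_real_of_nat by (simp add: inverse_eq_divide)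
  have on_T: "g x = h x" if x: "x \<in> T" for x
  proof (rule LIMSEQ_unique[OF g])
    have "(cmod (f n x - h x))\<^sup>2 \<le> (1 + Re (L x x)) * (1 / real (Suc n))" for n
      using v(3)[of "[(x, 1)]" n] x by (simp add: f_def) (simp add: form_def)
    then have "cmod (f n x - h x) \<le> sqrt ((1 + Re (L x x)) * (1 / real (Suc n)))" for n
      by (rule real_le_rsqrt)
    moreover have "(\<lambda>n. sqrt ((1 + Re (L x x)) * (1 / real (Suc n)))) \<longlonglongrightarrow> 0"
      using tendsto_real_sqrt[OF tendsto_mult[OF tendsto_const inv0]]
      by (simp only: mult_zero_right real_sqrt_zero)
    ultimately have "(\<lambda>n. f n x - h x) \<longlonglongrightarrow> 0"
      by (rule Lim_null_comparison[OF always_eventually[OF allI]])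
    then show "(\<lambda>n. f n x) \<longlonglongrightarrow> h x" by (rule LIM_zero_cancel)
  qed (use x \<open>T \<subseteq> X\<close> in auto)
  have norm: "(cmod (pairing g xs))\<^sup>2 \<le> Re (form L xs xs)" if xs: "xs \<in> combos X" for xs
  proof -
    define e where "e = (\<lambda>n. sqrt (1 / real (Suc n)))"
    define b where "b = (\<lambda>n. (1 + e n + sqrt (e n))\<^sup>2)"
    have e0: "e \<longlonglongrightarrow> 0" unfolding e_def using tendsto_real_sqrt[OF inv0] by simp
    have "b \<longlonglongrightarrow> (1 + 0 + sqrt 0)\<^sup>2"
      unfolding b_def by (intro tendsto_power tendsto_add tendsto_const tendsto_real_sqrt e0)
    then have b1: "b \<longlonglongrightarrow> 1" by simp
    have vn: "Re (form L (v n) (v n)) \<le> b n" for n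
    proof -
      define x where "x = sqrt (Re (form L (v n) (v n)))"
      have x: "x\<^sup>2 = Re (form L (v n) (v n))" "0 \<le> x"
        using psd_nonneg[OF psd vX] by (simp_all add: x_def)
      have "x \<le> 1 + e n + sqrt (e n)"
      proof (rule riesz_norm_bound[where w = "pairing h (v n)"])
        show "(cmod (of_real (x\<^sup>2) - pairing h (v n)))\<^sup>2 \<le> (1 + x\<^sup>2) * (e n)\<^sup>2"
          using v(3)[OF v(1), of n n] unfolding x(1) psd_form_real[OF psd vX, symmetric]
          by (simp add: e_def)
        show "(cmod (pairing h (v n)))\<^sup>2 \<le> 1\<^sup>2 * x\<^sup>2" using bound[OF v(1)] by (simp add: x(1))
      qed (auto simp: x e_def)
      then show ?thesis unfolding b_def x(1)[symmetric] using x(2) by (rule power_mono)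
    qed
    have "(cmod (pairing (f n) xs))\<^sup>2 \<le> Re (form L xs xs) * b n" for n
    proof -
      have "(cmod (pairing (f n) xs))\<^sup>2 \<le> Re (form L xs xs) * Re (form L (v n) (v n))"
        using psd_cauchy_schwarz[OF psd xs vX] by (simp add: f)
      also have "\<dots> \<le> Re (form L xs xs) * b n"
        by (rule mult_left_mono[OF vn psd_nonneg[OF psd xs]])
      finally show ?thesis .
    qed
    moreover have "(\<lambda>n. (cmod (pairing (f n) xs))\<^sup>2) \<longlonglongrightarrow> (cmod (pairing g xs))\<^sup>2"
      by (intro tendsto_intros tendsto_pairing[OF g xs])
    moreover have "(\<lambda>n. Re (form L xs xs) * b n) \<longlonglongrightarrow> Re (form L xs xs) * 1"
      by (intro tendsto_intros b1)
    ultimately have "(cmod (pairing g xs))\<^sup>2 \<le> Re (form L xs xs) * 1"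
      by (intro LIMSEQ_le) auto
    then show ?thesis by simp
  qed
  have "psd X (\<lambda>x y. L x y - g x * cnj (g y))"
  proof (rule psdI)
    show "L y x - g y * cnj (g x) = cnj (L x y - g x * cnj (g y))" if "x \<in> X" "y \<in> X" for x y
      using psd_hermitian[OF psd that] by simp
    show "0 \<le> Re (form (\<lambda>x y. L x y - g x * cnj (g y)) xs xs)" if "xs \<in> combos X" for xs
      using norm[OF that]
      by (simp add: form_diff form_product complex_norm_square[symmetric] del: of_real_power)
  qed
  with on_T show ?thesis by blast
qed

section \<open>The complete Pick property\<close>

text \<open>
  A kernel on pairs of a point and a prescribed value.  Its positivity on a set of pairs is
  the Pick condition for the interpolation problem given by these pairs.
\<close>

definition pick_kernel :: "real \<Rightarrow> ('a \<Rightarrow> 'a \<Rightarrow> complex) \<Rightarrow> 'a \<times> complex \<Rightarrow> 'a \<times> complex \<Rightarrow> complex" where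
  "pick_kernel M K p q = (of_real (M\<^sup>2) - snd p * cnj (snd q)) * K (fst p) (fst q)"

text \<open>
  The last condition says that, for every base point \<open>a\<close>, the kernel
  \<open>1 - K x a K a y / (K a a K x y)\<close> is a finite sum of rank one kernels.  Without the restriction
  to finite sums this is the classical characterisation of complete Pick kernels.
\<close>

definition complete_pick :: "'a set \<Rightarrow> ('a \<Rightarrow> 'a \<Rightarrow> complex) \<Rightarrow> bool" where
  "complete_pick X K \<longleftrightarrow> psd X K \<and> (\<forall>x\<in>X. K x x \<noteq> 0) \<and>
     (\<forall>a\<in>X. \<exists>(I :: nat set) b. finite I \<and> (\<forall>x\<in>X. \<forall>y\<in>X.
        K x y - K x a * K a y / K a a = K x y * (\<Sum>i\<in>I. b i x * cnj (b i y))))"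

text \<open>
  Write \<open>\<phi> p\<close> for the value \<open>snd p\<close>, and let \<open>K'\<close> be the Gram kernel of the components
  orthogonal to the kernel function at \<open>a\<close>.  Its row at \<open>a\<close> vanishes, so \<open>L p q = M\<^sup>2 K - \<phi> p cnj (\<phi> q) K'\<close> makes sense on the enlarged
  set before the value \<open>w\<close> at \<open>a\<close> is known.  The Pick condition is \<open>L - h h\<^sup>*\<close> being positive,
  where \<open>h p = \<phi> p K p a / sqrt (K a a)\<close> is \<open>\<phi> p\<close> times the component along the kernel
  function at \<open>a\<close>.  It holds on the old points, so \<open>psd_extend\<close> applies, and the value of the extended \<open>h\<close>
  at \<open>a\<close> gives \<open>w\<close>.
\<close>

lemma pick_one_point:
  assumes K: "complete_pick X K" and G: "G \<subseteq> X \<times> UNIV" "psd G (pick_kernel M K)"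
    and a: "a \<in> X" "a \<notin> fst ` G"
  shows "\<exists>w. psd (insert (a, w) G) (pick_kernel M K)"
proof -
  have psdK: "psd X K" and "K a a \<noteq> 0" using K a by (auto simp: complete_pick_def)
  obtain I :: "nat set" and b where I: "finite I"
    and b: "\<And>x y. x \<in> X \<Longrightarrow> y \<in> X \<Longrightarrow>
      K x y - K x a * K a y / K a a = K x y * (\<Sum>i\<in>I. b i x * cnj (b i y))"
    using K a unfolding complete_pick_def by meson
  define k where "k = Re (K a a)"
  have Kaa: "K a a = of_real k" and k: "0 < k"
    using psd_diag[OF psdK a(1)] \<open>K a a \<noteq> 0\<close> by (auto simp: k_def less_le)
  \<comment> \<open>at \<open>x = y = a\<close> the defining identity of \<open>b\<close> reads \<open>0 = K a a * (\<Sum>i\<in>I. \<bar>b i a\<bar>\<^sup>2)\<close>\<close>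
  have ba: "b i a = 0" if "i \<in> I" for i
  proof -
    have "(\<Sum>i\<in>I. b i a * cnj (b i a)) = 0" using b[OF a(1) a(1)] k by (simp add: Kaa)
    moreover have "(\<Sum>i\<in>I. b i a * cnj (b i a)) = of_real (\<Sum>i\<in>I. (cmod (b i a))\<^sup>2)"
      unfolding of_real_sum by (simp only: complex_norm_square)
    ultimately have "(\<Sum>i\<in>I. (cmod (b i a))\<^sup>2) = 0" by (simp only: of_real_eq_0_iff)
    then show ?thesis using I that by (simp add: sum_nonneg_eq_0_iff)
  qed
  have herm: "K y x = cnj (K x y)" if "x \<in> X" "y \<in> X" for x y
    using psd_hermitian[OF psdK that] .
  define s where "s = complex_of_real (sqrt k)"
  have s: "s * s = of_real k" "cnj s = s" "s \<noteq> 0"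
    using k by (simp_all add: s_def flip: of_real_mult)
  \<comment> \<open>the value 0 is a placeholder for \<open>w\<close>; it does not enter \<open>L\<close> because \<open>K'\<close> vanishes there\<close>
  let ?a = "(a, 0 :: complex)"
  define L where "L = (\<lambda>p q. of_real (M\<^sup>2) * K (fst p) (fst q) - snd p * cnj (snd q) *
      (K (fst p) (fst q) - K (fst p) a * K a (fst q) / K a a))"
  have GX: "fst p \<in> X" if "p \<in> insert ?a G" for p using that G(1) a(1) by auto
  have psdL: "psd (insert ?a G) L"
  proof -
    \<comment> \<open>\<open>L = M\<^sup>2 (K - K') + (M\<^sup>2 - \<phi> \<phi>\<^sup>*) K'\<close>, and \<open>K' = K * (\<Sum>i\<in>I. b i b i\<^sup>*)\<close>\<close>
    let ?R = "\<lambda>p q. of_real (M\<^sup>2 / k) * (K (fst p) a * cnj (K (fst q) a))"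
    let ?S = "\<lambda>p q. \<Sum>i\<in>I. b i (fst p) * pick_kernel M K p q * cnj (b i (fst q))"
    have "psd (insert ?a G) (\<lambda>p q. ?R p q + ?S p q)"
      using k by (intro psd_add psd_scale psd_rank_one psd_sum I psd_congruence_insert G(2))
        (auto simp: ba)
    moreover have "?R p q + ?S p q = L p q" if "p \<in> insert ?a G" "q \<in> insert ?a G" for p q
    proof -
      let ?B = "\<Sum>i\<in>I. b i (fst p) * cnj (b i (fst q))"
      let ?T = "K (fst p) a * K a (fst q) / K a a"
      have e: "K (fst p) (fst q) * ?B = K (fst p) (fst q) - ?T"
        using b[OF GX[OF that(1)] GX[OF that(2)]] by simp
      have "?S p q = pick_kernel M K p q * ?B" by (simp add: sum_distrib_left mult_ac)
      also have "\<dots> = (of_real (M\<^sup>2) - snd p * cnj (snd q)) * (K (fst p) (fst q) - ?T)"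
        unfolding e[symmetric] by (simp add: pick_kernel_def)
      finally have S: "?S p q = (of_real (M\<^sup>2) - snd p * cnj (snd q)) * (K (fst p) (fst q) - ?T)" .
      have R: "?R p q = of_real (M\<^sup>2) * ?T"
        using herm[OF GX[OF that(2)] a(1)] by (simp add: Kaa)
      have "m * t + (m - u) * (k - t) = m * k - u * (k - t)" for m t u k :: complex
        by (simp add: algebra_simps)
      then show ?thesis unfolding S R L_def .
    qed
    ultimately show ?thesis by (rule psd_cong_imp)
  qed
  define h where "h = (\<lambda>p. snd p * K (fst p) a / s)"
  have hh: "h p * cnj (h q) = snd p * cnj (snd q) * (K (fst p) a * K a (fst q) / K a a)"
    if "p \<in> G" "q \<in> G" for p q
    using herm[of "fst q" a] GX[of q] that a(1) by (simp add: h_def s Kaa)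
  have GG: "L p q - h p * cnj (h q) = pick_kernel M K p q" if "p \<in> G" "q \<in> G" for p q
  proof -
    have "m * k - u * (k - t) - u * t = (m - u) * k" for m t u k :: complex
      by (simp add: algebra_simps)
    then show ?thesis unfolding hh[OF that] L_def pick_kernel_def .
  qed
  have "psd G (\<lambda>p q. L p q - h p * cnj (h q))"
    using G(2) by (rule psd_cong_imp) (simp only: GG)
  then obtain g where g: "\<And>p. p \<in> G \<Longrightarrow> g p = h p"
    "psd (insert ?a G) (\<lambda>p q. L p q - g p * cnj (g q))"
    using psd_extend[OF psdL subset_insertI] by blast
  define w where "w = g ?a / s"
  have gw: "g ?a = w * s" using s by (simp add: w_def)
  have aG: "?a \<notin> G" using a(2) by force
  define f where "f = (\<lambda>p. if p = ?a then (a, w) else p)"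
  have [simp]: "f ?a = (a, w)" "\<And>p. p \<in> G \<Longrightarrow> f p = p" using aG by (auto simp: f_def)
  have eq: "L p q - g p * cnj (g q) = pick_kernel M K (f p) (f q)"
    if pq: "p \<in> insert ?a G" "q \<in> insert ?a G" for p q
  proof -
    consider "p = ?a" "q = ?a" | "p = ?a" "q \<in> G" | "p \<in> G" "q = ?a" | "p \<in> G" "q \<in> G"
      using pq by blast
    then show ?thesis
    proof cases
      case 1
      have "g ?a * cnj (g ?a) = w * cnj w * (s * s)" unfolding gw by (simp add: s)
      then show ?thesis using 1 by (simp add: L_def pick_kernel_def Kaa s algebra_simps)
    next
      case 2
      have "g ?a * cnj (g q) = w * cnj (snd q) * K a (fst q)"
        using g(1)[OF 2(2)] herm[of "fst q" a] GX[of q] 2 a(1) s by (simp add: gw h_def)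
      then show ?thesis using 2 by (simp add: L_def pick_kernel_def algebra_simps)
    next
      case 3
      have "g p * cnj (g ?a) = snd p * cnj w * K (fst p) a"
        using g(1)[OF 3(1)] s by (simp add: gw h_def)
      then show ?thesis using 3 by (simp add: L_def pick_kernel_def algebra_simps)
    next
      case 4
      then show ?thesis using GG by (simp add: g(1))
    qed
  qed
  have "psd (insert ?a G) (\<lambda>p q. pick_kernel M K (f p) (f q))"
    using g(2) eq by (rule psd_cong_imp)
  then have "psd (f ` insert ?a G) (pick_kernel M K)" by (simp only: psd_image)
  moreover have "f ` insert ?a G = insert (a, w) G" by simp
  ultimately show ?thesis by auto
qed

lemma psd_Union_chain:
  assumes chain: "subset.chain \<A> \<C>" and psd: "\<And>G. G \<in> \<C> \<Longrightarrow> psd G K" and "\<C> \<noteq> {}"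
  shows "psd (\<Union>\<C>) K"
proof (rule psdI)
  have sub: "\<exists>G\<in>\<C>. F \<subseteq> G" if "finite F" "F \<subseteq> \<Union>\<C>" for F
    using finite_subset_Union_chain[OF that \<open>\<C> \<noteq> {}\<close> chain] by blast
  show "K q p = cnj (K p q)" if "p \<in> \<Union>\<C>" "q \<in> \<Union>\<C>" for p q
    using sub[of "{p, q}"] that psd_hermitian[OF psd] by auto
  show "0 \<le> Re (form K xs xs)" if "xs \<in> combos (\<Union>\<C>)" for xs
    using sub[of "fst ` set xs"] that psd_nonneg[OF psd] by (auto simp: combos_def)
qed

text \<open>
  Zorn's lemma is applied to sets of pairs that satisfy the Pick condition.  Such a set is
  automatically the graph of a function, because two values at one point contradict positivity,
  and a maximal one is total by \<open>pick_one_point\<close>.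
\<close>

theorem pick_extension:
  assumes K: "complete_pick X K" and e: "e ` I \<subseteq> X"
    and psd: "psd I (\<lambda>i j. (of_real (M\<^sup>2) - \<phi> i * cnj (\<phi> j)) * K (e i) (e j))"
  shows "\<exists>\<psi>. (\<forall>i\<in>I. \<psi> (e i) = \<phi> i) \<and> psd X (\<lambda>x y. (of_real (M\<^sup>2) - \<psi> x * cnj (\<psi> y)) * K x y)"
proof -
  define G0 where "G0 = (\<lambda>i. (e i, \<phi> i)) ` I"
  define \<A> where "\<A> = {G. G0 \<subseteq> G \<and> G \<subseteq> X \<times> UNIV \<and> psd G (pick_kernel M K)}"
  have "psd G0 (pick_kernel M K)"
    unfolding G0_def psd_image using psd by (simp add: pick_kernel_def)
  then have "G0 \<in> \<A>" using e by (auto simp: \<A>_def G0_def)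
  then have "\<A> \<noteq> {}" by blast
  moreover have "\<Union>\<C> \<in> \<A>" if "\<C> \<noteq> {}" "subset.chain \<A> \<C>" for \<C>
  proof -
    have "\<C> \<subseteq> \<A>" using that(2) by (simp add: subset.chain_def)
    then show ?thesis
      using that(1) psd_Union_chain[OF that(2) _ that(1)] unfolding \<A>_def by blast
  qed
  ultimately obtain G where G: "G \<in> \<A>" and max: "\<And>G'. G' \<in> \<A> \<Longrightarrow> G \<subseteq> G' \<Longrightarrow> G' = G"
    using subset_Zorn_nonempty[of \<A>] by blast
  have G': "G0 \<subseteq> G" "G \<subseteq> X \<times> UNIV" "psd G (pick_kernel M K)" using G by (auto simp: \<A>_def)
  have total: "\<exists>w. (a, w) \<in> G" if a: "a \<in> X" for a
  proof (rule ccontr)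
    assume "\<nexists>w. (a, w) \<in> G"
    then have n: "a \<notin> fst ` G" by force
    obtain w where "psd (insert (a, w) G) (pick_kernel M K)"
      using pick_one_point[OF K G'(2,3) a n] by blast
    then have "insert (a, w) G \<in> \<A>" using G' a by (auto simp: \<A>_def)
    then have "(a, w) \<in> G" using max by blast
    with n show False by force
  qed
  have unique: "w = v" if "(x, w) \<in> G" "(x, v) \<in> G" for x w v
  proof -
    have x: "x \<in> X" using that G'(2) by auto
    have psdK: "psd X K" and nz: "K x x \<noteq> 0" using K x by (auto simp: complete_pick_def)
    define k where "k = Re (K x x)"
    have k: "K x x = of_real k" "0 < k"
      using psd_diag[OF psdK x] nz by (auto simp: k_def less_le)
    \<comment> \<open>the form at this combination is \<open>- K x x \<bar>w - v\<bar>\<^sup>2\<close>\<close>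
    have "0 \<le> Re (form (pick_kernel M K) [((x, w), 1), ((x, v), -1)] [((x, w), 1), ((x, v), -1)])"
      using that by (intro psd_nonneg[OF G'(3)]) auto
    also have "form (pick_kernel M K) [((x, w), 1), ((x, v), -1)] [((x, w), 1), ((x, v), -1)] =
        - (of_real k * ((w - v) * cnj (w - v)))"
      by (simp add: form_def pick_kernel_def k algebra_simps)
    finally have "k * (cmod (w - v))\<^sup>2 \<le> 0"
      by (simp only: complex_norm_square[symmetric] flip: of_real_mult) simp
    then have "(cmod (w - v))\<^sup>2 \<le> 0" using k(2) by (simp add: mult_le_0_iff)
    then show ?thesis by simp
  qed
  define \<psi> where "\<psi> = (\<lambda>x. SOME w. (x, w) \<in> G)"
  have \<psi>: "(x, \<psi> x) \<in> G" if "x \<in> X" for x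
    unfolding \<psi>_def using total[OF that] by (rule someI_ex)
  have "\<psi> (e i) = \<phi> i" if "i \<in> I" for i
    using that e G'(1) by (intro unique[OF \<psi>]) (auto simp: G0_def)
  moreover have "psd ((\<lambda>x. (x, \<psi> x)) ` X) (pick_kernel M K)"
    using \<psi> by (intro psd_mono[OF G'(3)]) auto
  then have "psd X (\<lambda>x y. (of_real (M\<^sup>2) - \<psi> x * cnj (\<psi> y)) * K x y)"
    by (simp add: psd_image pick_kernel_def)
  ultimately show ?thesis by blast
qed

section \<open>Multipliers of a reproducing kernel Hilbert space\<close>

context hilbert_function_space
begin

lemma ip_add_right: "f \<in> H \<Longrightarrow> g \<in> H \<Longrightarrow> h \<in> H \<Longrightarrow> ip h (\<lambda>x. f x + g x) = ip h f + ip h g"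
  using ip_cnj[of "\<lambda>x. f x + g x" h] ip_cnj[of f h] ip_cnj[of g h] add_mem[of f g] ip_add[of f g h]
  by simp

lemma ip_scale_right: "f \<in> H \<Longrightarrow> h \<in> H \<Longrightarrow> ip h (\<lambda>x. a * f x) = cnj a * ip h f"
  using ip_cnj[of "\<lambda>x. a * f x" h] ip_cnj[of f h] scale_mem[of f a] ip_scale[of f h a] by simp

lemma diff_mem: "f \<in> H \<Longrightarrow> g \<in> H \<Longrightarrow> (\<lambda>x. f x - g x) \<in> H"
  using add_mem[of f "\<lambda>x. (-1) * g x"] scale_mem[of g "-1"] by simp

lemma ip_diff_right: "f \<in> H \<Longrightarrow> g \<in> H \<Longrightarrow> h \<in> H \<Longrightarrow> ip h (\<lambda>x. f x - g x) = ip h f - ip h g"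
  using ip_add_right[of f "\<lambda>x. (-1) * g x" h] scale_mem[of g "-1"] ip_scale_right[of g h "-1"] by simp

lemma ip_zero: "h \<in> H \<Longrightarrow> ip (\<lambda>x. 0) h = 0"
  using ip_scale[of "\<lambda>x. 0" h 0] zero_mem by simp

lemma ip_self: "f \<in> H \<Longrightarrow> ip f f = of_real ((ip_norm ip f)\<^sup>2)"
  using ip_cnj[of f f] ip_nonneg[of f] by (simp add: ip_norm_def complex_eq_iff)

lemma ip_norm_ge_0: "f \<in> H \<Longrightarrow> 0 \<le> ip_norm ip f"
  using ip_nonneg[of f] by (simp add: ip_norm_def)

lemma ip_norm_scale: "f \<in> H \<Longrightarrow> ip_norm ip (\<lambda>x. a * f x) = cmod a * ip_norm ip f"
proof -
  assume f: "f \<in> H"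
  have "ip (\<lambda>x. a * f x) (\<lambda>x. a * f x) = (a * cnj a) * ip f f"
    using f scale_mem[OF f, of a] by (simp add: ip_scale ip_scale_right)
  also have "\<dots> = of_real ((cmod a)\<^sup>2 * (ip_norm ip f)\<^sup>2)"
    unfolding of_real_mult complex_norm_square ip_self[OF f] by simp
  finally have "Re (ip (\<lambda>x. a * f x) (\<lambda>x. a * f x)) = (cmod a * ip_norm ip f)\<^sup>2"
    by (simp add: power_mult_distrib)
  then have "ip_norm ip (\<lambda>x. a * f x) = sqrt ((cmod a * ip_norm ip f)\<^sup>2)"
    unfolding ip_norm_def[of ip "\<lambda>x. a * f x"] by simp
  then show ?thesis using ip_norm_ge_0[OF f] by simp
qed

text \<open>
  An inner product is a positive kernel on the space itself, which makes the Cauchy--Schwarz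
  inequality for kernels available.
\<close>

lemma psd_ip: "psd H ip"
proof (rule psdI)
  show "ip g f = cnj (ip f g)" if "f \<in> H" "g \<in> H" for f g
    using ip_cnj[OF that] .
  define comb :: "(('a \<Rightarrow> complex) \<times> complex) list \<Rightarrow> 'a \<Rightarrow> complex"
    where "comb = (\<lambda>xs x. pairing (\<lambda>f. f x) xs)"
  have comb_Cons: "comb (p # xs) = (\<lambda>x. snd p * fst p x + comb xs x)" for p xs
    by (simp add: comb_def)
  have comb_Nil: "comb [] = (\<lambda>x. 0)" by (simp add: comb_def)
  have comb: "comb xs \<in> H" if "xs \<in> combos H" for xs
    using that by (induction xs) (auto simp: comb_Nil comb_Cons zero_mem intro: add_mem scale_mem)
  have left: "ip (comb xs) g = pairing (\<lambda>f. ip f g) xs" if "xs \<in> combos H" "g \<in> H" for xs g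
    using that by (induction xs) (auto simp: comb_Nil comb_Cons ip_zero ip_add ip_scale scale_mem comb)
  show "0 \<le> Re (form ip xs xs)" if xs: "xs \<in> combos H" for xs
  proof -
    have "form ip xs xs = pairing (\<lambda>f. ip f (comb xs)) xs"
      unfolding form_eq_pairing
    proof (rule pairing_cong[OF xs])
      fix f assume f: "f \<in> H"
      have "pairing (\<lambda>g. cnj (ip f g)) xs = pairing (\<lambda>g. ip g f) xs"
        by (rule pairing_cong[OF xs]) (rule ip_cnj[OF f, symmetric])
      also have "\<dots> = ip (comb xs) f" using left[OF xs f] by simp
      finally show "cnj (pairing (\<lambda>g. cnj (ip f g)) xs) = ip f (comb xs)"
        using ip_cnj[OF comb[OF xs] f] by simp
    qed
    also have "\<dots> = ip (comb xs) (comb xs)" using left[OF xs comb[OF xs]] by simp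
    finally show ?thesis using ip_nonneg[OF comb[OF xs]] by simp
  qed
qed

lemma ip_cauchy_schwarz:
  assumes "f \<in> H" "g \<in> H"
  shows "cmod (ip f g) \<le> ip_norm ip f * ip_norm ip g"
proof -
  have "(cmod (ip f g))\<^sup>2 \<le> Re (ip f f) * Re (ip g g)"
    using psd_cauchy_schwarz[OF psd_ip, of "[(f, 1)]" "[(g, 1)]"] assms by (simp add: form_def)
  also have "\<dots> = (ip_norm ip f * ip_norm ip g)\<^sup>2"
    using assms by (simp add: ip_norm_def ip_nonneg power_mult_distrib)
  finally show ?thesis
    by (rule power2_le_imp_le) (simp add: ip_norm_ge_0 assms)
qed

lemma ip_norm_triangle:
  assumes "f \<in> H" "g \<in> H"
  shows "ip_norm ip (\<lambda>x. f x + g x) \<le> ip_norm ip f + ip_norm ip g"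
proof (rule power2_le_imp_le)
  have "of_real ((ip_norm ip (\<lambda>x. f x + g x))\<^sup>2) = ip f f + ip f g + (ip g f + ip g g)"
    unfolding ip_self[OF add_mem[OF assms], symmetric]
    using assms add_mem[OF assms] by (simp add: ip_add ip_add_right)
  also have "Re \<dots> = (ip_norm ip f)\<^sup>2 + 2 * Re (ip f g) + (ip_norm ip g)\<^sup>2"
    using assms ip_cnj[OF assms] by (simp add: ip_self)
  finally have "(ip_norm ip (\<lambda>x. f x + g x))\<^sup>2 = (ip_norm ip f)\<^sup>2 + 2 * Re (ip f g) + (ip_norm ip g)\<^sup>2"
    by simp
  then show "(ip_norm ip (\<lambda>x. f x + g x))\<^sup>2 \<le> (ip_norm ip f + ip_norm ip g)\<^sup>2"
    using ip_cauchy_schwarz[OF assms] complex_Re_le_cmod[of "ip f g"] by (simp add: power2_sum)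
qed (simp add: ip_norm_ge_0 assms)

lemma mult_norm_bound:
  assumes \<psi>: "\<psi> \<in> multipliers H ip"
  shows "0 \<le> mult_norm H ip \<psi>"
    and "f \<in> H \<Longrightarrow> ip_norm ip (\<lambda>x. \<psi> x * f x) \<le> mult_norm H ip \<psi> * ip_norm ip f"
proof -
  obtain C where mem: "\<And>f. f \<in> H \<Longrightarrow> (\<lambda>x. \<psi> x * f x) \<in> H"
    and C: "\<And>f. f \<in> H \<Longrightarrow> ip_norm ip (\<lambda>x. \<psi> x * f x) \<le> C * ip_norm ip f"
    using \<psi> by (auto simp: multipliers_def)
  let ?S = "(\<lambda>f. ip_norm ip (\<lambda>x. \<psi> x * f x)) ` {f \<in> H. ip_norm ip f \<le> 1}"
  have "ip_norm ip (\<lambda>x. \<psi> x * f x) \<le> \<bar>C\<bar>" if "f \<in> H" "ip_norm ip f \<le> 1" for f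
  proof -
    have "C * ip_norm ip f \<le> \<bar>C\<bar> * ip_norm ip f"
      using ip_norm_ge_0[OF that(1)] by (intro mult_right_mono) auto
    also have "\<dots> \<le> \<bar>C\<bar> * 1" using that by (intro mult_left_mono) auto
    finally show ?thesis using C[OF that(1)] by simp
  qed
  then have bdd: "bdd_above ?S" by (auto simp: bdd_above_def)
  have upper: "ip_norm ip (\<lambda>x. \<psi> x * f x) \<le> mult_norm H ip \<psi>" if "f \<in> H" "ip_norm ip f \<le> 1" for f
    unfolding mult_norm_def using that by (intro cSUP_upper[OF _ bdd]) auto
  have n0: "ip_norm ip (\<lambda>x. 0) = 0" by (simp add: ip_norm_def ip_zero zero_mem)
  show ge0: "0 \<le> mult_norm H ip \<psi>"
    using upper[OF zero_mem] n0 by simp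
  assume f: "f \<in> H"
  show "ip_norm ip (\<lambda>x. \<psi> x * f x) \<le> mult_norm H ip \<psi> * ip_norm ip f"
  proof (cases "ip_norm ip f = 0")
    case True
    then show ?thesis using C[OF f] by simp
  next
    case False
    then have pos: "0 < ip_norm ip f" using ip_norm_ge_0[OF f] by simp
    define a where "a = complex_of_real (1 / ip_norm ip f)"
    have a: "cmod a = 1 / ip_norm ip f" using pos by (simp add: a_def norm_divide)
    have "ip_norm ip (\<lambda>x. \<psi> x * (a * f x)) \<le> mult_norm H ip \<psi>"
      using upper[OF scale_mem[OF f, of a]] ip_norm_scale[OF f, of a] a pos by simp
    also have "(\<lambda>x. \<psi> x * (a * f x)) = (\<lambda>x. a * (\<psi> x * f x))" by (simp add: mult_ac)
    also have "ip_norm ip (\<lambda>x. a * (\<psi> x * f x)) = cmod a * ip_norm ip (\<lambda>x. \<psi> x * f x)"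
      by (rule ip_norm_scale[OF mem[OF f]])
    finally show ?thesis using pos by (simp add: a field_simps)
  qed
qed

end

context rkhs
begin

text \<open>
  The element of the space represented by a formal combination.  The coefficients are conjugated,
  so that the inner product with this element is the linear functional \<open>pairing\<close>.
\<close>

definition kernel_comb :: "('a \<times> complex) list \<Rightarrow> 'a \<Rightarrow> complex" where
  "kernel_comb xs = (\<lambda>x. if x \<in> X then cnj (pairing (\<lambda>y. cnj (K x y)) xs) else 0)"

lemma kernel_comb_Cons:
  "kernel_comb (p # xs) = (\<lambda>x. cnj (snd p) * (if x \<in> X then K x (fst p) else 0) + kernel_comb xs x)"
  by (auto simp: kernel_comb_def)

lemma kernel_comb_Nil: "kernel_comb [] = (\<lambda>x. 0)"
  by (auto simp: kernel_comb_def)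

lemma kernel_comb_mem: "xs \<in> combos X \<Longrightarrow> kernel_comb xs \<in> H"
  by (induction xs)
    (auto simp: kernel_comb_Nil kernel_comb_Cons zero_mem intro!: add_mem scale_mem kernel_mem)

lemma ip_kernel_comb:
  assumes f: "f \<in> H" and "xs \<in> combos X"
  shows "ip f (kernel_comb xs) = pairing f xs"
  using assms(2)
proof (induction xs)
  case Nil
  show ?case using ip_cnj[OF zero_mem f] ip_zero[OF f] by (simp add: kernel_comb_Nil)
next
  case (Cons p xs)
  let ?k = "\<lambda>x. if x \<in> X then K x (fst p) else 0"
  have p: "?k \<in> H" "ip f ?k = f (fst p)" using Cons f kernel_mem reproducing by auto
  have "ip f (kernel_comb (p # xs)) = ip f (\<lambda>x. cnj (snd p) * ?k x) + ip f (kernel_comb xs)"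
    unfolding kernel_comb_Cons using Cons by (intro ip_add_right scale_mem p(1) kernel_comb_mem f) simp
  also have "\<dots> = snd p * f (fst p) + pairing f xs"
    using ip_scale_right[OF p(1) f, of "cnj (snd p)"] Cons p(2) by simp
  finally show ?case by simp
qed

lemma ip_kernel_combs:
  assumes "xs \<in> combos X" "ys \<in> combos X"
  shows "ip (kernel_comb ys) (kernel_comb xs) = form K xs ys"
  unfolding ip_kernel_comb[OF kernel_comb_mem[OF assms(2)] assms(1)] form_eq_pairing
  by (rule pairing_cong[OF assms(1)]) (simp add: kernel_comb_def)

lemma norm_kernel_comb: "xs \<in> combos X \<Longrightarrow> (ip_norm ip (kernel_comb xs))\<^sup>2 = Re (form K xs xs)"
  using ip_self[OF kernel_comb_mem, of xs] ip_kernel_combs[of xs xs] by simp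

lemma psd_kernel: "psd X K"
proof (rule psdI)
  show "K y x = cnj (K x y)" if "x \<in> X" "y \<in> X" for x y
    using ip_cnj[OF kernel_mem[OF that(1)] kernel_mem[OF that(2)]]
      reproducing[OF kernel_mem[OF that(1)] that(2)] reproducing[OF kernel_mem[OF that(2)] that(1)] that
    by simp
  show "0 \<le> Re (form K xs xs)" if "xs \<in> combos X" for xs
    unfolding norm_kernel_comb[OF that, symmetric] by simp
qed

lemma pairing_bound:
  assumes "f \<in> H" "xs \<in> combos X"
  shows "(cmod (pairing f xs))\<^sup>2 \<le> (ip_norm ip f)\<^sup>2 * Re (form K xs xs)"
  unfolding ip_kernel_comb[OF assms, symmetric] norm_kernel_comb[OF assms(2), symmetric] power_mult_distrib[symmetric]
  by (rule power_mono[OF ip_cauchy_schwarz[OF assms(1) kernel_comb_mem[OF assms(2)]]]) simp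

lemma pointwise_limit:
  assumes F: "\<And>n. F n \<in> H" "f \<in> H" and lim: "(\<lambda>n. ip_norm ip (\<lambda>x. F n x - f x)) \<longlonglongrightarrow> 0" and x: "x \<in> X"
  shows "(\<lambda>n. F n x) \<longlonglongrightarrow> f x"
proof -
  let ?k = "\<lambda>z. if z \<in> X then K z x else 0"
  have "cmod (F n x - f x) \<le> ip_norm ip (\<lambda>x. F n x - f x) * ip_norm ip ?k" for n
    using ip_cauchy_schwarz[OF diff_mem[OF F(1) F(2)] kernel_mem[OF x]]
      reproducing[OF diff_mem[OF F(1) F(2)] x] by simp
  moreover have "(\<lambda>n. ip_norm ip (\<lambda>x. F n x - f x) * ip_norm ip ?k) \<longlonglongrightarrow> 0"
    using tendsto_mult[OF lim tendsto_const] by simp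
  ultimately have "(\<lambda>n. F n x - f x) \<longlonglongrightarrow> 0"
    by (rule Lim_null_comparison[OF always_eventually[OF allI]])
  then show ?thesis by (rule LIM_zero_cancel)
qed

text \<open>
  A function that is bounded as a functional on combinations of kernel functions is represented by
  the limit of its approximate Riesz vectors, and by the reproducing property this limit is the
  function itself.
\<close>

lemma rkhs_membership:
  assumes off: "\<And>x. x \<notin> X \<Longrightarrow> h x = 0" and "0 \<le> C"
    and bound: "\<And>xs. xs \<in> combos X \<Longrightarrow> (cmod (pairing h xs))\<^sup>2 \<le> C\<^sup>2 * Re (form K xs xs)"
  shows "h \<in> H" and "ip_norm ip h \<le> C"
proof -
  obtain v where v: "\<And>n. v n \<in> combos X"
    "\<And>m n. Re (form K (v m @ smul (-1) (v n)) (v m @ smul (-1) (v n)))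
           \<le> 2 / real (Suc m) + 2 / real (Suc n)"
    "\<And>n xs. xs \<in> combos X \<Longrightarrow>
           (cmod (form K xs (v n) - pairing h xs))\<^sup>2 \<le> (1 + Re (form K xs xs)) / real (Suc n)"
    using psd_riesz[OF psd_kernel \<open>0 \<le> C\<close> bound] by blast
  define F where "F = (\<lambda>n. kernel_comb (v n))"
  have F: "F n \<in> H" for n unfolding F_def by (rule kernel_comb_mem[OF v(1)])
  have dist: "(ip_norm ip (\<lambda>x. F m x - F n x))\<^sup>2 \<le> 2 / real (Suc m) + 2 / real (Suc n)" for m n
  proof -
    have "(\<lambda>x. F m x - F n x) = kernel_comb (v m @ smul (-1) (v n))"
      by (auto simp: F_def kernel_comb_def)
    then show ?thesis using norm_kernel_comb[of "v m @ smul (-1) (v n)"] v(1,2) by simp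
  qed
  have cauchy: "\<forall>e>0. \<exists>N. \<forall>m\<ge>N. \<forall>n\<ge>N. ip_norm ip (\<lambda>x. F m x - F n x) < e"
  proof (intro allI impI)
    fix e :: real assume e: "0 < e"
    obtain N where N: "4 / e\<^sup>2 < real N" using reals_Archimedean2 by blast
    have "ip_norm ip (\<lambda>x. F m x - F n x) < e" if "m \<ge> N" "n \<ge> N" for m n
    proof -
      have "2 / real (Suc m) + 2 / real (Suc n) \<le> 2 / real (Suc N) + 2 / real (Suc N)"
        using that by (intro add_mono divide_left_mono) auto
      also have "\<dots> = 4 / real (Suc N)" by simp
      also have "\<dots> < e\<^sup>2"
      proof -
        have "4 < e\<^sup>2 * real N" using N e by (simp add: field_simps)
        also have "\<dots> \<le> e\<^sup>2 * real (Suc N)" by (intro mult_left_mono) auto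
        finally show ?thesis by (simp add: field_simps)
      qed
      finally have "(ip_norm ip (\<lambda>x. F m x - F n x))\<^sup>2 < e\<^sup>2" using dist[of m n] by linarith
      then show ?thesis using e by (simp add: power2_less_imp_less)
    qed
    then show "\<exists>N. \<forall>m\<ge>N. \<forall>n\<ge>N. ip_norm ip (\<lambda>x. F m x - F n x) < e" by blast
  qed
  obtain g where g: "g \<in> H" "(\<lambda>n. ip_norm ip (\<lambda>x. F n x - g x)) \<longlonglongrightarrow> 0"
    using complete[OF F cauchy] by blast
  have inv0: "(\<lambda>n. 1 / real (Suc n)) \<longlonglongrightarrow> 0"
    using LIMSEQ_inverse_real_of_nat by (simp add: inverse_eq_divide)
  have "g x = h x" for x
  proof (cases "x \<in> X")
    case True
    have "(cmod (F n x - h x))\<^sup>2 \<le> (1 + Re (K x x)) * (1 / real (Suc n))" for n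
      using v(3)[of "[(x, 1)]" n] True
      by (simp add: F_def kernel_comb_def form_eq_pairing)
    then have "cmod (F n x - h x) \<le> sqrt ((1 + Re (K x x)) * (1 / real (Suc n)))" for n
      by (rule real_le_rsqrt)
    moreover have "(\<lambda>n. sqrt ((1 + Re (K x x)) * (1 / real (Suc n)))) \<longlonglongrightarrow> 0"
      using tendsto_real_sqrt[OF tendsto_mult[OF tendsto_const inv0]]
      by (simp only: mult_zero_right real_sqrt_zero)
    ultimately have "(\<lambda>n. F n x - h x) \<longlonglongrightarrow> 0"
      by (rule Lim_null_comparison[OF always_eventually[OF allI]])
    then have "(\<lambda>n. F n x) \<longlonglongrightarrow> h x" by (rule LIM_zero_cancel)
    then show ?thesis using pointwise_limit[OF F g True] LIMSEQ_unique by blast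
  next
    case False
    then show ?thesis using off vanishes_off[OF g(1)] by simp
  qed
  then have gh: "g = h" by (rule ext)
  show h: "h \<in> H" using g(1) unfolding gh .
  let ?d = "\<lambda>n. ip_norm ip (\<lambda>x. F n x - h x)" and ?q = "ip_norm ip h"
  have lim: "?d \<longlonglongrightarrow> 0" using g(2) unfolding gh .
  \<comment> \<open>\<open>\<parallel>h\<parallel>\<^sup>2 = ip h h\<close> is close to \<open>ip h (F n)\<close>, which is bounded by \<open>C \<parallel>F n\<parallel>\<close>\<close>
  have "?q\<^sup>2 \<le> C * (?q + ?d n) + ?q * ?d n" for n
  proof -
    have D: "(\<lambda>x. F n x - h x) \<in> H" by (rule diff_mem[OF F h])
    have "ip_norm ip (F n) \<le> ?q + ?d n"
      using ip_norm_triangle[OF h D] by simp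
    moreover have "cmod (ip h (F n)) \<le> C * ip_norm ip (F n)"
    proof (rule power2_le_imp_le)
      show "(cmod (ip h (F n)))\<^sup>2 \<le> (C * ip_norm ip (F n))\<^sup>2"
        using bound[OF v(1)] ip_kernel_comb[OF h v(1)] norm_kernel_comb[OF v(1)]
        by (simp add: F_def power_mult_distrib)
    qed (simp add: \<open>0 \<le> C\<close> ip_norm_ge_0 F)
    moreover have "C * ip_norm ip (F n) \<le> C * (?q + ?d n)"
      using calculation(1) \<open>0 \<le> C\<close> by (rule mult_left_mono)
    moreover have "cmod (ip h h) \<le> cmod (ip h (F n)) + cmod (ip h (\<lambda>x. F n x - h x))"
      using norm_triangle_ineq4[of "ip h (F n)" "ip h (\<lambda>x. F n x - h x)"] F h
      by (simp add: ip_diff_right)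
    moreover have "cmod (ip h (\<lambda>x. F n x - h x)) \<le> ?q * ?d n"
      by (rule ip_cauchy_schwarz[OF h D])
    moreover have "cmod (ip h h) = ?q\<^sup>2" unfolding ip_self[OF h] by (simp add: norm_power)
    ultimately show ?thesis by linarith
  qed
  moreover have "(\<lambda>n. C * (?q + ?d n) + ?q * ?d n) \<longlonglongrightarrow> C * (?q + 0) + ?q * 0"
    by (intro tendsto_intros lim)
  ultimately have "?q\<^sup>2 \<le> C * (?q + 0) + ?q * 0"
    by (intro LIMSEQ_le_const) auto
  then have "?q * ?q \<le> C * ?q" by (simp add: power2_eq_square)
  then show "?q \<le> C"
    using ip_norm_ge_0[OF h] \<open>0 \<le> C\<close> by (cases "?q = 0") (auto simp: mult_le_cancel_right)
qed

text \<open>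
  By \<open>form_defect\<close>, positivity bounds the dual action \<open>modulate \<psi>\<close> by \<open>M\<close>, so \<open>\<psi> f\<close> is a functional
  of norm at most \<open>M \<parallel>f\<parallel>\<close> and hence a member of the space.
\<close>

theorem psd_imp_multiplier:
  assumes psd: "psd X (\<lambda>x y. (of_real (M\<^sup>2) - \<psi> x * cnj (\<psi> y)) * K x y)" and M: "0 \<le> M"
  shows "\<psi> \<in> multipliers H ip" and "mult_norm H ip \<psi> \<le> M"
proof -
  have *: "(\<lambda>x. \<psi> x * f x) \<in> H" "ip_norm ip (\<lambda>x. \<psi> x * f x) \<le> M * ip_norm ip f" if f: "f \<in> H" for f
  proof -
    have C: "0 \<le> M * ip_norm ip f" using M ip_norm_ge_0[OF f] by simp
    have bound: "(cmod (pairing (\<lambda>x. \<psi> x * f x) xs))\<^sup>2 \<le> (M * ip_norm ip f)\<^sup>2 * Re (form K xs xs)"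
      if xs: "xs \<in> combos X" for xs
    proof -
      define ys where "ys = modulate \<psi> xs"
      have ys: "ys \<in> combos X" using xs by (simp add: ys_def)
      have "pairing (\<lambda>x. \<psi> x * f x) xs = pairing f ys"
        by (simp add: ys_def pairing_modulate)
      then have "(cmod (pairing (\<lambda>x. \<psi> x * f x) xs))\<^sup>2 \<le> (ip_norm ip f)\<^sup>2 * Re (form K ys ys)"
        using pairing_bound[OF f ys] by simp
      also have "\<dots> \<le> (ip_norm ip f)\<^sup>2 * (M\<^sup>2 * Re (form K xs xs))"
      proof (rule mult_left_mono)
        show "Re (form K ys ys) \<le> M\<^sup>2 * Re (form K xs xs)"
          using psd_nonneg[OF psd xs] unfolding form_defect ys_def[symmetric]
          by (simp flip: of_real_power)
      qed simp
      finally show ?thesis by (simp add: power_mult_distrib mult_ac)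
    qed
    show "(\<lambda>x. \<psi> x * f x) \<in> H"
      by (rule rkhs_membership(1)[OF _ C bound]) (simp add: vanishes_off[OF f])
    show "ip_norm ip (\<lambda>x. \<psi> x * f x) \<le> M * ip_norm ip f"
      by (rule rkhs_membership(2)[OF _ C bound]) (simp add: vanishes_off[OF f])
  qed
  show "\<psi> \<in> multipliers H ip" using * by (auto simp: multipliers_def)
  show "mult_norm H ip \<psi> \<le> M"
    unfolding mult_norm_def
  proof (rule cSUP_least)
    have "ip_norm ip (\<lambda>x. 0) = 0" by (simp add: ip_norm_def ip_zero zero_mem)
    then show "{f \<in> H. ip_norm ip f \<le> 1} \<noteq> {}" using zero_mem by force
    show "ip_norm ip (\<lambda>x. \<psi> x * f x) \<le> M" if "f \<in> {f \<in> H. ip_norm ip f \<le> 1}" for f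
      using *(2)[of f] mult_left_mono[of "ip_norm ip f" 1 M] M that by simp
  qed
qed

text \<open>
  The adjoint of multiplication by \<open>\<psi>\<close> acts on combinations of kernel functions as
  \<open>modulate \<psi>\<close>, and it has the same norm.
\<close>

theorem multiplier_imp_psd:
  assumes \<psi>: "\<psi> \<in> multipliers H ip"
  shows "psd X (\<lambda>x y. (of_real ((mult_norm H ip \<psi>)\<^sup>2) - \<psi> x * cnj (\<psi> y)) * K x y)"
proof (rule psdI)
  let ?N = "mult_norm H ip \<psi>"
  show "(of_real (?N\<^sup>2) - \<psi> y * cnj (\<psi> x)) * K y x = cnj ((of_real (?N\<^sup>2) - \<psi> x * cnj (\<psi> y)) * K x y)"
    if "x \<in> X" "y \<in> X" for x y
    using psd_hermitian[OF psd_kernel that] by simp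
  show "0 \<le> Re (form (\<lambda>x y. (of_real (?N\<^sup>2) - \<psi> x * cnj (\<psi> y)) * K x y) xs xs)" if xs: "xs \<in> combos X" for xs
  proof -
    define ys where "ys = modulate \<psi> xs"
    have ys: "ys \<in> combos X" using xs by (simp add: ys_def)
    define u where "u = kernel_comb ys"
    have u: "u \<in> H" unfolding u_def by (rule kernel_comb_mem[OF ys])
    let ?q = "ip_norm ip u" and ?p = "ip_norm ip (kernel_comb xs)"
    have p0: "0 \<le> ?p" by (rule ip_norm_ge_0[OF kernel_comb_mem[OF xs]])
    have \<psi>u: "(\<lambda>x. \<psi> x * u x) \<in> H" using \<psi> u by (auto simp: multipliers_def)
    have "of_real (?q\<^sup>2) = pairing u ys"
      using ip_kernel_comb[OF u ys] ip_self[OF u] by (simp add: u_def)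
    also have "\<dots> = pairing (\<lambda>x. \<psi> x * u x) xs"
      by (simp add: ys_def pairing_modulate)
    also have "\<dots> = ip (\<lambda>x. \<psi> x * u x) (kernel_comb xs)"
      by (rule ip_kernel_comb[OF \<psi>u xs, symmetric])
    finally have "cmod (of_real (?q\<^sup>2)) = cmod (ip (\<lambda>x. \<psi> x * u x) (kernel_comb xs))" by simp
    also have "\<dots> \<le> ip_norm ip (\<lambda>x. \<psi> x * u x) * ?p"
      by (rule ip_cauchy_schwarz[OF \<psi>u kernel_comb_mem[OF xs]])
    also have "\<dots> \<le> ?N * ?q * ?p"
      by (rule mult_right_mono[OF mult_norm_bound(2)[OF \<psi> u] p0])
    finally have "?q * ?q \<le> (?N * ?p) * ?q" by (simp add: norm_mult power2_eq_square mult_ac)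
    then have "?q \<le> ?N * ?p"
      using ip_norm_ge_0[OF u] p0 mult_norm_bound(1)[OF \<psi>]
      by (cases "?q = 0") (auto simp: mult_le_cancel_right)
    then have "?q\<^sup>2 \<le> (?N * ?p)\<^sup>2" using ip_norm_ge_0[OF u] by (rule power_mono)
    then have "Re (form K ys ys) \<le> ?N\<^sup>2 * Re (form K xs xs)"
      unfolding u_def norm_kernel_comb[OF ys] norm_kernel_comb[OF xs] power_mult_distrib .
    then show ?thesis
      unfolding form_defect ys_def[symmetric] by (simp flip: of_real_power)
  qed
qed

end

section \<open>The Drury--Arveson kernel and its restriction to the annulus\<close>

lemma cinner2_neq_1: "x \<in> unit_ball2 \<Longrightarrow> y \<in> unit_ball2 \<Longrightarrow> 1 - cinner2 x y \<noteq> 0"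
proof
  assume xy: "x \<in> unit_ball2" "y \<in> unit_ball2" and "1 - cinner2 x y = 0"
  then have "cmod (cinner2 x y) = 1" by (metis eq_iff_diff_eq_0 norm_one)
  then show False
    using cmod_cinner2_bound[OF xy] norm_triangle_ineq[of "fst x * cnj (fst y)" "snd x * cnj (snd y)"]
    by (simp add: cinner2_def)
qed

text \<open>
  For base points \<open>a \<noteq> 0\<close> the two rank one kernels come from the components of an automorphism of
  the ball that maps \<open>a\<close> to 0: one along \<open>a\<close> and one orthogonal to it.
\<close>

lemma complete_pick_drury_arveson: "complete_pick unit_ball2 da_kernel"
  unfolding complete_pick_def
proof (intro conjI ballI)
  obtain H ip where "drury_arveson H ip" using drury_arveson_exists by blast
  then show "psd unit_ball2 da_kernel" by (rule rkhs.psd_kernel)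
next
  fix x assume "x \<in> unit_ball2"
  then show "da_kernel x x \<noteq> 0" using cinner2_neq_1[of x x] by (simp add: da_kernel_def)
next
  fix a assume a: "a \<in> unit_ball2"
  define n where "n = (cmod (fst a))\<^sup>2 + (cmod (snd a))\<^sup>2"
  have n: "0 \<le> n" "n < 1" using a by (auto simp: n_def unit_ball2_def)
  have aa: "cinner2 a a = of_real n"
    unfolding cinner2_def n_def of_real_add complex_norm_square by simp
  show "\<exists>(I :: nat set) b. finite I \<and> (\<forall>x\<in>unit_ball2. \<forall>y\<in>unit_ball2.
      da_kernel x y - da_kernel x a * da_kernel a y / da_kernel a a =
      da_kernel x y * (\<Sum>i\<in>I. b i x * cnj (b i y)))"
  proof (cases "n = 0")
    case True
    then have "fst a = 0" "snd a = 0" unfolding n_def by (simp_all add: add_nonneg_eq_0_iff)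
    then have k: "da_kernel x a = 1" "da_kernel a y = 1" for x y
      by (simp_all add: da_kernel_def cinner2_def)
    define b :: "nat \<Rightarrow> complex \<times> complex \<Rightarrow> complex"
      where "b = (\<lambda>i x. if i = 0 then fst x else snd x)"
    have "da_kernel x y - 1 = da_kernel x y * (\<Sum>i\<in>{0, 1}. b i x * cnj (b i y))"
      if "x \<in> unit_ball2" "y \<in> unit_ball2" for x y
    proof -
      have "(\<Sum>i\<in>{0, 1}. b i x * cnj (b i y)) = cinner2 x y" by (simp add: b_def cinner2_def)
      then show ?thesis using cinner2_neq_1[OF that] by (simp add: da_kernel_def field_simps)
    qed
    then show ?thesis using k by (intro exI[of _ "{0, 1}"] exI[of _ b]) simp
  next
    case False
    then have n0: "0 < n" using n by simp
    define s where "s = complex_of_real (sqrt n)"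
    define t where "t = complex_of_real (sqrt (1 / n - 1))"
    have s: "s * s = of_real n" "cnj s = s" using n0 by (simp_all add: s_def flip: of_real_mult)
    have t: "t * t = 1 / of_real n - 1" "cnj t = t"
      using n0 n by (simp_all add: t_def flip: of_real_mult) 
    define W where "W = (\<lambda>x :: complex \<times> complex. fst x * snd a - snd x * fst a)"
    define b :: "nat \<Rightarrow> complex \<times> complex \<Rightarrow> complex"
      where "b = (\<lambda>i x. if i = 0 then (cinner2 x a - of_real n) / s / (1 - cinner2 x a)
        else t * W x / (1 - cinner2 x a))"
    have "da_kernel x y - da_kernel x a * da_kernel a y / da_kernel a a =
        da_kernel x y * (\<Sum>i\<in>{0, 1}. b i x * cnj (b i y))"
      if xy: "x \<in> unit_ball2" "y \<in> unit_ball2" for x y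
    proof -
      define P Q R N where "P = cinner2 x a" and "Q = cinner2 a y" and "R = cinner2 x y"
        and "N = complex_of_real n"
      have nz: "1 - P \<noteq> 0" "1 - Q \<noteq> 0" "1 - R \<noteq> 0" "N \<noteq> 0" "1 - N \<noteq> 0"
        using cinner2_neq_1 xy a n0 n(2) aa by (auto simp: P_def Q_def R_def N_def)
      have Q: "cnj (cinner2 y a) = Q" by (simp add: Q_def cinner2_def mult.commute)
      \<comment> \<open>Lagrange's identity: \<open>\<bar>a\<bar>\<^sup>2 \<langle>x, y\<rangle> - \<langle>x, a\<rangle> \<langle>a, y\<rangle>\<close> is the product of \<open>x \<and> a\<close> and the conjugate of \<open>y \<and> a\<close>\<close>
      have lagrange: "W x * cnj (W y) = R * N - P * Q"
        unfolding N_def aa[symmetric] by (simp add: W_def P_def Q_def R_def cinner2_def algebra_simps)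
      have "b 0 x * cnj (b 0 y) = (P - N) * (Q - N) / (s * s) / ((1 - P) * (1 - Q))"
        by (simp add: b_def Q s(2) P_def N_def)
      moreover have "b 1 x * cnj (b 1 y) = (t * t) * (W x * cnj (W y)) / ((1 - P) * (1 - Q))"
        by (simp add: b_def Q t(2) P_def)
      ultimately have S: "(\<Sum>i\<in>{0, 1}. b i x * cnj (b i y)) =
          ((P - N) * (Q - N) / N + (1 / N - 1) * (R * N - P * Q)) / ((1 - P) * (1 - Q))"
        unfolding lagrange t s(1) N_def[symmetric] by (simp add: add_divide_distrib)
      have "(P - N) * (Q - N) / N + (1 / N - 1) * (R * N - P * Q) =
          (1 - P) * (1 - Q) - (1 - R) * (1 - N)"
        using nz(4) by (simp add: field_simps)
      then have S': "(\<Sum>i\<in>{0, 1}. b i x * cnj (b i y)) =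
          1 - (1 - R) * (1 - N) / ((1 - P) * (1 - Q))"
        unfolding S using nz by (simp add: diff_divide_distrib)
      have k: "da_kernel x y = 1 / (1 - R)" "da_kernel x a = 1 / (1 - P)"
        "da_kernel a y = 1 / (1 - Q)" "da_kernel a a = 1 / (1 - N)"
        by (simp_all add: da_kernel_def P_def Q_def R_def N_def aa)
      show ?thesis unfolding S' k using nz by (simp add: field_simps)
    qed
    then show ?thesis by (intro exI[of _ "{0, 1}"] exI[of _ b]) simp
  qed
qed

text \<open>
  The sum of the Szego kernels, in the variables \<open>z\<close> and \<open>w\<close>, of the disc of radius \<open>\<rho>\<close> and of
  the exterior of the disc of radius \<open>\<sigma>\<close>, the latter without the constant function.
\<close>

definition annulus_kernel :: "real \<Rightarrow> real \<Rightarrow> complex \<Rightarrow> complex \<Rightarrow> complex" where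
  "annulus_kernel \<sigma> \<rho> z w =
     1 / (1 - z * cnj w / of_real (\<rho>\<^sup>2)) + (of_real (\<sigma>\<^sup>2) / (z * cnj w)) / (1 - of_real (\<sigma>\<^sup>2) / (z * cnj w))"

lemma annulus_product_bounds:
  assumes "0 < r" "z \<in> annulus r" "w \<in> annulus r"
  shows "r\<^sup>2 < cmod (z * cnj w)" "cmod (z * cnj w) < 1"
proof -
  have zw: "r < cmod z" "cmod z < 1" "r < cmod w" "cmod w < 1"
    using assms by (auto simp: annulus_def)
  have "r * r < cmod z * cmod w" using zw assms(1) by (intro mult_strict_mono) auto
  then show "r\<^sup>2 < cmod (z * cnj w)" by (simp add: norm_mult power2_eq_square)
  have "cmod z * cmod w < 1 * 1" using zw assms(1) by (intro mult_strict_mono) auto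
  then show "cmod (z * cnj w) < 1" by (simp add: norm_mult)
qed

lemma annulus_embedding_mem:
  assumes "0 < r" "z \<in> annulus r"
  shows "annulus_embedding r z \<in> unit_ball2"
proof -
  define x where "x = (cmod z)\<^sup>2"
  have z: "r < cmod z" "cmod z < 1" using assms by (auto simp: annulus_def)
  have x: "r\<^sup>2 < x" "x < 1" "0 < x"
    using power_strict_mono[OF z(1), of 2] power_strict_mono[OF z(2), of 2] z assms(1)
    by (auto simp: x_def)
  have "0 < (1 - x) * (x - r\<^sup>2)" using x by simp
  then have *: "x * x + r\<^sup>2 < x * (r\<^sup>2 + 1)" by (simp add: algebra_simps)
  have sq: "(sqrt (r\<^sup>2 + 1))\<^sup>2 = r\<^sup>2 + 1" by simp
  have r: "0 < r\<^sup>2 + 1" by (simp add: add_nonneg_pos)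
  have "(cmod (z / of_real (sqrt (r\<^sup>2 + 1))))\<^sup>2 = x / (r\<^sup>2 + 1)"
    unfolding x_def norm_divide power_divide norm_of_real power2_abs sq ..
  moreover have "(cmod (of_real (r / sqrt (r\<^sup>2 + 1)) * (1 / z)))\<^sup>2 = r\<^sup>2 / (r\<^sup>2 + 1) * (1 / x)"
    unfolding x_def norm_mult norm_divide power_divide norm_of_real power2_abs power_mult_distrib sq by simp
  moreover have "x / d + q / d * (1 / x) = (x * x + q) / (x * d)" if "0 < d" for d q
    using x that by (simp add: field_simps)
  from this[OF r] have "x / (r\<^sup>2 + 1) + r\<^sup>2 / (r\<^sup>2 + 1) * (1 / x) = (x * x + r\<^sup>2) / (x * (r\<^sup>2 + 1))" .
  moreover have "(x * x + r\<^sup>2) / (x * (r\<^sup>2 + 1)) < 1"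
    using * x r by (subst pos_divide_less_eq) auto
  ultimately show ?thesis by (simp add: unit_ball2_def annulus_embedding_def)
qed

text \<open>
  With \<open>t = z cnj w\<close>, the denominator \<open>1 + r\<^sup>2 - t - r\<^sup>2/t\<close> of the left-hand side factors as
  \<open>(1 - t) (1 - r\<^sup>2/t)\<close>.  The identity is the partial fraction decomposition of its reciprocal.
\<close>

lemma da_kernel_annulus:
  assumes "0 < r" "r < 1" "z \<in> annulus r" "w \<in> annulus r"
  shows "da_kernel (annulus_embedding r z) (annulus_embedding r w) =
    of_real ((1 + r\<^sup>2) / (1 - r\<^sup>2)) * annulus_kernel r 1 z w"
proof -
  define t R where "t = z * cnj w" and "R = complex_of_real (r\<^sup>2)"
  have bd: "r\<^sup>2 < cmod t" "cmod t < 1"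
    unfolding t_def using annulus_product_bounds[OF assms(1,3,4)] by auto
  have r1: "r\<^sup>2 < 1" using assms by (simp add: power_less_one_iff)
  have "cmod R = r\<^sup>2" by (simp add: R_def norm_power)
  then have nz: "t \<noteq> 0" "1 - t \<noteq> 0" "t - R \<noteq> 0" "1 - R \<noteq> 0" using bd r1 by (auto simp: norm_one)
  have r: "R + 1 \<noteq> 0"
  proof -
    have "R + 1 = of_real (r\<^sup>2 + 1)" by (simp add: R_def)
    moreover have "r\<^sup>2 + 1 \<noteq> 0" by (smt (verit) zero_le_power2)
    ultimately show ?thesis by (simp only: of_real_eq_0_iff not_False_eq_True)
  qed
  let ?s = "complex_of_real (sqrt (r\<^sup>2 + 1))"
  have s2: "?s * ?s = R + 1" by (simp add: R_def flip: of_real_mult)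
  have "cinner2 (annulus_embedding r z) (annulus_embedding r w) = (t + R / t) / (?s * ?s)"
    unfolding cinner2_def annulus_embedding_def t_def R_def
    by (simp add: add_divide_distrib power2_eq_square)
  then have k: "da_kernel (annulus_embedding r z) (annulus_embedding r w) =
      1 / (1 - (t + R / t) / (R + 1))"
    by (simp add: da_kernel_def s2)
  have "1 - (t + R / t) / d = (t * d - t * t - R) / (t * d)" if "d \<noteq> 0" for d
    using nz that by (simp add: field_simps)
  moreover have "t * (R + 1) - t * t - R = (1 - t) * (t - R)" by (simp add: algebra_simps)
  ultimately have "1 - (t + R / t) / (R + 1) = (1 - t) * (t - R) / (t * (R + 1))"
    using r by simp
  then have k': "da_kernel (annulus_embedding r z) (annulus_embedding r w) =
      t * (R + 1) / ((1 - t) * (t - R))"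
    unfolding k by simp
  have "annulus_kernel r 1 z w = 1 / (1 - t) + (R / t) / (1 - R / t)"
    by (simp add: annulus_kernel_def t_def R_def)
  also have "\<dots> = 1 / (1 - t) + R / (t - R)" using nz by (simp add: field_simps)
  also have "\<dots> = t * (1 - R) / ((1 - t) * (t - R))" using nz by (simp add: field_simps)
  finally have "annulus_kernel r 1 z w = t * (1 - R) / ((1 - t) * (t - R))" .
  moreover have "of_real ((1 + r\<^sup>2) / (1 - r\<^sup>2)) = (R + 1) / (1 - R)" by (simp add: R_def)
  ultimately show ?thesis unfolding k' using nz by simp
qed

text \<open>
  The Laurent coefficients of \<open>annulus_kernel r 1\<close> as a function of \<open>z cnj w\<close>.
\<close>

definition laurent_weight :: "real \<Rightarrow> int \<Rightarrow> real" where
  "laurent_weight r m = (if 0 \<le> m then 1 else r powi (- 2 * m))"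

lemma sum_symmetric_int:
  fixes f :: "int \<Rightarrow> 'b::comm_monoid_add"
  shows "(\<Sum>m\<in>{- int N..<int N}. f m) = (\<Sum>k<N. f (int k) + f (- int (Suc k)))"
proof (induction N)
  case (Suc N)
  have "{- int (Suc N)..<int (Suc N)} = insert (int N) (insert (- int (Suc N)) {- int N..<int N})"
    by auto
  then have "(\<Sum>m\<in>{- int (Suc N)..<int (Suc N)}. f m) =
      f (int N) + (f (- int (Suc N)) + (\<Sum>m\<in>{- int N..<int N}. f m))"
    by simp
  then show ?case using Suc by (simp add: add_ac)
qed simp

lemma annulus_kernel_series:
  assumes "0 < r" "z \<in> annulus r" "w \<in> annulus r"
  shows "(\<lambda>N. \<Sum>m\<in>{- int N..<int N}. of_real (laurent_weight r m) * (z powi m * cnj (w powi m)))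
           \<longlonglongrightarrow> annulus_kernel r 1 z w"
proof -
  define t where "t = z * cnj w"
  define q where "q = complex_of_real (r\<^sup>2) / t"
  have bd: "r\<^sup>2 < cmod t" "cmod t < 1"
    unfolding t_def using annulus_product_bounds[OF assms] by auto
  have t0: "0 < cmod t" using bd(1) by (meson le_less_trans zero_le_power2)
  have q: "cmod q < 1" unfolding q_def using bd t0 by (simp add: norm_divide norm_power)
  have a: "(\<lambda>k. t ^ k) sums (1 / (1 - t))" by (rule geometric_sums[OF bd(2)])
  have "(\<lambda>k. q * q ^ k) sums (q * (1 / (1 - q)))" by (rule sums_mult[OF geometric_sums[OF q]])
  then have "(\<lambda>k. t ^ k + q * q ^ k) sums (1 / (1 - t) + q * (1 / (1 - q)))"
    by (rule sums_add[OF a])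
  moreover have "1 / (1 - t) + q * (1 / (1 - q)) = annulus_kernel r 1 z w"
    by (simp add: annulus_kernel_def t_def q_def)
  moreover have "t ^ k = of_real (laurent_weight r (int k)) * (z powi int k * cnj (w powi int k))" for k
    by (simp add: t_def laurent_weight_def power_mult_distrib)
  moreover have "q * q ^ k = of_real (laurent_weight r (- int (Suc k))) *
      (z powi (- int (Suc k)) * cnj (w powi (- int (Suc k))))" for k
  proof -
    have "q * q ^ k = (complex_of_real (r\<^sup>2)) ^ Suc k / t ^ Suc k"
      unfolding power_divide[symmetric] by (simp add: q_def)
    moreover have "laurent_weight r (- int (Suc k)) = (r\<^sup>2) ^ Suc k"
    proof -
      have "- 2 * - int (Suc k) = int (2 * Suc k)" by simp
      then have "laurent_weight r (- int (Suc k)) = r powi int (2 * Suc k)"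
        unfolding laurent_weight_def by (simp add: algebra_simps)
      also have "\<dots> = (r\<^sup>2) ^ Suc k" unfolding power_int_of_nat by (rule power_mult)
      finally show ?thesis .
    qed
    moreover have "z powi (- int (Suc k)) * cnj (w powi (- int (Suc k))) = 1 / t ^ Suc k"
      by (simp only: power_int_minus power_int_of_nat) (simp add: t_def power_mult_distrib field_simps)
    ultimately show ?thesis by simp
  qed
  ultimately show ?thesis
    unfolding sum_symmetric_int sums_def by simp
qed

lemma form_sum_products:
  assumes "finite J"
  shows "form (\<lambda>x y. \<Sum>m\<in>J. of_real (a m) * (g m x * cnj (g m y))) xs xs =
    of_real (\<Sum>m\<in>J. a m * (cmod (pairing (g m) xs))\<^sup>2)"
  using assms
proof (induction J rule: finite_induct)
  case empty
  show ?case by (simp add: form_eq_pairing)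
next
  case (insert m J)
  have "form (\<lambda>x y. of_real (a m) * (g m x * cnj (g m y))) xs xs =
      of_real (a m * (cmod (pairing (g m) xs))\<^sup>2)"
    unfolding form_mult form_product of_real_mult complex_norm_square ..
  then show ?case using insert by (simp add: form_add)
qed

lemma annulus_form_series:
  assumes "0 < r" "xs \<in> combos (annulus r)"
  shows "(\<lambda>N. \<Sum>m\<in>{- int N..<int N}. laurent_weight r m * (cmod (pairing (\<lambda>z. z powi m) xs))\<^sup>2)
           \<longlonglongrightarrow> Re (form (annulus_kernel r 1) xs xs)"
proof -
  have "(\<lambda>N. Re (form (\<lambda>z w. \<Sum>m\<in>{- int N..<int N}.
      of_real (laurent_weight r m) * (z powi m * cnj (w powi m))) xs xs))
      \<longlonglongrightarrow> Re (form (annulus_kernel r 1) xs xs)"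
    by (intro tendsto_Re form_tendsto[of "annulus r"] annulus_kernel_series assms)
  then show ?thesis by (subst (asm) form_sum_products) (auto simp del: of_real_sum)
qed

section \<open>Circle means and the Cauchy formula on the annulus\<close>

text \<open>
  The mean value over the circle of radius \<open>\<rho>\<close> around 0, that is, the contour integral of
  \<open>F \<zeta> / \<zeta>\<close> divided by \<open>2 pi \<i>\<close>.
\<close>

definition has_circle_mean :: "(complex \<Rightarrow> complex) \<Rightarrow> complex \<Rightarrow> real \<Rightarrow> bool" where
  "has_circle_mean F I \<rho> \<longleftrightarrow>
     ((\<lambda>t. F (of_real \<rho> * exp (2 * of_real pi * \<i> * of_real t))) has_integral I) {0..1}"

lemma cmod_circle: "0 < \<rho> \<Longrightarrow> cmod (of_real \<rho> * exp (2 * of_real pi * \<i> * of_real t)) = \<rho>"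
  by (simp add: norm_mult)

lemma has_circle_mean_cong:
  assumes "has_circle_mean F I \<rho>" "0 < \<rho>" "\<And>\<zeta>. cmod \<zeta> = \<rho> \<Longrightarrow> F \<zeta> = G \<zeta>"
  shows "has_circle_mean G I \<rho>"
  using assms(1) assms(3)[OF cmod_circle[OF assms(2)]] by (simp add: has_circle_mean_def)

lemma has_circle_mean_add:
  "has_circle_mean F I \<rho> \<Longrightarrow> has_circle_mean G J \<rho> \<Longrightarrow> has_circle_mean (\<lambda>\<zeta>. F \<zeta> + G \<zeta>) (I + J) \<rho>"
  unfolding has_circle_mean_def by (rule has_integral_add)

lemma has_circle_mean_mult:
  "has_circle_mean F I \<rho> \<Longrightarrow> has_circle_mean (\<lambda>\<zeta>. a * F \<zeta>) (a * I) \<rho>"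
  unfolding has_circle_mean_def by (rule has_integral_mult_right)

lemma has_circle_mean_sum:
  "finite J \<Longrightarrow> (\<And>m. m \<in> J \<Longrightarrow> has_circle_mean (F m) (I m) \<rho>) \<Longrightarrow>
    has_circle_mean (\<lambda>\<zeta>. \<Sum>m\<in>J. F m \<zeta>) (\<Sum>m\<in>J. I m) \<rho>"
  unfolding has_circle_mean_def by (rule has_integral_sum)

lemma has_circle_mean_cnj:
  "has_circle_mean F I \<rho> \<Longrightarrow> has_circle_mean (\<lambda>\<zeta>. cnj (F \<zeta>)) (cnj I) \<rho>"
  unfolding has_circle_mean_def by (subst (asm) has_integral_cnj[symmetric]) (simp add: o_def)

lemma has_circle_mean_pairing:
  assumes "\<And>x. x \<in> S \<Longrightarrow> has_circle_mean (\<lambda>\<zeta>. F \<zeta> x) (I x) \<rho>" "xs \<in> combos S"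
  shows "has_circle_mean (\<lambda>\<zeta>. pairing (F \<zeta>) xs) (pairing I xs) \<rho>"
  using assms(2)
proof (induction xs)
  case Nil
  show ?case by (simp add: has_circle_mean_def)
next
  case (Cons p xs)
  then show ?case
    using has_circle_mean_add[OF has_circle_mean_mult[OF assms(1)[of "fst p"], of "snd p"]] by simp
qed

lemma has_circle_mean_form:
  assumes "\<And>x y. x \<in> S \<Longrightarrow> y \<in> S \<Longrightarrow> has_circle_mean (\<lambda>\<zeta>. F \<zeta> x y) (I x y) \<rho>"
    and "xs \<in> combos S" "ys \<in> combos S"
  shows "has_circle_mean (\<lambda>\<zeta>. form (F \<zeta>) xs ys) (form I xs ys) \<rho>"
  unfolding form_eq_pairing
  by (intro has_circle_mean_pairing[OF _ assms(2)] has_circle_mean_cnj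
      has_circle_mean_pairing[OF _ assms(3)] assms(1))

lemma has_circle_mean_norm_le:
  assumes F: "has_circle_mean F I \<rho>" and G: "has_circle_mean G J \<rho>" and "0 < \<rho>"
    and le: "\<And>\<zeta>. cmod \<zeta> = \<rho> \<Longrightarrow> cmod (F \<zeta>) \<le> Re (G \<zeta>)"
  shows "cmod I \<le> Re J"
proof -
  let ?z = "\<lambda>t. complex_of_real \<rho> * exp (2 * of_real pi * \<i> * of_real t)"
  have 1: "((\<lambda>t. F (?z t)) has_integral I) {0..1}" using F by (simp add: has_circle_mean_def)
  have 2: "((\<lambda>t. Re (G (?z t))) has_integral Re J) {0..1}"
    using G unfolding has_circle_mean_def by (rule has_integral_Re)
  have "cmod (integral {0..1} (\<lambda>t. F (?z t))) \<le> integral {0..1} (\<lambda>t. Re (G (?z t)))"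
    using 1 2 by (intro integral_norm_bound_integral le cmod_circle[OF \<open>0 < \<rho>\<close>])
      (auto simp: has_integral_integrable)
  then show ?thesis using integral_unique[OF 1] integral_unique[OF 2] by simp
qed

lemma has_circle_mean_contour:
  assumes I: "((\<lambda>\<zeta>. F \<zeta> / \<zeta>) has_contour_integral I) (circlepath 0 \<rho>)" and "0 < \<rho>"
  shows "has_circle_mean F (I / (2 * of_real pi * \<i>)) \<rho>"
proof -
  let ?z = "\<lambda>t. complex_of_real \<rho> * exp (2 * of_real pi * \<i> * of_real t)"
  have "((\<lambda>t. F (circlepath 0 \<rho> t) / circlepath 0 \<rho> t *
      vector_derivative (circlepath 0 \<rho>) (at t within {0..1})) has_integral I) {0..1}"
    using I by (simp add: has_contour_integral_def)
  then have "((\<lambda>t. 1 / (2 * of_real pi * \<i>) * (F (circlepath 0 \<rho> t) / circlepath 0 \<rho> t *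
      vector_derivative (circlepath 0 \<rho>) (at t within {0..1}))) has_integral 1 / (2 * of_real pi * \<i>) * I) {0..1}"
    by (rule has_integral_mult_right)
  then have "((\<lambda>t. F (?z t)) has_integral 1 / (2 * of_real pi * \<i>) * I) {0..1}"
  proof (rule has_integral_eq[rotated])
    fix t :: real assume t: "t \<in> {0..1}"
    have "circlepath 0 \<rho> t = ?z t" by (simp add: circlepath)
    moreover have "?z t \<noteq> 0" using \<open>0 < \<rho>\<close> by simp
    moreover have "vector_derivative (circlepath 0 \<rho>) (at t within {0..1}) = 2 * of_real pi * \<i> * ?z t"
      using t by (simp add: vector_derivative_circlepath01)
    ultimately show "1 / (2 * of_real pi * \<i>) * (F (circlepath 0 \<rho> t) / circlepath 0 \<rho> t *
        vector_derivative (circlepath 0 \<rho>) (at t within {0..1})) = F (?z t)"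
      by (simp add: field_simps)
  qed
  then show ?thesis by (simp add: has_circle_mean_def)
qed

lemma has_circle_mean_cauchy:
  assumes "continuous_on (cball 0 \<rho>) F" "F holomorphic_on (ball 0 \<rho>)" "cmod w < \<rho>"
  shows "has_circle_mean (\<lambda>\<zeta>. F \<zeta> * \<zeta> / (\<zeta> - w)) (F w) \<rho>"
proof -
  have \<rho>: "0 < \<rho>" using assms(3) by (meson le_less_trans norm_ge_zero)
  have "((\<lambda>\<zeta>. F \<zeta> / (\<zeta> - w)) has_contour_integral (2 * of_real pi * \<i> * F w)) (circlepath 0 \<rho>)"
    using assms by (intro Cauchy_integral_circlepath) auto
  then have "((\<lambda>\<zeta>. F \<zeta> * \<zeta> / (\<zeta> - w) / \<zeta>) has_contour_integral (2 * of_real pi * \<i> * F w)) (circlepath 0 \<rho>)"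
    by (rule has_contour_integral_eq) (use \<rho> in \<open>auto simp: path_image_circlepath\<close>)
  then show ?thesis using has_circle_mean_contour[OF _ \<rho>] by fastforce
qed

lemma has_circle_mean_powi:
  assumes "0 < \<rho>"
  shows "has_circle_mean (\<lambda>\<zeta>. \<zeta> powi m) (if m = 0 then 1 else 0) \<rho>"
proof (cases "m = 0")
  case True
  then show ?thesis using has_integral_const_real[of "1::complex" 0 1] by (simp add: has_circle_mean_def)
next
  case False
  have "((\<lambda>\<zeta>. \<zeta> powi (m - 1)) has_contour_integral 0) (circlepath 0 \<rho>)"
  proof (rule Cauchy_theorem_primitive)
    show "((\<lambda>\<zeta>. \<zeta> powi m / of_int m) has_field_derivative \<zeta> powi (m - 1)) (at \<zeta> within - {0})"
      if "\<zeta> \<in> - {0}" for \<zeta> :: complex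
      using that False by (auto intro!: derivative_eq_intros)
    show "path_image (circlepath 0 \<rho>) \<subseteq> - {0}" using assms by (auto simp: path_image_circlepath)
  qed auto
  then have "((\<lambda>\<zeta>. \<zeta> powi m / \<zeta>) has_contour_integral 0) (circlepath 0 \<rho>)"
    by (rule has_contour_integral_eq)
      (use assms in \<open>auto simp: path_image_circlepath power_int_diff\<close>)
  then show ?thesis using has_circle_mean_contour[OF _ assms, of "\<lambda>\<zeta>. \<zeta> powi m" 0] False by simp
qed

lemma cnj_on_circle: "cmod \<zeta> = \<rho> \<Longrightarrow> 0 < \<rho> \<Longrightarrow> cnj \<zeta> = of_real (\<rho>\<^sup>2) / \<zeta>"
  using complex_norm_square[of \<zeta>] by (auto simp: field_simps)

lemma cnj_power_int: "cnj (z powi m) = cnj z powi m"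
  by (simp add: power_int_def)

lemma parseval_laurent:
  assumes "0 < \<rho>" "finite J"
  shows "has_circle_mean (\<lambda>\<zeta>. (\<Sum>m\<in>J. \<alpha> m * \<zeta> powi m) * cnj (\<Sum>m\<in>J. \<alpha> m * \<zeta> powi m))
    (of_real (\<Sum>m\<in>J. (cmod (\<alpha> m))\<^sup>2 * \<rho> powi (2 * m))) \<rho>"
proof -
  let ?c = "\<lambda>m l. \<alpha> m * cnj (\<alpha> l) * of_real (\<rho> powi (2 * l))"
  have mean: "has_circle_mean (\<lambda>\<zeta>. \<Sum>m\<in>J. \<Sum>l\<in>J. ?c m l * \<zeta> powi (m - l))
      (\<Sum>m\<in>J. \<Sum>l\<in>J. ?c m l * (if m - l = 0 then 1 else 0)) \<rho>"
    by (intro has_circle_mean_sum has_circle_mean_mult has_circle_mean_powi assms)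
  have val: "(\<Sum>m\<in>J. \<Sum>l\<in>J. ?c m l * (if m - l = 0 then 1 else 0)) =
      of_real (\<Sum>m\<in>J. (cmod (\<alpha> m))\<^sup>2 * \<rho> powi (2 * m))"
  proof -
    have "(\<Sum>l\<in>J. ?c m l * (if m - l = 0 then 1 else 0)) = of_real ((cmod (\<alpha> m))\<^sup>2 * \<rho> powi (2 * m))"
      if "m \<in> J" for m
    proof -
      have "(\<Sum>l\<in>J. ?c m l * (if m - l = 0 then 1 else 0)) = (\<Sum>l\<in>J. if l = m then ?c m m else 0)"
        by (intro sum.cong) auto
      also have "\<dots> = ?c m m" using that assms(2) by simp
      finally show ?thesis unfolding of_real_mult complex_norm_square .
    qed
    then show ?thesis by (simp only: of_real_sum cong: sum.cong)
  qed
  have eq: "(\<Sum>m\<in>J. \<Sum>l\<in>J. ?c m l * \<zeta> powi (m - l)) =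
      (\<Sum>m\<in>J. \<alpha> m * \<zeta> powi m) * cnj (\<Sum>m\<in>J. \<alpha> m * \<zeta> powi m)" if \<zeta>: "cmod \<zeta> = \<rho>" for \<zeta>
  proof -
    have nz: "\<zeta> \<noteq> 0" using \<zeta> assms(1) by auto
    have "cnj (\<zeta> powi l) = of_real (\<rho> powi (2 * l)) * \<zeta> powi (- l)" for l
    proof -
      have "\<rho> powi (2 * l) = (\<rho>\<^sup>2) powi l" unfolding power_int_mult by simp
      then show ?thesis
        unfolding cnj_power_int cnj_on_circle[OF \<zeta> assms(1)] power_int_divide_distrib
        by (simp only: power_int_minus divide_inverse of_real_power_int)
    qed
    then have trm: "?c m l * \<zeta> powi (m - l) = \<alpha> m * \<zeta> powi m * cnj (\<alpha> l * \<zeta> powi l)" for m l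
      using nz by (simp add: power_int_diff power_int_minus divide_inverse)
    show ?thesis by (simp only: cnj_sum sum_product trm)
  qed
  show ?thesis
    unfolding val[symmetric] by (rule has_circle_mean_cong[OF mean assms(1) eq])
qed

text \<open>
  On the circle, \<open>cnj \<zeta> = \<rho>\<^sup>2 / \<zeta>\<close> turns the conjugated factor into a function that is
  holomorphic in the disc; the Cauchy formula then evaluates it at \<open>z\<close>.
\<close>

lemma cauchy_kernel_mean_outer:
  assumes "cmod z < \<rho>" "cmod w < \<rho>"
  shows "has_circle_mean (\<lambda>\<zeta>. \<zeta> / (\<zeta> - z) * cnj (\<zeta> / (\<zeta> - w))) (1 / (1 - z * cnj w / of_real (\<rho>\<^sup>2))) \<rho>"
proof -
  have \<rho>: "0 < \<rho>" using assms(1) by (meson le_less_trans norm_ge_zero)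
  define F where "F = (\<lambda>\<zeta>. 1 / (1 - \<zeta> * cnj w / of_real (\<rho>\<^sup>2)))"
  have nz: "1 - \<zeta> * cnj w / of_real (\<rho>\<^sup>2) \<noteq> 0" if "cmod \<zeta> \<le> \<rho>" for \<zeta>
  proof
    assume "1 - \<zeta> * cnj w / of_real (\<rho>\<^sup>2) = 0"
    then have "\<zeta> * cnj w = of_real (\<rho>\<^sup>2)" using \<rho> by (simp add: field_simps)
    then have "cmod \<zeta> * cmod w = \<rho>\<^sup>2"
      by (metis norm_mult complex_mod_cnj norm_of_real abs_of_nonneg zero_le_power2)
    moreover have "cmod \<zeta> * cmod w \<le> \<rho> * cmod w" using that by (intro mult_right_mono) auto
    moreover have "\<rho> * cmod w < \<rho> * \<rho>" using assms(2) \<rho> by simp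
    ultimately show False by (simp add: power2_eq_square)
  qed
  have mean: "has_circle_mean (\<lambda>\<zeta>. F \<zeta> * \<zeta> / (\<zeta> - z)) (F z) \<rho>"
    unfolding F_def using nz assms(1)
    by (intro has_circle_mean_cauchy continuous_intros holomorphic_intros) (auto simp: dist_norm less_imp_le)
  show ?thesis
  proof (rule has_circle_mean_cong[OF mean[unfolded F_def] \<rho>])
    fix \<zeta> assume \<zeta>: "cmod \<zeta> = \<rho>"
    have n: "\<zeta> \<noteq> 0" "\<zeta> \<noteq> w" using \<zeta> \<rho> assms by auto
    have "cnj (\<zeta> / (\<zeta> - w)) = 1 / (1 - cnj w / cnj \<zeta>)" using n by (simp add: field_simps)
    also have "\<dots> = 1 / (1 - \<zeta> * cnj w / of_real (\<rho>\<^sup>2))"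
      unfolding cnj_on_circle[OF \<zeta> \<rho>] by (simp add: mult.commute)
    finally show "1 / (1 - \<zeta> * cnj w / of_real (\<rho>\<^sup>2)) * \<zeta> / (\<zeta> - z) = \<zeta> / (\<zeta> - z) * cnj (\<zeta> / (\<zeta> - w))"
      by simp
  qed
qed

text \<open>
  As on the outer circle, but here the conjugated factor has its pole at the point
  \<open>\<sigma>\<^sup>2 / cnj w\<close> inside the disc, and the other factor is evaluated there.
\<close>

lemma cauchy_kernel_mean_inner:
  assumes "0 < \<sigma>" "\<sigma> < cmod z" "\<sigma> < cmod w"
  shows "has_circle_mean (\<lambda>\<zeta>. \<zeta> / (\<zeta> - z) * cnj (\<zeta> / (\<zeta> - w)))
    ((of_real (\<sigma>\<^sup>2) / (z * cnj w)) / (1 - of_real (\<sigma>\<^sup>2) / (z * cnj w))) \<sigma>"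
proof -
  define p where "p = of_real (\<sigma>\<^sup>2) / cnj w"
  have w: "w \<noteq> 0" "z \<noteq> 0" using assms by auto
  have p: "cmod p < \<sigma>"
  proof -
    have "cmod p = \<sigma>\<^sup>2 / cmod w" by (simp add: p_def norm_divide norm_power)
    then show ?thesis using assms w by (simp add: power2_eq_square divide_less_eq)
  qed
  have pz: "p \<noteq> z" using p assms by auto
  define F where "F = (\<lambda>\<zeta>. - p / (\<zeta> - z))"
  have nz: "\<zeta> - z \<noteq> 0" if "cmod \<zeta> \<le> \<sigma>" for \<zeta> using that assms by auto
  have mean: "has_circle_mean (\<lambda>\<zeta>. F \<zeta> * \<zeta> / (\<zeta> - p)) (F p) \<sigma>"
    unfolding F_def using nz p
    by (intro has_circle_mean_cauchy continuous_intros holomorphic_intros) (auto simp: dist_norm less_imp_le)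
  have Fp: "F p = (of_real (\<sigma>\<^sup>2) / (z * cnj w)) / (1 - of_real (\<sigma>\<^sup>2) / (z * cnj w))"
  proof -
    have "of_real (\<sigma>\<^sup>2) / (z * cnj w) = p / z" by (simp add: p_def)
    moreover have "F p = (p / z) / (1 - p / z)" using w pz by (simp add: F_def field_simps)
    ultimately show ?thesis by simp
  qed
  have eq: "F \<zeta> * \<zeta> / (\<zeta> - p) = \<zeta> / (\<zeta> - z) * cnj (\<zeta> / (\<zeta> - w))" if \<zeta>: "cmod \<zeta> = \<sigma>" for \<zeta>
  proof -
    have n: "\<zeta> \<noteq> 0" "\<zeta> \<noteq> w" "\<zeta> \<noteq> p" using \<zeta> assms p by auto
    have "cnj (\<zeta> / (\<zeta> - w)) = 1 / (1 - cnj w / cnj \<zeta>)" using n by (simp add: field_simps)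
    also have "cnj w / cnj \<zeta> = \<zeta> / p"
      unfolding cnj_on_circle[OF \<zeta> assms(1)] p_def by simp
    also have "1 / (1 - \<zeta> / p) = - p / (\<zeta> - p)"
      using n w assms(1) by (simp add: p_def field_simps)
    finally show ?thesis by (simp add: F_def)
  qed
  show ?thesis
    unfolding Fp[symmetric] by (rule has_circle_mean_cong[OF mean assms(1) eq])
qed

lemma open_annulus: "open (annulus r)"
  unfolding annulus_def by (intro open_Collect_conj open_Collect_less continuous_intros)

text \<open>
  The difference quotient \<open>(g \<zeta> - g z) / (\<zeta> - z)\<close> is holomorphic on the annulus, so its integrals
  over the two circles agree; \<open>b\<close> is their common value divided by \<open>2 pi \<i>\<close>.  The circles
  differ only in whether they enclose \<open>z\<close>.
\<close>

lemma annulus_cauchy_formula: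
  assumes g: "g holomorphic_on annulus r" and "0 < r" "r < \<sigma>" "\<sigma> < cmod z" "cmod z < \<rho>" "\<rho> < 1"
  shows "\<exists>b. has_circle_mean (\<lambda>\<zeta>. g \<zeta> * (\<zeta> / (\<zeta> - z))) (g z + b) \<rho> \<and>
    has_circle_mean (\<lambda>\<zeta>. g \<zeta> * (\<zeta> / (\<zeta> - z))) b \<sigma>"
proof -
  define G where "G = (\<lambda>\<zeta>. if \<zeta> = z then deriv g z else (g \<zeta> - g z) / (\<zeta> - z))"
  have G: "G holomorphic_on annulus r"
    unfolding G_def by (rule pole_lemma_open[OF g open_annulus])
  have pos: "0 < \<sigma>" "0 < \<rho>" "\<sigma> < \<rho>" using assms by linarith+
  have circ: "path_image (circlepath 0 s) \<subseteq> annulus r" if "r < s" "s < 1" for s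
    using that \<open>0 < r\<close> by (auto simp: path_image_circlepath annulus_def)
  have homotopic: "homotopic_loops (annulus r) (circlepath 0 \<rho>) (circlepath 0 \<sigma>)"
  proof (rule homotopic_loops_linear)
    fix t :: real assume "t \<in> {0..1}"
    show "closed_segment (circlepath 0 \<rho> t) (circlepath 0 \<sigma> t) \<subseteq> annulus r"
    proof
      fix x assume "x \<in> closed_segment (circlepath 0 \<rho> t) (circlepath 0 \<sigma> t)"
      then obtain u where u: "0 \<le> u" "u \<le> 1"
        "x = (1 - u) *\<^sub>R circlepath 0 \<rho> t + u *\<^sub>R circlepath 0 \<sigma> t"
        by (auto simp: closed_segment_def)
      define s where "s = (1 - u) * \<rho> + u * \<sigma>"
      have "x = of_real s * exp (2 * of_real pi * \<i> * of_real t)"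
        unfolding u(3) s_def by (simp add: circlepath scaleR_conv_of_real algebra_simps)
      moreover have "\<sigma> \<le> s" "s \<le> \<rho>"
      proof -
        have "s = \<sigma> + (1 - u) * (\<rho> - \<sigma>)" "s = \<rho> - u * (\<rho> - \<sigma>)"
          by (simp_all add: s_def algebra_simps)
        moreover have "0 \<le> (1 - u) * (\<rho> - \<sigma>)" "0 \<le> u * (\<rho> - \<sigma>)" using u pos by auto
        ultimately show "\<sigma> \<le> s" "s \<le> \<rho>" by linarith+
      qed
      ultimately show "x \<in> annulus r"
        using cmod_circle[of s t] pos assms by (simp add: annulus_def)
    qed
  qed auto
  define I where "I = contour_integral (circlepath 0 \<sigma>) G"
  have hol: "(G has_contour_integral contour_integral (circlepath 0 s) G) (circlepath 0 s)"
    if "r < s" "s < 1" for s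
    using that circ[OF that] \<open>0 < r\<close>
    by (intro has_contour_integral_integral contour_integrable_holomorphic_simple[OF G open_annulus]) auto
  have I\<sigma>: "(G has_contour_integral I) (circlepath 0 \<sigma>)" unfolding I_def using assms by (intro hol) auto
  have "contour_integral (circlepath 0 \<rho>) G = I"
    unfolding I_def by (rule Cauchy_theorem_homotopic_loops[OF homotopic open_annulus G]) auto
  then have I\<rho>: "(G has_contour_integral I) (circlepath 0 \<rho>)" using hol[of \<rho>] assms by auto
  have "((\<lambda>\<zeta>. g z / (\<zeta> - z)) has_contour_integral 2 * of_real pi * \<i> * g z) (circlepath 0 \<rho>)"
    using assms by (intro Cauchy_integral_circlepath) auto
  from has_contour_integral_add[OF I\<rho> this]
  have "((\<lambda>\<zeta>. g \<zeta> * (\<zeta> / (\<zeta> - z)) / \<zeta>) has_contour_integral I + 2 * of_real pi * \<i> * g z) (circlepath 0 \<rho>)"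
    by (rule has_contour_integral_eq)
      (use assms pos in \<open>auto simp: path_image_circlepath G_def diff_divide_distrib\<close>)
  from has_circle_mean_contour[OF this pos(2)]
  have 1: "has_circle_mean (\<lambda>\<zeta>. g \<zeta> * (\<zeta> / (\<zeta> - z))) (g z + I / (2 * of_real pi * \<i>)) \<rho>"
    by (simp add: add_divide_distrib add.commute)
  have "((\<lambda>\<zeta>. g z / (\<zeta> - z)) has_contour_integral 0) (circlepath 0 \<sigma>)"
  proof (rule Cauchy_theorem_convex_simple)
    show "(\<lambda>\<zeta>. g z / (\<zeta> - z)) holomorphic_on ball 0 (cmod z)"
      by (intro holomorphic_intros) auto
  qed (use assms pos in \<open>auto simp: path_image_circlepath\<close>)
  from has_contour_integral_add[OF I\<sigma> this]
  have "((\<lambda>\<zeta>. g \<zeta> * (\<zeta> / (\<zeta> - z)) / \<zeta>) has_contour_integral I + 0) (circlepath 0 \<sigma>)"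
    by (rule has_contour_integral_eq)
      (use assms pos in \<open>auto simp: path_image_circlepath G_def diff_divide_distrib\<close>)
  from has_circle_mean_contour[OF this pos(1)]
  have "has_circle_mean (\<lambda>\<zeta>. g \<zeta> * (\<zeta> / (\<zeta> - z))) (I / (2 * of_real pi * \<i>)) \<sigma>" by simp
  with 1 show ?thesis by blast
qed

section \<open>The upper bound\<close>

lemma pairing_sum:
  "pairing (\<lambda>x. \<Sum>m\<in>J. \<alpha> m * g m x) xs = (\<Sum>m\<in>J. \<alpha> m * pairing (g m) xs)"
  by (induction J rule: infinite_finite_induct) (simp_all add: pairing_add pairing_mult)

text \<open>
  The Cauchy formula for \<open>g = \<phi> f\<close>, where \<open>f\<close> is the Laurent polynomial, turns the combination
  of values into the difference of the means of \<open>g C\<close> over the two circles, where \<open>C\<close> is the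
  corresponding combination of Cauchy kernels.  On each circle
  \<open>\<bar>\<phi> f C\<bar> \<le> \<bar>f\<bar>\<^sup>2/4 + B\<^sup>2 \<bar>C\<bar>\<^sup>2\<close>; the means of \<open>\<bar>f\<bar>\<^sup>2\<close> are given by Parseval's
  identity, and those of \<open>\<bar>C\<bar>\<^sup>2\<close> add up to the form of \<open>annulus_kernel \<sigma> \<rho>\<close>.
\<close>

lemma annulus_duality_estimate:
  assumes "0 < r" "r < \<sigma>" "0 < \<rho>" "\<rho> < 1"
    and \<phi>: "\<phi> holomorphic_on annulus r" "\<And>z. z \<in> annulus r \<Longrightarrow> cmod (\<phi> z) \<le> B"
    and xs: "xs \<in> combos {z. \<sigma> < cmod z \<and> cmod z < \<rho>}" and J: "finite J" and "\<sigma> < 1" "r < \<rho>"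
  shows "cmod (pairing (\<lambda>z. \<phi> z * (\<Sum>m\<in>J. \<alpha> m * z powi m)) xs) \<le>
    (\<Sum>m\<in>J. (cmod (\<alpha> m))\<^sup>2 * (\<rho> powi (2 * m) + \<sigma> powi (2 * m))) / 4
    + B\<^sup>2 * Re (form (annulus_kernel \<sigma> \<rho>) xs xs)"
proof -
  define f where "f = (\<lambda>z. \<Sum>m\<in>J. \<alpha> m * z powi m)"
  define g where "g = (\<lambda>z. \<phi> z * f z)"
  define C where "C = (\<lambda>\<zeta>. pairing (\<lambda>z. \<zeta> / (\<zeta> - z)) xs)"
  let ?S = "{z. \<sigma> < cmod z \<and> cmod z < \<rho>}"
  have \<sigma>: "0 < \<sigma>" using assms by linarith
  have g: "g holomorphic_on annulus r"
    unfolding g_def f_def using \<open>0 < r\<close> by (intro holomorphic_intros \<phi>(1)) (auto simp: annulus_def)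
  have ex: "\<forall>z\<in>?S. \<exists>b. has_circle_mean (\<lambda>\<zeta>. g \<zeta> * (\<zeta> / (\<zeta> - z))) (g z + b) \<rho> \<and>
      has_circle_mean (\<lambda>\<zeta>. g \<zeta> * (\<zeta> / (\<zeta> - z))) b \<sigma>"
    using annulus_cauchy_formula[OF g assms(1,2) _ _ assms(4)] by blast
  obtain b where b_means: "\<forall>z\<in>?S. has_circle_mean (\<lambda>\<zeta>. g \<zeta> * (\<zeta> / (\<zeta> - z))) (g z + b z) \<rho> \<and>
      has_circle_mean (\<lambda>\<zeta>. g \<zeta> * (\<zeta> / (\<zeta> - z))) (b z) \<sigma>"
    using bchoice[OF ex] ..
  then have b: "\<And>z. z \<in> ?S \<Longrightarrow> has_circle_mean (\<lambda>\<zeta>. g \<zeta> * (\<zeta> / (\<zeta> - z))) (g z + b z) \<rho>"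
      "\<And>z. z \<in> ?S \<Longrightarrow> has_circle_mean (\<lambda>\<zeta>. g \<zeta> * (\<zeta> / (\<zeta> - z))) (b z) \<sigma>"
    by blast+
  have out: "has_circle_mean (\<lambda>\<zeta>. g \<zeta> * C \<zeta>) (pairing g xs + pairing b xs) \<rho>"
    using has_circle_mean_pairing[OF b(1) xs] unfolding pairing_mult pairing_add C_def .
  have inn: "has_circle_mean (\<lambda>\<zeta>. g \<zeta> * C \<zeta>) (pairing b xs) \<sigma>"
    using has_circle_mean_pairing[OF b(2) xs] unfolding pairing_mult C_def .
  let ?D = "\<lambda>\<zeta>. of_real (1/4) * (f \<zeta> * cnj (f \<zeta>)) + of_real (B\<^sup>2) * (C \<zeta> * cnj (C \<zeta>))"
  let ?k\<rho> = "\<lambda>z w. 1 / (1 - z * cnj w / complex_of_real (\<rho>\<^sup>2))"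
  let ?k\<sigma> = "\<lambda>z w. (complex_of_real (\<sigma>\<^sup>2) / (z * cnj w)) / (1 - of_real (\<sigma>\<^sup>2) / (z * cnj w))"
  have bound: "cmod (g \<zeta> * C \<zeta>) \<le> Re (?D \<zeta>)" if "\<zeta> \<in> annulus r" for \<zeta>
  proof -
    have "?D \<zeta> = of_real ((cmod (f \<zeta>))\<^sup>2 / 4 + B\<^sup>2 * (cmod (C \<zeta>))\<^sup>2)"
      unfolding of_real_add of_real_mult complex_norm_square[symmetric] by simp
    then have D: "Re (?D \<zeta>) = (cmod (f \<zeta>))\<^sup>2 / 4 + B\<^sup>2 * (cmod (C \<zeta>))\<^sup>2"
      by (simp only: Re_complex_of_real)
    have "cmod (g \<zeta> * C \<zeta>) = cmod (\<phi> \<zeta>) * (cmod (f \<zeta>) * cmod (C \<zeta>))"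
      by (simp add: g_def norm_mult)
    also have "\<dots> \<le> B * (cmod (f \<zeta>) * cmod (C \<zeta>))"
      by (rule mult_right_mono[OF \<phi>(2)[OF that]]) simp
    also have "\<dots> \<le> (cmod (f \<zeta>))\<^sup>2 / 4 + B\<^sup>2 * (cmod (C \<zeta>))\<^sup>2"
      using zero_le_power2[of "cmod (f \<zeta>) / 2 - B * cmod (C \<zeta>)"]
      by (simp add: power2_diff power_mult_distrib power_divide mult_ac)
    finally show ?thesis unfolding D .
  qed
  have "has_circle_mean ?D (of_real (1/4) * of_real (\<Sum>m\<in>J. (cmod (\<alpha> m))\<^sup>2 * \<rho> powi (2 * m)) +
      of_real (B\<^sup>2) * form ?k\<rho> xs xs) \<rho>"
    unfolding C_def form_product[symmetric] f_def
    by (intro has_circle_mean_add has_circle_mean_mult parseval_laurent assms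
        has_circle_mean_form[OF _ xs xs] cauchy_kernel_mean_outer) auto
  from has_circle_mean_norm_le[OF out this \<open>0 < \<rho>\<close> bound] assms
  have 1: "cmod (pairing g xs + pairing b xs) \<le>
      (\<Sum>m\<in>J. (cmod (\<alpha> m))\<^sup>2 * \<rho> powi (2 * m)) / 4 + B\<^sup>2 * Re (form ?k\<rho> xs xs)"
    by (simp add: annulus_def del: of_real_sum of_real_power)
  have "has_circle_mean ?D (of_real (1/4) * of_real (\<Sum>m\<in>J. (cmod (\<alpha> m))\<^sup>2 * \<sigma> powi (2 * m)) +
      of_real (B\<^sup>2) * form ?k\<sigma> xs xs) \<sigma>"
    unfolding C_def form_product[symmetric] f_def
    by (intro has_circle_mean_add has_circle_mean_mult parseval_laurent assms \<sigma>
        has_circle_mean_form[OF _ xs xs] cauchy_kernel_mean_inner) auto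
  from has_circle_mean_norm_le[OF inn this \<sigma> bound] assms
  have 2: "cmod (pairing b xs) \<le>
      (\<Sum>m\<in>J. (cmod (\<alpha> m))\<^sup>2 * \<sigma> powi (2 * m)) / 4 + B\<^sup>2 * Re (form ?k\<sigma> xs xs)"
    by (simp add: annulus_def del: of_real_sum of_real_power)
  have "annulus_kernel \<sigma> \<rho> = (\<lambda>z w. ?k\<rho> z w + ?k\<sigma> z w)"
    by (intro ext) (simp add: annulus_kernel_def)
  then have form: "form (annulus_kernel \<sigma> \<rho>) xs xs = form ?k\<rho> xs xs + form ?k\<sigma> xs xs"
    by (simp only: form_add)
  have "cmod (pairing g xs) \<le> cmod (pairing g xs + pairing b xs) + cmod (pairing b xs)"
    using norm_triangle_ineq4[of "pairing g xs + pairing b xs" "pairing b xs"] by simp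
  then have "cmod (pairing g xs) \<le>
      ((\<Sum>m\<in>J. (cmod (\<alpha> m))\<^sup>2 * \<rho> powi (2 * m)) + (\<Sum>m\<in>J. (cmod (\<alpha> m))\<^sup>2 * \<sigma> powi (2 * m))) / 4 +
      B\<^sup>2 * (Re (form ?k\<rho> xs xs) + Re (form ?k\<sigma> xs xs))"
    using 1 2 by (simp add: add_divide_distrib distrib_left)
  then show ?thesis
    unfolding form g_def f_def by (simp add: sum.distrib distrib_left)
qed

lemma tendsto_annulus_kernel:
  assumes "0 < r" "z \<in> annulus r" "w \<in> annulus r" "\<sigma> \<longlonglongrightarrow> r" "\<rho> \<longlonglongrightarrow> 1"
  shows "(\<lambda>n. annulus_kernel (\<sigma> n) (\<rho> n) z w) \<longlonglongrightarrow> annulus_kernel r 1 z w"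
proof -
  have bd: "r\<^sup>2 < cmod (z * cnj w)" "cmod (z * cnj w) < 1"
    using annulus_product_bounds[OF assms(1-3)] by auto
  have t: "z * cnj w \<noteq> 0" "z * cnj w \<noteq> 1" "z * cnj w \<noteq> of_real (r\<^sup>2)"
  proof -
    show "z * cnj w \<noteq> 0"
    proof
      assume "z * cnj w = 0"
      then have "r\<^sup>2 < 0" using bd(1) by (simp only: norm_zero)
      then show False by simp
    qed
    show "z * cnj w \<noteq> 1" using bd(2) by (metis less_irrefl norm_one)
    show "z * cnj w \<noteq> of_real (r\<^sup>2)"
      using bd(1) by (metis abs_of_nonneg less_irrefl norm_of_real zero_le_power2)
  qed
  then have "1 - z * cnj w / of_real (1\<^sup>2) \<noteq> 0" "1 - of_real (r\<^sup>2) / (z * cnj w) \<noteq> 0" by auto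
  then show ?thesis
    unfolding annulus_kernel_def using t(1)
    by (intro tendsto_intros assms(4,5)) auto
qed

text \<open>
  The circles are moved to the boundary of the annulus.  Only the estimate passes to the limit,
  so no boundary values of \<open>\<phi>\<close> are needed.
\<close>

lemma annulus_boundary_estimate:
  assumes r: "0 < r" "r < 1"
    and \<phi>: "\<phi> holomorphic_on annulus r" "\<And>z. z \<in> annulus r \<Longrightarrow> cmod (\<phi> z) \<le> B"
    and xs: "xs \<in> combos (annulus r)" and J: "finite J"
  shows "cmod (pairing (\<lambda>z. \<phi> z * (\<Sum>m\<in>J. \<alpha> m * z powi m)) xs) \<le>
    (\<Sum>m\<in>J. (cmod (\<alpha> m))\<^sup>2 * (1 + r powi (2 * m))) / 4
    + B\<^sup>2 * Re (form (annulus_kernel r 1) xs xs)" (is "?L \<le> ?R")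
proof -
  \<comment> \<open>the offset 3 keeps \<open>r < \<sigma> n < \<rho> n < 1\<close> for every \<open>n\<close>\<close>
  define \<epsilon> where "\<epsilon> = (\<lambda>n. (1 - r) / real (n + 3))"
  define \<sigma> where "\<sigma> = (\<lambda>n. r + \<epsilon> n)"
  define \<rho> where "\<rho> = (\<lambda>n. 1 - \<epsilon> n)"
  have "(\<lambda>n. (1 - r) * inverse (real (n + 3))) \<longlonglongrightarrow> (1 - r) * 0"
    by (intro tendsto_mult tendsto_const LIMSEQ_ignore_initial_segment lim_inverse_n)
  then have \<epsilon>0: "\<epsilon> \<longlonglongrightarrow> 0" by (simp add: \<epsilon>_def divide_inverse)
  have \<epsilon>: "0 < \<epsilon> n" "\<epsilon> n < 1 - r" for n
    using r by (auto simp: \<epsilon>_def divide_less_eq)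
  have \<sigma>: "\<sigma> \<longlonglongrightarrow> r" and \<rho>: "\<rho> \<longlonglongrightarrow> 1"
    using tendsto_add[OF tendsto_const[of r] \<epsilon>0] tendsto_diff[OF tendsto_const[of 1] \<epsilon>0]
    by (simp_all add: \<sigma>_def \<rho>_def)
  let ?R = "\<lambda>n. (\<Sum>m\<in>J. (cmod (\<alpha> m))\<^sup>2 * (\<rho> n powi (2 * m) + \<sigma> n powi (2 * m))) / 4
    + B\<^sup>2 * Re (form (annulus_kernel (\<sigma> n) (\<rho> n)) xs xs)"
  have "\<forall>\<^sub>F n in sequentially. \<sigma> n < cmod z \<and> cmod z < \<rho> n" if "z \<in> fst ` set xs" for z
  proof (rule eventually_conj)
    have z: "r < cmod z" "cmod z < 1" using xs that by (auto simp: combos_def annulus_def)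
    show "\<forall>\<^sub>F n in sequentially. \<sigma> n < cmod z" using order_tendstoD(2)[OF \<sigma> z(1)] .
    show "\<forall>\<^sub>F n in sequentially. cmod z < \<rho> n" using order_tendstoD(1)[OF \<rho> z(2)] .
  qed
  then have "\<forall>\<^sub>F n in sequentially. \<forall>z\<in>fst ` set xs. \<sigma> n < cmod z \<and> cmod z < \<rho> n"
    by (intro eventually_ball_finite) auto
  then have "\<forall>\<^sub>F n in sequentially. ?L \<le> ?R n"
  proof (rule eventually_mono)
    fix n assume n: "\<forall>z\<in>fst ` set xs. \<sigma> n < cmod z \<and> cmod z < \<rho> n"
    show "?L \<le> ?R n"
    proof (rule annulus_duality_estimate[OF r(1) _ _ _ \<phi> _ J])
      show "xs \<in> combos {z. \<sigma> n < cmod z \<and> cmod z < \<rho> n}" using n by (auto simp: combos_def)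
    qed (use \<epsilon>[of n] r in \<open>auto simp: \<sigma>_def \<rho>_def\<close>)
  qed
  moreover have "?R \<longlonglongrightarrow> (\<Sum>m\<in>J. (cmod (\<alpha> m))\<^sup>2 * (1 powi (2 * m) + r powi (2 * m))) / 4
    + B\<^sup>2 * Re (form (annulus_kernel r 1) xs xs)"
    using r by (intro tendsto_intros \<rho> \<sigma> form_tendsto[OF _ xs xs] tendsto_annulus_kernel) auto
  ultimately have "?L \<le> (\<Sum>m\<in>J. (cmod (\<alpha> m))\<^sup>2 * (1 powi (2 * m) + r powi (2 * m))) / 4
    + B\<^sup>2 * Re (form (annulus_kernel r 1) xs xs)"
    by (intro tendsto_lowerbound[where F = sequentially]) auto
  then show ?thesis by simp
qed

lemma annulus_kernel_hermitian: "annulus_kernel \<sigma> \<rho> w z = cnj (annulus_kernel \<sigma> \<rho> z w)"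
  by (simp add: annulus_kernel_def mult.commute)

text \<open>
  Let \<open>\<delta>\<^sub>m\<close> be the Laurent moments of the combination modulated by \<open>\<phi>\<close>.  For the truncations of
  \<open>f = \<Sum>\<gamma>\<^sub>m cnj \<delta>\<^sub>m z\<^sup>m\<close> both sides of the boundary estimate involve
  \<open>Q = \<Sum>\<gamma>\<^sub>m \<bar>\<delta>\<^sub>m\<bar>\<^sup>2\<close>: since \<open>\<gamma>\<^sub>m (1 + r\<^bsup>2m\<^esup>) \<le> 2\<close>, it reads
  \<open>Q \<le> Q/2 + B\<^sup>2 \<parallel>xs\<parallel>\<^sup>2\<close>.
\<close>

lemma annulus_upper_bound:
  assumes r: "0 < r" "r < 1"
    and \<phi>: "\<phi> holomorphic_on annulus r" "\<And>z. z \<in> annulus r \<Longrightarrow> cmod (\<phi> z) \<le> B"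
  shows "psd (annulus r) (\<lambda>z w. (of_real ((sqrt 2 * B)\<^sup>2) - \<phi> z * cnj (\<phi> w)) * annulus_kernel r 1 z w)"
proof (rule psdI)
  show "(of_real ((sqrt 2 * B)\<^sup>2) - \<phi> w * cnj (\<phi> z)) * annulus_kernel r 1 w z =
      cnj ((of_real ((sqrt 2 * B)\<^sup>2) - \<phi> z * cnj (\<phi> w)) * annulus_kernel r 1 z w)" for z w
    unfolding annulus_kernel_hermitian[of r 1 w z] by simp
next
  fix xs assume xs: "xs \<in> combos (annulus r)"
  let ?A = "annulus_kernel r 1"
  define ys where "ys = modulate \<phi> xs"
  have ys: "ys \<in> combos (annulus r)" using xs by (simp add: ys_def)
  define \<delta> where "\<delta> = (\<lambda>m :: int. pairing (\<lambda>z. z powi m) ys)"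
  define \<gamma> where "\<gamma> = laurent_weight r"
  have \<gamma>0: "0 \<le> \<gamma> m" for m using r by (simp add: \<gamma>_def laurent_weight_def)
  \<comment> \<open>this is where the factor 2, and with it the constant \<open>sqrt 2\<close>, comes from\<close>
  have \<gamma>: "\<gamma> m * (1 + r powi (2 * m)) \<le> 2" for m
  proof (cases "0 \<le> m")
    case True
    then show ?thesis using r by (simp add: \<gamma>_def laurent_weight_def power_int_le_one)
  next
    case False
    have "r powi (- 2 * m) * r powi (2 * m) = 1" using r by (simp flip: power_int_add)
    moreover have "r powi (- 2 * m) \<le> 1" using r False by (intro power_int_le_one) auto
    ultimately show ?thesis using False by (simp add: \<gamma>_def laurent_weight_def distrib_left)
  qed
  have Q: "(\<Sum>m\<in>{- int N..<int N}. \<gamma> m * (cmod (\<delta> m))\<^sup>2) \<le> 2 * B\<^sup>2 * Re (form ?A xs xs)" for N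
  proof -
    let ?J = "{- int N..<int N}"
    let ?Q = "\<Sum>m\<in>?J. \<gamma> m * (cmod (\<delta> m))\<^sup>2"
    define \<alpha> where "\<alpha> = (\<lambda>m. of_real (\<gamma> m) * cnj (\<delta> m))"
    have "pairing (\<lambda>z. \<phi> z * (\<Sum>m\<in>?J. \<alpha> m * z powi m)) xs = pairing (\<lambda>z. \<Sum>m\<in>?J. \<alpha> m * z powi m) ys"
      by (simp add: ys_def pairing_modulate)
    also have "\<dots> = (\<Sum>m\<in>?J. \<alpha> m * \<delta> m)" unfolding pairing_sum \<delta>_def ..
    also have "\<dots> = of_real ?Q"
      unfolding of_real_sum of_real_mult complex_norm_square \<alpha>_def
      by (intro sum.cong) (simp_all add: mult_ac)
    finally have "cmod (pairing (\<lambda>z. \<phi> z * (\<Sum>m\<in>?J. \<alpha> m * z powi m)) xs) = \<bar>?Q\<bar>"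
      by (simp only: norm_of_real)
    then have "?Q \<le> (\<Sum>m\<in>?J. (cmod (\<alpha> m))\<^sup>2 * (1 + r powi (2 * m))) / 4 + B\<^sup>2 * Re (form ?A xs xs)"
      using annulus_boundary_estimate[OF r \<phi> xs, of ?J \<alpha>] by auto
    also have "(\<Sum>m\<in>?J. (cmod (\<alpha> m))\<^sup>2 * (1 + r powi (2 * m))) \<le> (\<Sum>m\<in>?J. 2 * (\<gamma> m * (cmod (\<delta> m))\<^sup>2))"
    proof (rule sum_mono)
      fix m
      have "(cmod (\<alpha> m))\<^sup>2 * (1 + r powi (2 * m)) =
          (\<gamma> m * (cmod (\<delta> m))\<^sup>2) * (\<gamma> m * (1 + r powi (2 * m)))"
        using \<gamma>0[of m] by (simp add: \<alpha>_def norm_mult power2_eq_square mult_ac)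
      also have "\<dots> \<le> (\<gamma> m * (cmod (\<delta> m))\<^sup>2) * 2"
        using \<gamma>0[of m] by (intro mult_left_mono \<gamma>) simp
      finally show "(cmod (\<alpha> m))\<^sup>2 * (1 + r powi (2 * m)) \<le> 2 * (\<gamma> m * (cmod (\<delta> m))\<^sup>2)" by simp
    qed
    finally show ?thesis by (simp add: sum_distrib_left[symmetric])
  qed
  have "Re (form ?A ys ys) \<le> 2 * B\<^sup>2 * Re (form ?A xs xs)"
    using annulus_form_series[OF r(1) ys] Q unfolding \<gamma>_def \<delta>_def
    by (intro LIMSEQ_le_const2) auto
  then show "0 \<le> Re (form (\<lambda>z w. (of_real ((sqrt 2 * B)\<^sup>2) - \<phi> z * cnj (\<phi> w)) * ?A z w) xs xs)"
    unfolding form_defect ys_def[symmetric]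
    by (simp add: power_mult_distrib flip: of_real_power of_real_mult)
qed

section \<open>The lower bound for \<open>z\<^sup>n + (r/z)\<^sup>n\<close>\<close>

definition unity_root :: "nat \<Rightarrow> complex" where
  "unity_root N = exp (2 * of_real pi * \<i> / of_nat N)"

lemma unity_root_powi_eq_1:
  assumes "0 < N"
  shows "unity_root N powi k = 1 \<longleftrightarrow> int N dvd k"
proof -
  have eq: "unity_root N powi k = exp (\<i> * of_real (2 * pi * of_int k / real N))"
    unfolding unity_root_def exp_power_int by (simp add: mult_ac)
  have "(2 * pi * of_int k / real N = of_int (2 * n) * pi) \<longleftrightarrow> k = n * int N" for n
  proof -
    have "(2 * pi * of_int k / real N = of_int (2 * n) * pi) \<longleftrightarrow> real_of_int k = of_int n * real N"
      using assms by (auto simp: field_simps)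
    also have "\<dots> \<longleftrightarrow> real_of_int k = of_int (n * int N)" by simp
    finally show ?thesis by (simp only: of_int_eq_iff)
  qed
  then show ?thesis
    unfolding eq exp_eq_1 by (auto simp: dvd_def mult.commute)
qed

lemma unity_root_average:
  assumes N: "0 < N"
  shows "(\<Sum>j<N. unity_root N powi (int j * k)) / of_nat N = (if int N dvd k then 1 else 0)"
proof -
  have pw: "unity_root N powi (int j * k) = (unity_root N powi k) ^ j" for j
    by (metis mult.commute power_int_mult power_int_of_nat)
  show ?thesis
  proof (cases "int N dvd k")
    case True
    then have "unity_root N powi k = 1" using N by (simp add: unity_root_powi_eq_1)
    then show ?thesis using N True unfolding pw by simp
  next
    case False
    then have ne: "unity_root N powi k \<noteq> 1" using N by (simp add: unity_root_powi_eq_1)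
    have "(unity_root N powi k) ^ N = unity_root N powi (int N * k)" by (rule pw[symmetric])
    also have "\<dots> = 1" using N by (simp add: unity_root_powi_eq_1)
    finally show ?thesis using False unfolding pw geometric_sum[OF ne] by simp
  qed
qed

text \<open>
  The test combination sits at \<open>N\<close> equidistributed points of the circle of radius
  \<open>s = sqrt r\<close>, and its coefficients are proportional to \<open>cnj \<phi>\<close>.  As \<open>N\<close> grows, only its
  moments of order \<open>\<plusminus> n\<close> survive, each contributing 1 to its squared norm, while the modulated
  combination has moment 2 of order 0 and hence squared norm at least 4.  A bound \<open>M\<close>
  for the modulation therefore satisfies \<open>4 \<le> 2 M\<^sup>2\<close>.
\<close>

lemma annulus_multiplier_lower_bound:
  assumes r: "0 < r" "r < 1" and n: "0 < n"
    and psd: "psd (annulus r) (\<lambda>z w. (of_real (M\<^sup>2) -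
      (z ^ n + of_real (r ^ n) / z ^ n) * cnj (w ^ n + of_real (r ^ n) / w ^ n)) * annulus_kernel r 1 z w)"
  shows "2 \<le> M\<^sup>2"
proof -
  let ?A = "annulus_kernel r 1"
  define \<phi> where "\<phi> = (\<lambda>z :: complex. z ^ n + of_real (r ^ n) / z ^ n)"
  have psd_\<phi>: "psd (annulus r) (\<lambda>z w. (of_real (M\<^sup>2) - \<phi> z * cnj (\<phi> w)) * ?A z w)"
    unfolding \<phi>_def by (rule psd)
  define s where "s = sqrt r"
  have s: "0 < s" "s < 1" "r < s" "s\<^sup>2 = r"
    using r real_sqrt_less_mono[of "r\<^sup>2" r] by (auto simp: s_def power2_eq_square)
  have est: "4 \<le> M\<^sup>2 * (2 + 8 / (1 - s) * s ^ (N - 3 * n))" if N: "3 * n < N" for N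
  proof -
    define \<omega> where "\<omega> = unity_root N"
    \<comment> \<open>\<open>av k\<close> is the average of \<open>\<omega>\<^bsup>jk\<^esup>\<close> over \<open>j < N\<close>\<close>
    define av where "av = (\<lambda>k. if int N dvd k then 1 else 0 :: real)"
    have N0: "0 < N" using N by simp
    have \<omega>0: "\<omega> \<noteq> 0" by (simp add: \<omega>_def unity_root_def)
    have avg: "(\<Sum>j<N. \<omega> powi (int j * k)) / of_nat N = of_real (av k)" for k
      unfolding \<omega>_def av_def unity_root_average[OF N0] by simp
    define x where "x = (\<lambda>j. of_real s * \<omega> powi int j)"
    define c where "c = (\<lambda>j. of_real (1 / s ^ n) *
        (\<omega> powi (int j * int n) + \<omega> powi (int j * - int n)) / of_nat N)"
    define xs where "xs = map (\<lambda>j. (x j, c j)) [0..<N]"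
    have cmod\<omega>: "cmod (\<omega> powi k) = 1" for k
      by (simp add: \<omega>_def unity_root_def norm_power_int)
    have xA: "x j \<in> annulus r" for j
      using s cmod\<omega>[of "int j"] by (simp add: x_def annulus_def norm_mult)
    have xs: "xs \<in> combos (annulus r)" by (auto simp: xs_def combos_def xA)
    have pair: "pairing g xs = (\<Sum>j<N. c j * g (x j))" for g
      by (simp add: pairing_def xs_def o_def interv_sum_list_conv_sum_set_nat atLeast0LessThan)
    have xpow: "x j powi m = of_real (s powi m) * \<omega> powi (int j * m)" for j m
      by (simp add: x_def power_int_mult_distrib power_int_mult)
    have u: "pairing (\<lambda>z. z powi m) xs =
        of_real (s powi m / s ^ n * (av (m + int n) + av (m - int n)))" for m
    proof -
      have trm: "c j * x j powi m = of_real (s powi m / s ^ n) *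
          (\<omega> powi (int j * (m + int n)) / of_nat N + \<omega> powi (int j * (m - int n)) / of_nat N)" for j
      proof -
        have "\<omega> powi (int j * (m + int n)) = \<omega> powi (int j * int n) * \<omega> powi (int j * m)"
          "\<omega> powi (int j * (m - int n)) = \<omega> powi (int j * - int n) * \<omega> powi (int j * m)"
          using \<omega>0 by (simp_all add: algebra_simps flip: power_int_add)
        then show ?thesis unfolding c_def xpow by (simp add: divide_simps algebra_simps)
      qed
      have "pairing (\<lambda>z. z powi m) xs = of_real (s powi m / s ^ n) *
          ((\<Sum>j<N. \<omega> powi (int j * (m + int n))) / of_nat N + (\<Sum>j<N. \<omega> powi (int j * (m - int n))) / of_nat N)"
        by (simp only: pair trm sum_distrib_left[symmetric] sum.distrib sum_divide_distrib)
      then show ?thesis unfolding avg by simp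
    qed
    have \<phi>x: "\<phi> (x j) = of_real (s ^ n) * (\<omega> powi (int j * int n) + \<omega> powi (int j * - int n))" for j
    proof -
      have "x j ^ n = of_real (s ^ n) * \<omega> powi (int j * int n)"
        using xpow[of j "int n"] by simp
      moreover have "of_real (r ^ n) / (of_real (s ^ n) * \<omega> powi (int j * int n)) =
          of_real (s ^ n) * \<omega> powi (int j * - int n)"
      proof -
        have "r ^ n = s ^ n * s ^ n" unfolding s(4)[symmetric] by (simp add: power2_eq_square power_mult_distrib)
        moreover have "\<omega> powi (int j * - int n) = inverse (\<omega> powi (int j * int n))"
          by (simp add: power_int_minus)
        ultimately show ?thesis using s(1) \<omega>0 by (simp add: field_simps)
      qed
      ultimately show ?thesis unfolding \<phi>_def by (simp add: distrib_left)
    qed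
    define ys where "ys = modulate \<phi> xs"
    have ys: "ys \<in> combos (annulus r)" using xs by (simp add: ys_def)
    have v0: "pairing (\<lambda>z. z powi 0) ys = 2"
    proof -
      have trm: "c j * \<phi> (x j) = \<omega> powi (int j * (2 * int n)) / of_nat N + 2 * (\<omega> powi (int j * 0) / of_nat N)
          + \<omega> powi (int j * (- 2 * int n)) / of_nat N" for j
      proof -
        let ?a = "\<omega> powi (int j * int n)" and ?b = "\<omega> powi (int j * - int n)"
        have "?a * ?a = \<omega> powi (int j * (2 * int n))" "?b * ?b = \<omega> powi (int j * (- 2 * int n))" "?a * ?b = 1"
          using \<omega>0 by (simp_all add: algebra_simps flip: power_int_add)
        moreover have "c j * \<phi> (x j) = (?a * ?a + 2 * (?a * ?b) + ?b * ?b) / of_nat N"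
        proof -
          have "c j * \<phi> (x j) =
              of_real (1 / s ^ n * s ^ n) * ((?a + ?b) * (?a + ?b)) / of_nat N"
            unfolding c_def \<phi>x of_real_mult by (simp only: divide_inverse mult_ac)
          also have "1 / s ^ n * s ^ n = 1" using s(1) by simp
          finally show ?thesis by (simp add: algebra_simps)
        qed
        ultimately show ?thesis by (simp add: add_divide_distrib)
      qed
      have "pairing (\<lambda>z. z powi 0) ys = (\<Sum>j<N. c j * \<phi> (x j))"
        using pair[of \<phi>] by (simp add: ys_def pairing_modulate)
      also have "\<dots> = of_real (av (2 * int n)) + 2 * of_real (av 0) + of_real (av (- 2 * int n))"
        unfolding trm sum.distrib sum_distrib_left[symmetric] sum_divide_distrib[symmetric] avg ..
      finally have "pairing (\<lambda>z. z powi 0) ys =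
          of_real (av (2 * int n)) + 2 * of_real (av 0) + of_real (av (- 2 * int n))" .
      moreover have "av (2 * int n) = 0" "av (- 2 * int n) = 0" "av 0 = 1"
        using N n zdvd_not_zless[of "2 * int n" "int N"] by (auto simp: av_def)
      ultimately show ?thesis by simp
    qed
    have lower: "4 \<le> Re (form ?A ys ys)"
    proof (rule LIMSEQ_le_const[OF annulus_form_series[OF r(1) ys]])
      have "4 \<le> (\<Sum>m\<in>{- int K..<int K}. laurent_weight r m * (cmod (pairing (\<lambda>z. z powi m) ys))\<^sup>2)"
        if "1 \<le> K" for K
      proof -
        have "(\<Sum>m\<in>{0}. laurent_weight r m * (cmod (pairing (\<lambda>z. z powi m) ys))\<^sup>2) \<le>
            (\<Sum>m\<in>{- int K..<int K}. laurent_weight r m * (cmod (pairing (\<lambda>z. z powi m) ys))\<^sup>2)"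
          using that r by (intro sum_mono2) (auto simp: laurent_weight_def)
        then show ?thesis using v0 by (simp add: laurent_weight_def)
      qed
      then show "\<exists>K0. \<forall>K\<ge>K0. 4 \<le> (\<Sum>m\<in>{- int K..<int K}. laurent_weight r m * (cmod (pairing (\<lambda>z. z powi m) ys))\<^sup>2)"
        by blast
    qed
    let ?e = "4 * s ^ (N - 3 * n)"
    \<comment> \<open>apart from the orders \<open>\<plusminus> n\<close> only aliased orders \<open>\<bar>m\<bar> \<ge> N - n\<close> contribute\<close>
    have weight: "laurent_weight r m * (cmod (pairing (\<lambda>z. z powi m) xs))\<^sup>2 \<le>
        (if m = int n then 1 else 0) + (if m = - int n then 1 else 0) + ?e * s ^ nat \<bar>m\<bar>" for m
    proof -
      define k where "k = nat \<bar>m\<bar>"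
      have w: "laurent_weight r m * (s powi m)\<^sup>2 = s ^ (2 * k)"
      proof (cases "0 \<le> m")
        case True
        then have "m = int k" by (simp add: k_def)
        then show ?thesis by (simp add: laurent_weight_def power_mult[symmetric] mult.commute)
      next
        case False
        then have m: "m = - int k" by (simp add: k_def)
        have "laurent_weight r m = (s ^ (2 * k)) * (s ^ (2 * k))"
        proof -
          have "laurent_weight r m = r powi int (2 * k)" using False by (simp add: laurent_weight_def m)
          also have "\<dots> = (s\<^sup>2) ^ (2 * k)" unfolding power_int_of_nat s(4) ..
          finally show ?thesis by (simp add: power2_eq_square power_mult_distrib)
        qed
        moreover have "(s powi m)\<^sup>2 = 1 / s ^ (2 * k)"
          unfolding m power_int_minus power_int_of_nat
          by (simp add: power_inverse divide_inverse power_mult[symmetric] mult.commute)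
        ultimately show ?thesis using s(1) by simp
      qed
      define y where "y = av (m + int n) + av (m - int n)"
      have "laurent_weight r m * (cmod (pairing (\<lambda>z. z powi m) xs))\<^sup>2 =
          (laurent_weight r m * (s powi m)\<^sup>2) * y\<^sup>2 / s ^ (2 * n)"
        unfolding u norm_of_real y_def[symmetric] power2_abs
        by (simp add: power_mult_distrib power_divide power_mult[symmetric] mult.commute)
      then have eq: "laurent_weight r m * (cmod (pairing (\<lambda>z. z powi m) xs))\<^sup>2 = s ^ (2 * k) * y\<^sup>2 / s ^ (2 * n)"
        unfolding w .
      have nonneg: "0 \<le> ?e * s ^ nat \<bar>m\<bar>" using s by simp
      have small: "av l = 0" if "l \<noteq> 0" "\<bar>l\<bar> < int N" for l
        using that dvd_imp_le_int[of l "int N"] by (auto simp: av_def)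
      consider "m = int n" | "m = - int n" | "m \<noteq> int n" "m \<noteq> - int n" "\<bar>m\<bar> + int n < int N"
        | "m \<noteq> int n" "m \<noteq> - int n" "int N \<le> \<bar>m\<bar> + int n" by linarith
      then show ?thesis
      proof cases
        case 1
        then have "y = 1" using small[of "m + int n"] n N by (simp add: y_def av_def)
        then show ?thesis using 1 nonneg s(1) unfolding eq by (simp add: k_def)
      next
        case 2
        then have "y = 1" using small[of "m - int n"] n N by (simp add: y_def av_def)
        then show ?thesis using 2 nonneg s(1) unfolding eq by (simp add: k_def)
      next
        case 3
        then have "y = 0" using small[of "m + int n"] small[of "m - int n"] by (simp add: y_def)
        then show ?thesis using 3 nonneg unfolding eq by simp
      next
        case 4
        then have k: "N - n \<le> k" "n \<le> k" using N by (auto simp: k_def)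
        have "0 \<le> y" "y \<le> 2" by (auto simp: y_def av_def)
        then have "y\<^sup>2 \<le> 2\<^sup>2" by (intro power_mono)
        then have "s ^ (2 * k) * y\<^sup>2 / s ^ (2 * n) \<le> s ^ (2 * k) * 4 / s ^ (2 * n)"
          using s by (intro divide_right_mono mult_left_mono) auto
        also have "\<dots> = 4 * (s ^ (2 * k - 2 * n))"
          using s(1) k by (simp add: power_diff)
        also have "2 * k - 2 * n = (k - 2 * n) + k" using k N by simp
        also have "4 * s ^ ((k - 2 * n) + k) = 4 * s ^ (k - 2 * n) * s ^ k" by (simp add: power_add)
        also have "\<dots> \<le> 4 * s ^ (N - 3 * n) * s ^ k"
          using s k by (intro mult_right_mono mult_left_mono power_decreasing) auto
        finally show ?thesis using 4 unfolding eq by (simp add: k_def)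
      qed
    qed
    have upper: "Re (form ?A xs xs) \<le> 2 + 8 / (1 - s) * s ^ (N - 3 * n)"
    proof (rule LIMSEQ_le_const2[OF annulus_form_series[OF r(1) xs]], intro exI allI impI)
      fix K
      let ?J = "{- int K..<int K}"
      have "(\<Sum>m\<in>?J. laurent_weight r m * (cmod (pairing (\<lambda>z. z powi m) xs))\<^sup>2) \<le>
          (\<Sum>m\<in>?J. (if m = int n then 1 else 0) + (if m = - int n then 1 else 0) + ?e * s ^ nat \<bar>m\<bar>)"
        by (rule sum_mono[OF weight])
      also have "\<dots> = (\<Sum>m\<in>?J. if m = int n then 1 else 0) + (\<Sum>m\<in>?J. if m = - int n then 1 else 0)
          + ?e * (\<Sum>m\<in>?J. s ^ nat \<bar>m\<bar>)"
        by (simp only: sum.distrib sum_distrib_left)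
      also have "\<dots> \<le> 1 + 1 + ?e * (2 / (1 - s))"
      proof (intro add_mono mult_left_mono)
        show "(\<Sum>m\<in>?J. if m = int n then 1 else 0) \<le> (1 :: real)"
          "(\<Sum>m\<in>?J. if m = - int n then 1 else 0) \<le> (1 :: real)"
          by (simp_all add: sum.delta)
        have g: "(\<Sum>k<K. s ^ k) \<le> 1 / (1 - s)"
          using sum_le_suminf[OF summable_geometric[of s], of "{..<K}"] s suminf_geometric[of s] by simp
        have "(\<Sum>m\<in>?J. s ^ nat \<bar>m\<bar>) = (\<Sum>k<K. s ^ k + s ^ Suc k)"
          unfolding sum_symmetric_int by (simp add: nat_add_distrib)
        also have "\<dots> \<le> (\<Sum>k<K. 2 * s ^ k)"
          using s by (intro sum_mono) (simp add: mult_left_le_one_le)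
        also have "\<dots> \<le> 2 / (1 - s)" using g by (simp add: sum_distrib_left[symmetric])
        finally show "(\<Sum>m\<in>?J. s ^ nat \<bar>m\<bar>) \<le> 2 / (1 - s)" .
      qed (use s in auto)
      finally show "(\<Sum>m\<in>?J. laurent_weight r m * (cmod (pairing (\<lambda>z. z powi m) xs))\<^sup>2)
          \<le> 2 + 8 / (1 - s) * s ^ (N - 3 * n)" by simp
    qed
    have "Re (form ?A ys ys) \<le> M\<^sup>2 * Re (form ?A xs xs)"
    proof -
      show ?thesis
        using psd_nonneg[OF psd_\<phi> xs] unfolding form_defect ys_def[symmetric] by (simp flip: of_real_power)
    qed
    also have "\<dots> \<le> M\<^sup>2 * (2 + 8 / (1 - s) * s ^ (N - 3 * n))"
      by (rule mult_left_mono[OF upper]) simp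
    finally show ?thesis using lower by linarith
  qed
  have pow0: "(\<lambda>j. s ^ j) \<longlonglongrightarrow> 0" using s by (intro LIMSEQ_realpow_zero) auto
  have "(\<lambda>j. M\<^sup>2 * (2 + 8 / (1 - s) * s ^ j)) \<longlonglongrightarrow> M\<^sup>2 * (2 + 8 / (1 - s) * 0)"
    by (rule tendsto_mult[OF tendsto_const tendsto_add[OF tendsto_const tendsto_mult[OF tendsto_const pow0]]])
  moreover have "4 \<le> M\<^sup>2 * (2 + 8 / (1 - s) * s ^ j)" if "1 \<le> j" for j
    using est[of "j + 3 * n"] that by simp
  ultimately have "4 \<le> M\<^sup>2 * (2 + 8 / (1 - s) * 0)"
    by (intro LIMSEQ_le_const) auto
  then show ?thesis by simp
qed

section \<open>The extension problem\<close>

lemma annulus_weighted_kernel_scale: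
  assumes r: "0 < r" "r < 1"
  shows "psd (annulus r) (\<lambda>z w. c z w * da_kernel (annulus_embedding r z) (annulus_embedding r w)) \<longleftrightarrow>
    psd (annulus r) (\<lambda>z w. c z w * annulus_kernel r 1 z w)"
proof -
  define k where "k = (1 + r\<^sup>2) / (1 - r\<^sup>2)"
  have "r\<^sup>2 < 1" using r by (simp add: power_less_one_iff)
  then have k: "0 < k" by (simp add: k_def add_pos_nonneg)
  have eq: "c z w * da_kernel (annulus_embedding r z) (annulus_embedding r w) =
      of_real k * (c z w * annulus_kernel r 1 z w)" if "z \<in> annulus r" "w \<in> annulus r" for z w
    unfolding da_kernel_annulus[OF r that] k_def by simp
  show ?thesis
  proof
    assume "psd (annulus r) (\<lambda>z w. c z w * da_kernel (annulus_embedding r z) (annulus_embedding r w))"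
    then have "psd (annulus r) (\<lambda>z w. of_real (1 / k) *
        (c z w * da_kernel (annulus_embedding r z) (annulus_embedding r w)))"
      using k by (intro psd_scale) auto
    then show "psd (annulus r) (\<lambda>z w. c z w * annulus_kernel r 1 z w)"
      by (rule psd_cong_imp) (use k in \<open>simp add: eq\<close>)
  next
    assume "psd (annulus r) (\<lambda>z w. c z w * annulus_kernel r 1 z w)"
    then have "psd (annulus r) (\<lambda>z w. of_real k * (c z w * annulus_kernel r 1 z w))"
      using k by (intro psd_scale) auto
    then show "psd (annulus r) (\<lambda>z w. c z w * da_kernel (annulus_embedding r z) (annulus_embedding r w))"
      by (rule psd_cong_imp) (simp add: eq)
  qed
qed

text \<open>
  The Pick condition for \<open>\<phi>\<close> on the annulus; it uses \<open>annulus_kernel\<close>, which differs from the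
  restricted Drury--Arveson kernel by a positive constant factor.
\<close>

definition admissible_bound :: "real \<Rightarrow> (complex \<Rightarrow> complex) \<Rightarrow> real \<Rightarrow> bool" where
  "admissible_bound r \<phi> M \<longleftrightarrow> 0 \<le> M \<and>
     psd (annulus r) (\<lambda>z w. (of_real (M\<^sup>2) - \<phi> z * cnj (\<phi> w)) * annulus_kernel r 1 z w)"

lemma extension_norm_admissible:
  assumes r: "0 < r" "r < 1" and H: "drury_arveson H ip" and s: "s \<in> extension_norms H ip r \<phi>"
  shows "admissible_bound r \<phi> s"
proof -
  interpret rkhs unit_ball2 da_kernel H ip by (rule H)
  obtain \<psi> where \<psi>: "s = mult_norm H ip \<psi>" "\<psi> \<in> multipliers H ip"
    "\<And>z. z \<in> annulus r \<Longrightarrow> \<psi> (annulus_embedding r z) = \<phi> z"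
    using s by (auto simp: extension_norms_def)
  have "psd unit_ball2 (\<lambda>x y. (of_real (s\<^sup>2) - \<psi> x * cnj (\<psi> y)) * da_kernel x y)"
    unfolding \<psi>(1) by (rule multiplier_imp_psd[OF \<psi>(2)])
  then have "psd (annulus_embedding r ` annulus r) (\<lambda>x y. (of_real (s\<^sup>2) - \<psi> x * cnj (\<psi> y)) * da_kernel x y)"
    by (rule psd_mono) (use annulus_embedding_mem[OF r(1)] in blast)
  then have "psd (annulus r) (\<lambda>z w. (of_real (s\<^sup>2) - \<phi> z * cnj (\<phi> w)) *
      da_kernel (annulus_embedding r z) (annulus_embedding r w))"
    unfolding psd_image by (rule psd_cong_imp) (simp add: \<psi>(3))
  then show ?thesis
    unfolding admissible_bound_def annulus_weighted_kernel_scale[OF r]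
    using mult_norm_bound(1)[OF \<psi>(2)] \<psi>(1) by simp
qed

lemma admissible_imp_extension:
  assumes r: "0 < r" "r < 1" and H: "drury_arveson H ip" and M: "admissible_bound r \<phi> M"
  shows "\<exists>s\<in>extension_norms H ip r \<phi>. s \<le> M"
proof -
  interpret rkhs unit_ball2 da_kernel H ip by (rule H)
  have "psd (annulus r) (\<lambda>z w. (of_real (M\<^sup>2) - \<phi> z * cnj (\<phi> w)) *
      da_kernel (annulus_embedding r z) (annulus_embedding r w))"
    unfolding annulus_weighted_kernel_scale[OF r] using M by (simp add: admissible_bound_def)
  then obtain \<psi> where \<psi>: "\<And>z. z \<in> annulus r \<Longrightarrow> \<psi> (annulus_embedding r z) = \<phi> z"
    "psd unit_ball2 (\<lambda>x y. (of_real (M\<^sup>2) - \<psi> x * cnj (\<psi> y)) * da_kernel x y)"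
    using pick_extension[OF complete_pick_drury_arveson, of "annulus_embedding r" "annulus r" M \<phi>]
      annulus_embedding_mem[OF r(1)] by blast
  have "0 \<le> M" using M by (simp add: admissible_bound_def)
  from psd_imp_multiplier[OF \<psi>(2) this] \<psi>(1) show ?thesis
    by (auto simp: extension_norms_def)
qed

text \<open>
  The infimum of the extension norms is therefore admissible, and an extension realising it
  attains the minimum.
\<close>

lemma closed_admissible_bounds: "closed {M. admissible_bound r \<phi> M}"
proof -
  let ?A = "annulus_kernel r 1"
  have herm: "(of_real (M\<^sup>2) - \<phi> w * cnj (\<phi> z)) * ?A w z = cnj ((of_real (M\<^sup>2) - \<phi> z * cnj (\<phi> w)) * ?A z w)"
    for M z w
    unfolding annulus_kernel_hermitian[of r 1 w z] by simp
  have "{M. admissible_bound r \<phi> M} = {0..} \<inter> (\<Inter>xs\<in>combos (annulus r).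
      {M. 0 \<le> M\<^sup>2 * Re (form ?A xs xs) - Re (form ?A (modulate \<phi> xs) (modulate \<phi> xs))})"
    unfolding admissible_bound_def psd_def form_defect using herm by auto
  also have "closed \<dots>"
    by (intro closed_Int closed_INT ballI closed_atLeast closed_Collect_le continuous_intros)
  finally show ?thesis .
qed

lemma admissible_bound_ge:
  assumes r: "0 < r" "r < 1" and M: "admissible_bound r \<phi> M" and z: "z \<in> annulus r"
  shows "cmod (\<phi> z) \<le> M"
proof -
  have "da_kernel (annulus_embedding r z) (annulus_embedding r z) \<noteq> 0"
    using complete_pick_drury_arveson annulus_embedding_mem[OF r(1) z] by (simp add: complete_pick_def)
  then have nz: "annulus_kernel r 1 z z \<noteq> 0" unfolding da_kernel_annulus[OF r z z] by auto
  have "psd (annulus r) (\<lambda>z w. 1 * da_kernel (annulus_embedding r z) (annulus_embedding r w))"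
  proof -
    have "psd (annulus_embedding r ` annulus r) da_kernel"
    proof (rule psd_mono)
      show "psd unit_ball2 da_kernel"
        using complete_pick_drury_arveson unfolding complete_pick_def by (rule conjunct1)
    qed (use annulus_embedding_mem[OF r(1)] in blast)
    then show ?thesis by (simp add: psd_image)
  qed
  then have "psd (annulus r) (\<lambda>z w. 1 * annulus_kernel r 1 z w)"
    unfolding annulus_weighted_kernel_scale[OF r] .
  then have psdA: "psd (annulus r) (annulus_kernel r 1)" by simp
  define k where "k = Re (annulus_kernel r 1 z z)"
  have k: "annulus_kernel r 1 z z = of_real k" "0 < k"
    using psd_diag[OF psdA z] nz by (auto simp: k_def less_le)
  have "0 \<le> Re ((of_real (M\<^sup>2) - \<phi> z * cnj (\<phi> z)) * annulus_kernel r 1 z z)"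
    using M z unfolding admissible_bound_def by (intro psd_diag(2)) auto
  also have "(of_real (M\<^sup>2) - \<phi> z * cnj (\<phi> z)) * annulus_kernel r 1 z z =
      of_real ((M\<^sup>2 - (cmod (\<phi> z))\<^sup>2) * k)"
    unfolding k of_real_mult of_real_diff complex_norm_square ..
  finally have "0 \<le> (M\<^sup>2 - (cmod (\<phi> z))\<^sup>2) * k" by simp
  then have "(cmod (\<phi> z))\<^sup>2 \<le> M\<^sup>2" using k(2) by (simp add: zero_le_mult_iff)
  then show ?thesis by (rule power2_le_imp_le) (use M in \<open>simp add: admissible_bound_def\<close>)
qed

lemma annulus_nonempty: "0 < r \<Longrightarrow> r < 1 \<Longrightarrow> of_real ((1 + r) / 2) \<in> annulus r"
  unfolding annulus_def mem_Collect_eq norm_of_real by simp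

lemma sup_norm_upper:
  assumes "\<phi> \<in> Hinf A" "z \<in> A"
  shows "cmod (\<phi> z) \<le> sup_norm A \<phi>"
proof -
  have "bdd_above ((\<lambda>z. cmod (\<phi> z)) ` A)"
    using assms(1) by (auto simp: Hinf_def bounded_iff bdd_above_def)
  then show ?thesis unfolding sup_norm_def using assms(2) by (rule cSUP_upper2) simp
qed

text \<open>
  With \<open>x = \<bar>z\<bar>\<^sup>n\<close> the claim \<open>x + r\<^sup>n / x \<le> 1 + r\<^sup>n\<close> is \<open>(1 - x) (x - r\<^sup>n) \<ge> 0\<close>.
\<close>

lemma two_mode_function_bound:
  assumes r: "0 < r" "r < 1" and "z \<in> annulus r"
  shows "cmod (z ^ n + of_real (r ^ n) / z ^ n) \<le> 1 + r ^ n"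
proof -
  define x where "x = cmod z ^ n"
  have z: "r < cmod z" "cmod z < 1" using assms by (auto simp: annulus_def)
  have x: "r ^ n \<le> x" "x \<le> 1" "0 < x"
    using z r less_trans[OF r(1) z(1)]
    by (auto simp: x_def simp del: zero_less_norm_iff intro: power_mono power_le_one zero_less_power)
  have "cmod (z ^ n + of_real (r ^ n) / z ^ n) \<le> x + r ^ n / x"
    using norm_triangle_ineq[of "z ^ n" "of_real (r ^ n) / z ^ n"] r
    by (simp add: norm_divide norm_power x_def)
  also have "\<dots> \<le> 1 + r ^ n"
  proof -
    have "0 \<le> (1 - x) * (x - r ^ n)" using x by simp
    then have "x * x + r ^ n \<le> (1 + r ^ n) * x" by (simp add: algebra_simps)
    moreover have "x + r ^ n / x = (x * x + r ^ n) / x" using x by (simp add: field_simps)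
    ultimately show ?thesis using x by (simp add: pos_divide_le_eq)
  qed
  finally show ?thesis .
qed

theorem theorem1p2:
  fixes r :: real
    and H :: "(complex \<times> complex \<Rightarrow> complex) set"
    and ip :: "(complex \<times> complex \<Rightarrow> complex) \<Rightarrow> (complex \<times> complex \<Rightarrow> complex) \<Rightarrow> complex"
  assumes "0 < r" and "r < 1"
    and "drury_arveson H ip"
  shows "(\<forall>\<phi>\<in>Hinf (annulus r).
            (\<exists>m\<in>extension_norms H ip r \<phi>. \<forall>s\<in>extension_norms H ip r \<phi>. m \<le> s) \<and>
            (LEAST s. s \<in> extension_norms H ip r \<phi>)
              \<in> {sup_norm (annulus r) \<phi> .. sqrt 2 * sup_norm (annulus r) \<phi>}) \<and>
         \<not> (\<exists>C<sqrt 2. \<forall>\<phi>\<in>Hinf (annulus r).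
            (LEAST s. s \<in> extension_norms H ip r \<phi>) \<le> C * sup_norm (annulus r) \<phi>)"
proof -
  note r = assms(1,2) and H = assms(3)
  let ?A = "annulus r"
  have nonempty: "?A \<noteq> {}" using annulus_nonempty[OF r] by blast
  have sup_nonneg: "0 \<le> sup_norm ?A \<phi>" if "\<phi> \<in> Hinf ?A" for \<phi>
    using sup_norm_upper[OF that annulus_nonempty[OF r]] norm_ge_zero order_trans by blast
  have minimum: "\<exists>m\<in>extension_norms H ip r \<phi>. admissible_bound r \<phi> m \<and>
      (\<forall>s\<in>extension_norms H ip r \<phi>. m \<le> s) \<and> m \<le> sqrt 2 * sup_norm ?A \<phi>"
    if \<phi>: "\<phi> \<in> Hinf ?A" for \<phi>
  proof -
    let ?E = "extension_norms H ip r \<phi>"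
    have "admissible_bound r \<phi> (sqrt 2 * sup_norm ?A \<phi>)"
      unfolding admissible_bound_def
      using annulus_upper_bound[OF r, of \<phi> "sup_norm ?A \<phi>"] sup_norm_upper[OF \<phi>] sup_nonneg[OF \<phi>] \<phi>
      by (auto simp: Hinf_def)
    then obtain s0 where s0: "s0 \<in> ?E" "s0 \<le> sqrt 2 * sup_norm ?A \<phi>"
      using admissible_imp_extension[OF r H] by blast
    have sub: "?E \<subseteq> {M. admissible_bound r \<phi> M}"
      using extension_norm_admissible[OF r H] by blast
    have bdd: "bdd_below ?E"
      using sub by (intro bdd_belowI[of _ 0]) (auto simp: admissible_bound_def)
    have "Inf ?E \<in> {M. admissible_bound r \<phi> M}"
      using s0(1) by (intro closed_subset_contains_Inf[OF closed_admissible_bounds sub _ bdd]) blast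
    then have adm: "admissible_bound r \<phi> (Inf ?E)" by simp
    then obtain m where m: "m \<in> ?E" "m \<le> Inf ?E"
      using admissible_imp_extension[OF r H] by blast
    have least: "m \<le> s" if "s \<in> ?E" for s
      using m(2) cInf_lower[OF that bdd] by simp
    show ?thesis
      using m(1) least least[OF s0(1)] s0(2) sub by (intro bexI[of _ m]) auto
  qed
  have least: "\<exists>m\<in>extension_norms H ip r \<phi>. \<forall>s\<in>extension_norms H ip r \<phi>. m \<le> s"
      "admissible_bound r \<phi> (LEAST s. s \<in> extension_norms H ip r \<phi>)"
      "(LEAST s. s \<in> extension_norms H ip r \<phi>) \<le> sqrt 2 * sup_norm ?A \<phi>"
    if \<phi>: "\<phi> \<in> Hinf ?A" for \<phi>
  proof -
    obtain m where m: "m \<in> extension_norms H ip r \<phi>" "admissible_bound r \<phi> m"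
      "\<And>s. s \<in> extension_norms H ip r \<phi> \<Longrightarrow> m \<le> s" "m \<le> sqrt 2 * sup_norm ?A \<phi>"
      using minimum[OF \<phi>] by blast
    have "(LEAST s. s \<in> extension_norms H ip r \<phi>) = m"
      using m(1,3) by (rule Least_equality)
    then show "\<exists>m\<in>extension_norms H ip r \<phi>. \<forall>s\<in>extension_norms H ip r \<phi>. m \<le> s"
      "admissible_bound r \<phi> (LEAST s. s \<in> extension_norms H ip r \<phi>)"
      "(LEAST s. s \<in> extension_norms H ip r \<phi>) \<le> sqrt 2 * sup_norm ?A \<phi>"
      using m by auto
  qed
  have lower: "sup_norm ?A \<phi> \<le> (LEAST s. s \<in> extension_norms H ip r \<phi>)" if "\<phi> \<in> Hinf ?A" for \<phi>
    unfolding sup_norm_def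
    by (rule cSUP_least[OF nonempty]) (rule admissible_bound_ge[OF r least(2)[OF that]])
  have sharp: "\<not> (\<exists>C<sqrt 2. \<forall>\<phi>\<in>Hinf ?A. (LEAST s. s \<in> extension_norms H ip r \<phi>) \<le> C * sup_norm ?A \<phi>)"
  proof
    assume "\<exists>C<sqrt 2. \<forall>\<phi>\<in>Hinf ?A. (LEAST s. s \<in> extension_norms H ip r \<phi>) \<le> C * sup_norm ?A \<phi>"
    then obtain C where C: "C < sqrt 2"
      "\<And>\<phi>. \<phi> \<in> Hinf ?A \<Longrightarrow> (LEAST s. s \<in> extension_norms H ip r \<phi>) \<le> C * sup_norm ?A \<phi>"
      by blast
    have "(\<lambda>n. \<bar>C\<bar> * r ^ n) \<longlonglongrightarrow> \<bar>C\<bar> * 0"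
      using r by (intro tendsto_mult tendsto_const LIMSEQ_realpow_zero) auto
    then have "(\<lambda>n. C + \<bar>C\<bar> * r ^ n) \<longlonglongrightarrow> C + \<bar>C\<bar> * 0" by (rule tendsto_add[OF tendsto_const])
    then have "(\<lambda>n. C + \<bar>C\<bar> * r ^ n) \<longlonglongrightarrow> C" by simp
    from order_tendstoD(2)[OF this C(1)] obtain n0 where n0: "\<And>n. n0 \<le> n \<Longrightarrow> C + \<bar>C\<bar> * r ^ n < sqrt 2"
      unfolding eventually_sequentially by blast
    define n where "n = Suc n0"
    define \<phi> where "\<phi> = (\<lambda>z :: complex. z ^ n + of_real (r ^ n) / z ^ n)"
    let ?m = "LEAST s. s \<in> extension_norms H ip r \<phi>"
    have bound: "cmod (\<phi> z) \<le> 1 + r ^ n" if "z \<in> ?A" for z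
      unfolding \<phi>_def by (rule two_mode_function_bound[OF r that])
    have "\<phi> holomorphic_on ?A"
      unfolding \<phi>_def using r by (intro holomorphic_intros) (auto simp: annulus_def)
    then have \<phi>: "\<phi> \<in> Hinf ?A"
      using bound by (auto simp: Hinf_def bounded_iff)
    have "2 \<le> ?m\<^sup>2"
      using least(2)[OF \<phi>] unfolding admissible_bound_def \<phi>_def
      by (intro annulus_multiplier_lower_bound[OF r, of n]) (auto simp: n_def)
    then have "sqrt 2 \<le> ?m"
      using least(2)[OF \<phi>] unfolding admissible_bound_def by (metis real_le_lsqrt real_sqrt_le_iff real_sqrt_unique)
    also have "\<dots> \<le> C * sup_norm ?A \<phi>" by (rule C(2)[OF \<phi>])
    also have "\<dots> \<le> C + \<bar>C\<bar> * r ^ n"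
    proof (cases "0 \<le> C")
      case True
      have "sup_norm ?A \<phi> \<le> 1 + r ^ n"
        unfolding sup_norm_def by (rule cSUP_least[OF nonempty bound])
      then have "C * sup_norm ?A \<phi> \<le> C * (1 + r ^ n)" using True by (rule mult_left_mono)
      then show ?thesis using True by (simp add: algebra_simps)
    next
      case False
      then have "C * sup_norm ?A \<phi> \<le> 0" using sup_nonneg[OF \<phi>] by (simp add: mult_nonpos_nonneg)
      moreover have "C * sup_norm ?A \<phi> \<ge> sqrt 2"
        using \<open>sqrt 2 \<le> ?m\<close> C(2)[OF \<phi>] by linarith
      moreover have "0 < sqrt (2::real)" by simp
      ultimately show ?thesis by linarith
    qed
    also have "\<dots> < sqrt 2" by (rule n0) (simp add: n_def)
    finally show False by simp
  qed
  show ?thesis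
    using least(1,3) lower sharp by auto
qed

end
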